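(* Let $k$ be an algebraically closed field of characteristic $0$, $C$ a finite abelian group, $C^*$ its character group, $t$ a positive integer, and let $g=(g_1,\ldots,g_t)\in C^t$, $g^*=(g_1^*,\ldots,g_t^* )\in (C^* )^t$, $n=(n_1,\ldots,n_t)\in\mathbf{N}^t$ be such that $\langle g_l^*,g_l\rangle$ is a primitive $n_l$-th root of unity for every $l$, and $\langle g_r^*,g_l\rangle=\langle g_l^*,g_r\rangle^{-1}$ for all $r\neq l$. Then the Hopf algebra $K=H(C,n,g^*,g^{-1},0)$ is (isomorphic as a bialgebra to) a smash biproduct $L\,{}_W\!\bowtie_R H$ of the group algebra $L=kC$ and an algebra $H$ that is also a coalgebra, for some $k$-linear maps $R: H\otimes L\to L\otimes H$ and $W: L\otimes H\to H\otimes L$.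
   Context: Here $C^*=\mathrm{Hom}(C,k^{\times})$ and $\langle c^*,c\rangle=c^*(c)$ for $c^*\in C^*$, $c\in C$. The pointed Hopf algebra $K=H(C,n,g^*,g^{-1},0)$: as an algebra, it is generated by the elements of the group $C$ (with the relations of $C$, the identity of $C$ being the unit) and elements $x_1,\ldots,x_t$, subject to the relations $$x_jc=\langle g_j^*,c\rangle\, c\,x_j,\qquad x_jx_k=\langle g_j^*,g_k\rangle\, x_kx_j\ (j\neq k),\qquad x_j^{n_j}=0,$$ for all $c\in C$ and $j,k\in\{1,\ldots,t\}$. Its coalgebra structure and antipode are given by $$\varepsilon(c)=1,\quad \Delta(c)=c\otimes c,\quad \varepsilon(x_i)=0,\quad \Delta(x_i)=x_i\otimes g_i+1\otimes x_i,\quad S(c)=c^{-1},\quad S(x_i)=-x_ig_i^{-1}.$$ The group algebra $L=kC$ carries its usual algebra structure and the coalgebra structure $\Delta(c)=c\otimes c$, $\varepsilon(c)=1$ for $c\in C$. Smash biproduct: let $L$ and $H$ be unital algebras that are also counital coalgebras (not necessarily bialgebras), and let $R: H\otimes L\to L\otimes H$, $W: L\otimes H\to H\otimes L$ be $k$-linear. Write $m$, $\Delta$, $\varepsilon$, $I$ for multiplications, comultiplications, counits and identity maps. $L\,{}_W\!\bowtie_R H$ is the vector space $L\otimes H$ with multiplication $(m_L\otimes m_H)\circ(I_L\otimes R\otimes I_H)$ and comultiplication $(I_L\otimes W\otimes I_H)\circ(\Delta_L\otimes\Delta_H)$. It is called a smash biproduct of $L$ and $H$ if the multiplication is associative with unit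 $1_L\otimes 1_H$, the comultiplication is coassociative with counit $\varepsilon_L\otimes\varepsilon_H$, and with these structures $L\otimes H$ is a bialgebra. *)

theory Defs
  imports "HOL-Algebra.Algebra"
begin

section \<open>Algebras over a ground ring\<close>

(* The library locale for algebras asks the multiplication to be commutative, so it does not apply. *)
definition assoc_algebra ::
    "('k, 'm) ring_scheme \<Rightarrow> ('k, 'a, 'n) module_scheme \<Rightarrow> bool" where
  "assoc_algebra k A \<longleftrightarrow> module k A \<and> ring A \<and>
     (\<forall>r\<in>carrier k. \<forall>x\<in>carrier A. \<forall>y\<in>carrier A.
        (r \<odot>\<^bsub>A\<^esub> x) \<otimes>\<^bsub>A\<^esub> y = r \<odot>\<^bsub>A\<^esub> (x \<otimes>\<^bsub>A\<^esub> y) \<and>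
        x \<otimes>\<^bsub>A\<^esub> (r \<odot>\<^bsub>A\<^esub> y) = r \<odot>\<^bsub>A\<^esub> (x \<otimes>\<^bsub>A\<^esub> y))"

definition linear_map ::
    "('k, 'm) ring_scheme \<Rightarrow> ('k, 'a, 'n) module_scheme \<Rightarrow> ('k, 'b, 'o) module_scheme
       \<Rightarrow> ('a \<Rightarrow> 'b) \<Rightarrow> bool" where
  "linear_map k M N f \<longleftrightarrow> f \<in> carrier M \<rightarrow> carrier N \<and>
     (\<forall>x\<in>carrier M. \<forall>y\<in>carrier M. f (x \<oplus>\<^bsub>M\<^esub> y) = f x \<oplus>\<^bsub>N\<^esub> f y) \<and>
     (\<forall>r\<in>carrier k. \<forall>x\<in>carrier M. f (r \<odot>\<^bsub>M\<^esub> x) = r \<odot>\<^bsub>N\<^esub> f x)"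

definition self_module :: "('k, 'm) ring_scheme \<Rightarrow> ('k, 'k) module" where
  "self_module k = \<lparr>carrier = carrier k, monoid.mult = monoid.mult k, one = \<one>\<^bsub>k\<^esub>,
     ring.zero = \<zero>\<^bsub>k\<^esub>, add = add k, smult = monoid.mult k\<rparr>"

definition quot_module :: "('k, 'a, 'n) module_scheme \<Rightarrow> 'a set \<Rightarrow> ('k, 'a set) module" where
  "quot_module M N =
     ring.extend (M Quot N) (module.fields (\<lambda>r U. \<Union>x\<in>U. N +>\<^bsub>M\<^esub> (r \<odot>\<^bsub>M\<^esub> x)))"

definition submodule_gen ::
    "('k, 'm) ring_scheme \<Rightarrow> ('k, 'a, 'n) module_scheme \<Rightarrow> 'a set \<Rightarrow> 'a set" where
  "submodule_gen k M S = \<Inter>{N. submodule N k M \<and> S \<subseteq> N}"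


section \<open>Free modules and monoid algebras\<close>

(* The record type for modules also carries a multiplication and a unit; they are
   irrelevant for a mere module and left unspecified. *)
definition free_module :: "('k, 'm) ring_scheme \<Rightarrow> 'x set \<Rightarrow> ('k, 'x \<Rightarrow> 'k) module" where
  "free_module k U =
     \<lparr>carrier = {f. (\<forall>x. f x \<in> carrier k) \<and> finite {x. f x \<noteq> \<zero>\<^bsub>k\<^esub>} \<and> {x. f x \<noteq> \<zero>\<^bsub>k\<^esub>} \<subseteq> U},
      monoid.mult = undefined, one = undefined,
      ring.zero = (\<lambda>x. \<zero>\<^bsub>k\<^esub>), add = (\<lambda>f g x. f x \<oplus>\<^bsub>k\<^esub> g x), smult = (\<lambda>r f x. r \<otimes>\<^bsub>k\<^esub> f x)\<rparr>"

definition single :: "('k, 'm) ring_scheme \<Rightarrow> 'x \<Rightarrow> 'x \<Rightarrow> 'k" where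
  "single k a = (\<lambda>x. if x = a then \<one>\<^bsub>k\<^esub> else \<zero>\<^bsub>k\<^esub>)"

(* Linear extension of a map from a basis to a module P. *)
definition lin_ext ::
    "('k, 'm) ring_scheme \<Rightarrow> ('k, 'p, 'n) module_scheme \<Rightarrow> ('x \<Rightarrow> 'p) \<Rightarrow> ('x \<Rightarrow> 'k) \<Rightarrow> 'p" where
  "lin_ext k P f r = (\<Oplus>\<^bsub>P\<^esub>x\<in>{x. r x \<noteq> \<zero>\<^bsub>k\<^esub>}. r x \<odot>\<^bsub>P\<^esub> f x)"

definition monoid_algebra ::
    "('k, 'm) ring_scheme \<Rightarrow> ('x, 'n) monoid_scheme \<Rightarrow> ('k, 'x \<Rightarrow> 'k) module" where
  "monoid_algebra k G = (free_module k (carrier G))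
     \<lparr>monoid.mult := (\<lambda>f g z.
        \<Oplus>\<^bsub>k\<^esub>p\<in>{p. f (fst p) \<noteq> \<zero>\<^bsub>k\<^esub> \<and> g (snd p) \<noteq> \<zero>\<^bsub>k\<^esub> \<and> fst p \<otimes>\<^bsub>G\<^esub> snd p = z}.
          f (fst p) \<otimes>\<^bsub>k\<^esub> g (snd p)),
      one := single k \<one>\<^bsub>G\<^esub>\<rparr>"

definition free_monoid :: "'x set \<Rightarrow> 'x list monoid" where
  "free_monoid U = \<lparr>carrier = lists U, monoid.mult = (@), one = []\<rparr>"

definition free_algebra :: "('k, 'm) ring_scheme \<Rightarrow> 'x set \<Rightarrow> ('k, 'x list \<Rightarrow> 'k) module" where
  "free_algebra k U = monoid_algebra k (free_monoid U)"

(* The algebra homomorphism from a free algebra to A with prescribed values v on the generators. *)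
definition free_algebra_lift ::
    "('k, 'm) ring_scheme \<Rightarrow> ('k, 'a, 'n) module_scheme \<Rightarrow> ('x \<Rightarrow> 'a) \<Rightarrow> ('x list \<Rightarrow> 'k) \<Rightarrow> 'a" where
  "free_algebra_lift k A v = lin_ext k A (\<lambda>w. foldr (\<lambda>x y. v x \<otimes>\<^bsub>A\<^esub> y) w \<one>\<^bsub>A\<^esub>)"


section \<open>Tensor products\<close>

type_synonym ('k, 'a, 'b) tensor = "('a \<times> 'b \<Rightarrow> 'k) set"

definition tensor_rels ::
    "('k, 'm) ring_scheme \<Rightarrow> ('k, 'a, 'n) module_scheme \<Rightarrow> ('k, 'b, 'o) module_scheme
       \<Rightarrow> ('a \<times> 'b \<Rightarrow> 'k) set" where
  "tensor_rels k M N = (let F = free_module k (carrier M \<times> carrier N) in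
     {single k (x \<oplus>\<^bsub>M\<^esub> x', y) \<ominus>\<^bsub>F\<^esub> (single k (x, y) \<oplus>\<^bsub>F\<^esub> single k (x', y)) | x x' y.
        x \<in> carrier M \<and> x' \<in> carrier M \<and> y \<in> carrier N} \<union>
     {single k (x, y \<oplus>\<^bsub>N\<^esub> y') \<ominus>\<^bsub>F\<^esub> (single k (x, y) \<oplus>\<^bsub>F\<^esub> single k (x, y')) | x y y'.
        x \<in> carrier M \<and> y \<in> carrier N \<and> y' \<in> carrier N} \<union>
     {single k (r \<odot>\<^bsub>M\<^esub> x, y) \<ominus>\<^bsub>F\<^esub> r \<odot>\<^bsub>F\<^esub> single k (x, y) | r x y.
        r \<in> carrier k \<and> x \<in> carrier M \<and> y \<in> carrier N} \<union>
     {single k (x, r \<odot>\<^bsub>N\<^esub> y) \<ominus>\<^bsub>F\<^esub> r \<odot>\<^bsub>F\<^esub> single k (x, y) | r x y.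
        r \<in> carrier k \<and> x \<in> carrier M \<and> y \<in> carrier N})"

definition tensor_null ::
    "('k, 'm) ring_scheme \<Rightarrow> ('k, 'a, 'n) module_scheme \<Rightarrow> ('k, 'b, 'o) module_scheme
       \<Rightarrow> ('a \<times> 'b \<Rightarrow> 'k) set" where
  "tensor_null k M N =
     submodule_gen k (free_module k (carrier M \<times> carrier N)) (tensor_rels k M N)"

(* Only the module structure is meaningful here: a multiplication on a tensor product
   is added explicitly where it is needed. *)
definition tensor ::
    "('k, 'm) ring_scheme \<Rightarrow> ('k, 'a, 'n) module_scheme \<Rightarrow> ('k, 'b, 'o) module_scheme
       \<Rightarrow> ('k, ('k, 'a, 'b) tensor) module" where
  "tensor k M N = quot_module (free_module k (carrier M \<times> carrier N)) (tensor_null k M N)"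

definition pure ::
    "('k, 'm) ring_scheme \<Rightarrow> ('k, 'a, 'n) module_scheme \<Rightarrow> ('k, 'b, 'o) module_scheme
       \<Rightarrow> 'a \<Rightarrow> 'b \<Rightarrow> ('k, 'a, 'b) tensor" where
  "pure k M N x y =
     tensor_null k M N +>\<^bsub>free_module k (carrier M \<times> carrier N)\<^esub> single k (x, y)"

(* For f bilinear into P: the induced linear map on the tensor product, computed on a
   representative of the coset U (the choice does not matter when f is bilinear). *)
definition tensor_lift ::
    "('k, 'm) ring_scheme \<Rightarrow> ('k, 'p, 'n) module_scheme \<Rightarrow> ('a \<Rightarrow> 'b \<Rightarrow> 'p)
       \<Rightarrow> ('k, 'a, 'b) tensor \<Rightarrow> 'p" where
  "tensor_lift k P f U = lin_ext k P (\<lambda>(x, y). f x y) (SOME r. r \<in> U)"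

(* The modules M and N are the targets of f and h. *)
definition tensor_map ::
    "('k, 'm) ring_scheme \<Rightarrow> ('k, 'c, 'n) module_scheme \<Rightarrow> ('k, 'd, 'o) module_scheme
       \<Rightarrow> ('a \<Rightarrow> 'c) \<Rightarrow> ('b \<Rightarrow> 'd) \<Rightarrow> ('k, 'a, 'b) tensor \<Rightarrow> ('k, 'c, 'd) tensor" where
  "tensor_map k M N f h = tensor_lift k (tensor k M N) (\<lambda>x y. pure k M N (f x) (h y))"

definition flip ::
    "('k, 'm) ring_scheme \<Rightarrow> ('k, 'a, 'n) module_scheme \<Rightarrow> ('k, 'b, 'o) module_scheme
       \<Rightarrow> ('k, 'a, 'b) tensor \<Rightarrow> ('k, 'b, 'a) tensor" where
  "flip k A B = tensor_lift k (tensor k B A) (\<lambda>a b. pure k B A b a)"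

(* (A B) C \<rightarrow> A (B C) *)
definition tensor_assoc ::
    "('k, 'm) ring_scheme \<Rightarrow> ('k, 'a, 'n) module_scheme \<Rightarrow> ('k, 'b, 'o) module_scheme
       \<Rightarrow> ('k, 'c, 'p) module_scheme
       \<Rightarrow> ('k, ('k, 'a, 'b) tensor, 'c) tensor \<Rightarrow> ('k, 'a, ('k, 'b, 'c) tensor) tensor" where
  "tensor_assoc k A B C = (let T = tensor k A (tensor k B C) in
     tensor_lift k T (\<lambda>u c. tensor_lift k T (\<lambda>a b.
       pure k A (tensor k B C) a (pure k B C b c)) u))"

(* (A B) (C D) \<rightarrow> (A (B C)) D *)
definition middle_in ::
    "('k, 'm) ring_scheme \<Rightarrow> ('k, 'a, 'n) module_scheme \<Rightarrow> ('k, 'b, 'o) module_scheme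
       \<Rightarrow> ('k, 'c, 'p) module_scheme \<Rightarrow> ('k, 'd, 'q) module_scheme
       \<Rightarrow> ('k, ('k, 'a, 'b) tensor, ('k, 'c, 'd) tensor) tensor
       \<Rightarrow> ('k, ('k, 'a, ('k, 'b, 'c) tensor) tensor, 'd) tensor" where
  "middle_in k A B C D =
     (let ABC = tensor k A (tensor k B C); T = tensor k ABC D in
      tensor_lift k T (\<lambda>u v. tensor_lift k T (\<lambda>a b. tensor_lift k T (\<lambda>c d.
        pure k ABC D (pure k A (tensor k B C) a (pure k B C b c)) d) v) u))"

(* (A (B C)) D \<rightarrow> (A B) (C D) *)
definition middle_out ::
    "('k, 'm) ring_scheme \<Rightarrow> ('k, 'a, 'n) module_scheme \<Rightarrow> ('k, 'b, 'o) module_scheme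
       \<Rightarrow> ('k, 'c, 'p) module_scheme \<Rightarrow> ('k, 'd, 'q) module_scheme
       \<Rightarrow> ('k, ('k, 'a, ('k, 'b, 'c) tensor) tensor, 'd) tensor
       \<Rightarrow> ('k, ('k, 'a, 'b) tensor, ('k, 'c, 'd) tensor) tensor" where
  "middle_out k A B C D =
     (let AB = tensor k A B; CD = tensor k C D; T = tensor k AB CD in
      tensor_lift k T (\<lambda>u d. tensor_lift k T (\<lambda>a v. tensor_lift k T (\<lambda>b c.
        pure k AB CD (pure k A B a b) (pure k C D c d)) v) u))"

(* The map I T I from (A B) (C D) to (A B') (C' D), for T from B C to B' C'. *)
definition apply_middle ::
    "('k, 'm) ring_scheme \<Rightarrow> ('k, 'a, 'n) module_scheme \<Rightarrow> ('k, 'b, 'o) module_scheme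
       \<Rightarrow> ('k, 'c, 'p) module_scheme \<Rightarrow> ('k, 'd, 'q) module_scheme
       \<Rightarrow> ('k, 'e, 'r) module_scheme \<Rightarrow> ('k, 'f, 's) module_scheme
       \<Rightarrow> (('k, 'b, 'c) tensor \<Rightarrow> ('k, 'e, 'f) tensor)
       \<Rightarrow> ('k, ('k, 'a, 'b) tensor, ('k, 'c, 'd) tensor) tensor
       \<Rightarrow> ('k, ('k, 'a, 'e) tensor, ('k, 'f, 'd) tensor) tensor" where
  "apply_middle k A B C D B' C' T =
     middle_out k A B' C' D \<circ>
     tensor_map k (tensor k A (tensor k B' C')) D
       (tensor_map k A (tensor k B' C') (\<lambda>a. a) T) (\<lambda>d. d) \<circ>
     middle_in k A B C D"


section \<open>Coalgebras and bialgebras\<close>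

record ('k, 'a) bialg = "('k, 'a) module" +
  comult :: "'a \<Rightarrow> ('a \<times> 'a \<Rightarrow> 'k) set"
  counit :: "'a \<Rightarrow> 'k"

record ('k, 'a) hopf = "('k, 'a) bialg" +
  antipode :: "'a \<Rightarrow> 'a"

definition coalgebra ::
    "('k, 'm) ring_scheme \<Rightarrow> ('k, 'a, 'n) bialg_scheme \<Rightarrow> bool" where
  "coalgebra k A \<longleftrightarrow> module k A \<and>
     linear_map k A (tensor k A A) (comult A) \<and>
     linear_map k A (self_module k) (counit A) \<and>
     (\<forall>x\<in>carrier A.
        tensor_assoc k A A A (tensor_map k (tensor k A A) A (comult A) (\<lambda>y. y) (comult A x)) =
          tensor_map k A (tensor k A A) (\<lambda>y. y) (comult A) (comult A x) \<and>
        tensor_lift k A (\<lambda>y z. counit A y \<odot>\<^bsub>A\<^esub> z) (comult A x) = x \<and>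
        tensor_lift k A (\<lambda>y z. counit A z \<odot>\<^bsub>A\<^esub> y) (comult A x) = x)"

definition mult_map ::
    "('k, 'm) ring_scheme \<Rightarrow> ('k, 'a, 'n) module_scheme \<Rightarrow> ('k, 'a, 'a) tensor \<Rightarrow> 'a" where
  "mult_map k A = tensor_lift k A (\<lambda>x y. x \<otimes>\<^bsub>A\<^esub> y)"

definition smash_mult ::
    "('k, 'm) ring_scheme \<Rightarrow> ('k, 'l, 'n) module_scheme \<Rightarrow> ('k, 'h, 'o) module_scheme
       \<Rightarrow> (('k, 'h, 'l) tensor \<Rightarrow> ('k, 'l, 'h) tensor)
       \<Rightarrow> ('k, 'l, 'h) tensor \<Rightarrow> ('k, 'l, 'h) tensor \<Rightarrow> ('k, 'l, 'h) tensor" where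
  "smash_mult k L H R U V =
     tensor_map k L H (mult_map k L) (mult_map k H)
       (apply_middle k L H L H L H R (pure k (tensor k L H) (tensor k L H) U V))"

definition smash_comult ::
    "('k, 'm) ring_scheme \<Rightarrow> ('k, 'l, 'n) bialg_scheme \<Rightarrow> ('k, 'h, 'o) bialg_scheme
       \<Rightarrow> (('k, 'l, 'h) tensor \<Rightarrow> ('k, 'h, 'l) tensor)
       \<Rightarrow> ('k, 'l, 'h) tensor \<Rightarrow> ('k, ('k, 'l, 'h) tensor, ('k, 'l, 'h) tensor) tensor" where
  "smash_comult k L H W U =
     apply_middle k L L H H H L W
       (tensor_map k (tensor k L L) (tensor k H H) (comult L) (comult H) U)"

(* The usual product (a b)(a' b') = aa' bb' on a tensor product of algebras. *)
definition tensor_algebra ::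
    "('k, 'm) ring_scheme \<Rightarrow> ('k, 'a, 'n) module_scheme \<Rightarrow> ('k, 'b, 'o) module_scheme
       \<Rightarrow> ('k, ('k, 'a, 'b) tensor) module" where
  "tensor_algebra k A B = (tensor k A B)
     \<lparr>monoid.mult := smash_mult k A B (flip k B A), one := pure k A B \<one>\<^bsub>A\<^esub> \<one>\<^bsub>B\<^esub>\<rparr>"

definition bialgebra ::
    "('k, 'm) ring_scheme \<Rightarrow> ('k, 'a, 'n) bialg_scheme \<Rightarrow> bool" where
  "bialgebra k A \<longleftrightarrow> assoc_algebra k A \<and> coalgebra k A \<and>
     comult A \<in> ring_hom A (tensor_algebra k A A) \<and> counit A \<in> ring_hom A k"

definition bialgebra_iso ::
    "('k, 'm) ring_scheme \<Rightarrow> ('k, 'a, 'n) bialg_scheme \<Rightarrow> ('k, 'b, 'o) bialg_scheme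
       \<Rightarrow> ('a \<Rightarrow> 'b) \<Rightarrow> bool" where
  "bialgebra_iso k A B f \<longleftrightarrow> linear_map k A B f \<and> f \<in> ring_hom A B \<and>
     bij_betw f (carrier A) (carrier B) \<and>
     (\<forall>x\<in>carrier A. comult B (f x) = tensor_map k B B f f (comult A x) \<and>
        counit B (f x) = counit A x)"


section \<open>Smash biproducts\<close>

definition smash ::
    "('k, 'm) ring_scheme \<Rightarrow> ('k, 'l, 'n) bialg_scheme \<Rightarrow> ('k, 'h, 'o) bialg_scheme
       \<Rightarrow> (('k, 'h, 'l) tensor \<Rightarrow> ('k, 'l, 'h) tensor)
       \<Rightarrow> (('k, 'l, 'h) tensor \<Rightarrow> ('k, 'h, 'l) tensor)
       \<Rightarrow> ('k, ('k, 'l, 'h) tensor) bialg" where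
  "smash k L H R W = module.extend
     ((tensor k L H)\<lparr>monoid.mult := smash_mult k L H R, one := pure k L H \<one>\<^bsub>L\<^esub> \<one>\<^bsub>H\<^esub>\<rparr>)
     (bialg.fields (smash_comult k L H W)
       (tensor_lift k (self_module k) (\<lambda>x y. counit L x \<otimes>\<^bsub>k\<^esub> counit H y)))"

definition smash_biproduct ::
    "('k, 'm) ring_scheme \<Rightarrow> ('k, 'l, 'n) bialg_scheme \<Rightarrow> ('k, 'h, 'o) bialg_scheme
       \<Rightarrow> (('k, 'h, 'l) tensor \<Rightarrow> ('k, 'l, 'h) tensor)
       \<Rightarrow> (('k, 'l, 'h) tensor \<Rightarrow> ('k, 'h, 'l) tensor) \<Rightarrow> bool" where
  "smash_biproduct k L H R W \<longleftrightarrow>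
     assoc_algebra k L \<and> coalgebra k L \<and> assoc_algebra k H \<and> coalgebra k H \<and>
     linear_map k (tensor k H L) (tensor k L H) R \<and>
     linear_map k (tensor k L H) (tensor k H L) W \<and>
     bialgebra k (smash k L H R W)"


section \<open>Group algebras\<close>

definition group_algebra ::
    "('k, 'm) ring_scheme \<Rightarrow> ('c, 'n) monoid_scheme \<Rightarrow> ('k, 'c \<Rightarrow> 'k) bialg" where
  "group_algebra k C = (let A = monoid_algebra k C in module.extend A
     (bialg.fields
       (lin_ext k (tensor k A A) (\<lambda>c. pure k A A (single k c) (single k c)))
       (lin_ext k (self_module k) (\<lambda>c. \<one>\<^bsub>k\<^esub>))))"


section \<open>The pointed Hopf algebra\<close>

definition primitive_root_of_unity :: "('k, 'm) ring_scheme \<Rightarrow> nat \<Rightarrow> 'k \<Rightarrow> bool" where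
  "primitive_root_of_unity k n z \<longleftrightarrow> 0 < n \<and> z \<in> carrier k \<and> z [^]\<^bsub>k\<^esub> n = \<one>\<^bsub>k\<^esub> \<and>
     (\<forall>m. 0 < m \<and> m < n \<longrightarrow> z [^]\<^bsub>k\<^esub> m \<noteq> \<one>\<^bsub>k\<^esub>)"

datatype 'c gen = Elt 'c | Var nat

definition hopf_gens :: "('c, 'n) monoid_scheme \<Rightarrow> nat \<Rightarrow> 'c gen set" where
  "hopf_gens C t = Elt ` carrier C \<union> Var ` {1..t}"

definition hopf_rels ::
    "('k, 'm) ring_scheme \<Rightarrow> ('c, 'n) monoid_scheme \<Rightarrow> nat \<Rightarrow> (nat \<Rightarrow> nat)
       \<Rightarrow> (nat \<Rightarrow> 'c \<Rightarrow> 'k) \<Rightarrow> (nat \<Rightarrow> 'c) \<Rightarrow> ('c gen list \<Rightarrow> 'k) set" where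
  "hopf_rels k C t n gs g = (let F = free_algebra k (hopf_gens C t) in
     {single k [Elt c, Elt d] \<ominus>\<^bsub>F\<^esub> single k [Elt (c \<otimes>\<^bsub>C\<^esub> d)] | c d.
        c \<in> carrier C \<and> d \<in> carrier C} \<union>
     {single k [Elt \<one>\<^bsub>C\<^esub>] \<ominus>\<^bsub>F\<^esub> \<one>\<^bsub>F\<^esub>} \<union>
     {single k [Var j, Elt c] \<ominus>\<^bsub>F\<^esub> gs j c \<odot>\<^bsub>F\<^esub> single k [Elt c, Var j] | j c.
        j \<in> {1..t} \<and> c \<in> carrier C} \<union>
     {single k [Var j, Var i] \<ominus>\<^bsub>F\<^esub> gs j (g i) \<odot>\<^bsub>F\<^esub> single k [Var i, Var j] | j i.
        j \<in> {1..t} \<and> i \<in> {1..t} \<and> j \<noteq> i} \<union>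
     {single k (replicate (n j) (Var j)) | j. j \<in> {1..t}})"

definition hopf_ideal ::
    "('k, 'm) ring_scheme \<Rightarrow> ('c, 'n) monoid_scheme \<Rightarrow> nat \<Rightarrow> (nat \<Rightarrow> nat)
       \<Rightarrow> (nat \<Rightarrow> 'c \<Rightarrow> 'k) \<Rightarrow> (nat \<Rightarrow> 'c) \<Rightarrow> ('c gen list \<Rightarrow> 'k) set" where
  "hopf_ideal k C t n gs g = Idl\<^bsub>free_algebra k (hopf_gens C t)\<^esub> (hopf_rels k C t n gs g)"

(* This is H(C, n, gs, g^-1, 0), parametrised by g itself: the generators x_i satisfy
     x_i c = gs_i(c) c x_i,   x_j x_i = gs_j(g_i) x_i x_j,   x_i^(n_i) = 0,
     Delta(x_i) = x_i (x) g_i + 1 (x) x_i,   S(x_i) = - x_i g_i^-1 .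

   Comultiplication, counit and antipode are the algebra homomorphisms (for the antipode:
   into the opposite algebra) with prescribed values on the generators. They are
   evaluated on a representative in the free algebra of the given coset. *)
definition pointed_hopf ::
    "('k, 'm) ring_scheme \<Rightarrow> ('c, 'n) monoid_scheme \<Rightarrow> nat \<Rightarrow> (nat \<Rightarrow> nat)
       \<Rightarrow> (nat \<Rightarrow> 'c \<Rightarrow> 'k) \<Rightarrow> (nat \<Rightarrow> 'c) \<Rightarrow> ('k, ('c gen list \<Rightarrow> 'k) set) hopf" where
  "pointed_hopf k C t n gs g =
     (let F = free_algebra k (hopf_gens C t);
          I = hopf_ideal k C t n gs g;
          A = quot_module F I;
          cls = (\<lambda>w. I +>\<^bsub>F\<^esub> single k w);
          D = (\<lambda>a. case a of
                 Elt c \<Rightarrow> pure k A A (cls [Elt c]) (cls [Elt c])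
               | Var i \<Rightarrow> pure k A A (cls [Var i]) (cls [Elt (g i)])
                          \<oplus>\<^bsub>tensor k A A\<^esub> pure k A A \<one>\<^bsub>A\<^esub> (cls [Var i]));
          e = (\<lambda>a. case a of Elt c \<Rightarrow> \<one>\<^bsub>k\<^esub> | Var i \<Rightarrow> \<zero>\<^bsub>k\<^esub>);
          S = (\<lambda>a. case a of
                 Elt c \<Rightarrow> cls [Elt (inv\<^bsub>C\<^esub> c)]
               | Var i \<Rightarrow> \<ominus>\<^bsub>A\<^esub> (cls [Var i] \<otimes>\<^bsub>A\<^esub> cls [Elt (inv\<^bsub>C\<^esub> (g i))]))
      in bialg.extend
        (module.extend A
          (bialg.fields
            (\<lambda>U. free_algebra_lift k (tensor_algebra k A A) D (SOME f. f \<in> U))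
            (\<lambda>U. free_algebra_lift k (self_module k) e (SOME f. f \<in> U))))
        (hopf.fields
          (\<lambda>U. free_algebra_lift k (A\<lparr>monoid.mult := (\<lambda>x y. y \<otimes>\<^bsub>A\<^esub> x)\<rparr>) S (SOME f. f \<in> U))))"

end

(* For an exponent a let x^a = x_1^a_1 ... x_t^a_t.  Take H to be the vector space on the monomials x^a
   with a_i < n_i for all i, with the product of the x_i in K, and with the braided coproduct in which
   the x_i are primitive.  The maps R(x^a (x) c) = <a, c> c (x) x^a and W(c (x) x^a) = x^a (x) c g^a,
   where <a, c> is the product of the g_i^*(c)^a_i and g^a that of the g_i^a_i, carry all the
   interaction with the group.  Both structures are given by structure constants: the product by a
   bicharacter chi, the coproduct by gam, a product of Gaussian binomial coefficients and of the inverse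
   of chi.  Coassociativity is a cocycle identity for gam.  The coproduct of the smash biproduct S
   respects left multiplication by a generator x_i by a q-Pascal recurrence for gam, in which x_i^n_i = 0
   is harmless because the Gaussian binomials at a primitive n_i-th root of unity vanish there; as S is
   generated by C and the x_i, the coproduct is multiplicative.
   The generators of S satisfy the relations of K, which gives a surjection from K to S; the linear map
   from S to K sending c (x) x^a to the ordered monomial c x^a commutes with left multiplication by
   generators, so it is inverse to that surjection.  The coproducts of S and K then agree because
   both are algebra maps that agree on generators. *)

theory Submission
  imports Defs
begin

section \<open>Linear and bilinear maps\<close>

text \<open>As \<open>K\<close> is a quotient of a free algebra, nothing is known beforehand about
  the independence of its ordered monomials. The smash biproduct supplies it: it is built from free
  modules, and since the homomorphism from the free algebra onto it kills the relations, the
  comparison map is injective without any rewriting argument in \<open>K\<close>.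

  The inverse of \<open>chi\<close> in \<open>gam\<close> records an x_i passing a g_j. In Delta(x_1
  x_2) the term with x_2 on the left is (1 (x) x_1)(x_2 (x) g_2), which is \<open>gs 1 (g 2)\<close>
  times x_2 (x) g_2 x_1; by skewness this scalar is the inverse of \<open>gs 2 (g 1)\<close>, the
  factor that sorts x_2 x_1. Equal variables meet with a root of unity instead, which produces the
  Gaussian binomials.

  Tensors and the structure maps of \<open>K\<close> are evaluated at representatives chosen by
  \<open>SOME\<close>, so maps are handled through their values on spanning families. Monomials
  exist for every exponent and are zero beyond the bounds \<open>n i\<close>; the price is checking
  that the structure constants respect these zeros.\<close>

definition bilinear ::
    "('k, 'm) ring_scheme \<Rightarrow> ('k, 'a, 'n) module_scheme \<Rightarrow> ('k, 'b, 'o) module_scheme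
       \<Rightarrow> ('k, 'c, 'p) module_scheme \<Rightarrow> ('a \<Rightarrow> 'b \<Rightarrow> 'c) \<Rightarrow> bool" where
  "bilinear k M N P f \<longleftrightarrow> (\<forall>x\<in>carrier M. linear_map k N P (f x)) \<and>
     (\<forall>y\<in>carrier N. linear_map k M P (\<lambda>x. f x y))"

text \<open>Phrased through submodules instead of linear combinations, so that it serves directly as
  an induction principle. Independence is no part of it: members of a spanning family may coincide
  or vanish.\<close>

definition spans ::
    "('k, 'm) ring_scheme \<Rightarrow> ('k, 'a, 'n) module_scheme \<Rightarrow> 'a set \<Rightarrow> bool" where
  "spans k M B \<longleftrightarrow> B \<subseteq> carrier M \<and> (\<forall>N. submodule N k M \<longrightarrow> B \<subseteq> N \<longrightarrow> carrier M \<subseteq> N)"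

lemma linear_mapI:
  assumes "\<And>x. x \<in> carrier M \<Longrightarrow> f x \<in> carrier N"
    and "\<And>x y. x \<in> carrier M \<Longrightarrow> y \<in> carrier M \<Longrightarrow> f (x \<oplus>\<^bsub>M\<^esub> y) = f x \<oplus>\<^bsub>N\<^esub> f y"
    and "\<And>r x. r \<in> carrier k \<Longrightarrow> x \<in> carrier M \<Longrightarrow> f (r \<odot>\<^bsub>M\<^esub> x) = r \<odot>\<^bsub>N\<^esub> f x"
  shows "linear_map k M N f"
  using assms by (auto simp: linear_map_def)

lemma linear_mapD:
  assumes "linear_map k M N f"
  shows linear_map_closed: "x \<in> carrier M \<Longrightarrow> f x \<in> carrier N"
    and linear_map_add: "x \<in> carrier M \<Longrightarrow> y \<in> carrier M \<Longrightarrow> f (x \<oplus>\<^bsub>M\<^esub> y) = f x \<oplus>\<^bsub>N\<^esub> f y"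
    and linear_map_smult: "r \<in> carrier k \<Longrightarrow> x \<in> carrier M \<Longrightarrow> f (r \<odot>\<^bsub>M\<^esub> x) = r \<odot>\<^bsub>N\<^esub> f x"
  using assms by (auto simp: linear_map_def)

lemma linear_map_comp:
  "linear_map k M N f \<Longrightarrow> linear_map k N P h \<Longrightarrow> linear_map k M P (\<lambda>x. h (f x))"
  by (auto simp: linear_map_def Pi_iff)

lemma linear_map_id: "linear_map k M M (\<lambda>x. x)"
  by (simp add: linear_map_def)

lemma linear_map_cong:
  assumes "linear_map k M N f" "module k M" "\<And>x. x \<in> carrier M \<Longrightarrow> h x = f x"
  shows "linear_map k M N h"
proof -
  interpret M: module k M by fact
  show ?thesis using assms(1,3) by (auto simp: linear_map_def)
qed

lemma linear_map_record_cong: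
  assumes "carrier M' = carrier M" "add M' = add M" "smult M' = smult M"
    "carrier N' = carrier N" "add N' = add N" "smult N' = smult N"
  shows "linear_map k M' N' f \<longleftrightarrow> linear_map k M N f"
  using assms by (simp add: linear_map_def)

lemma module_record_cong:
  assumes "module k M" "carrier M' = carrier M" "add M' = add M" "smult M' = smult M"
    "ring.zero M' = ring.zero M"
  shows "module k M'"
proof -
  interpret M: module k M by fact
  have "abelian_group M'"
    by (rule abelian_groupI) (use assms M.l_neg in \<open>auto simp: M.a_ac\<close>)
  then show ?thesis
    by (intro moduleI) (use assms M.R.is_cring in \<open>auto simp: M.smult_l_distr M.smult_r_distr M.smult_assoc1\<close>)
qed

lemma finsum_record_cong:
  assumes "carrier M' = carrier M" "add M' = add M" "ring.zero M' = ring.zero M"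
  shows "finsum M' f A = finsum M f A"
  using assms by (simp add: finsum_def finprod_def)

lemma linear_map_zero:
  assumes "module k M" "module k N" "linear_map k M N f"
  shows "f \<zero>\<^bsub>M\<^esub> = \<zero>\<^bsub>N\<^esub>"
proof -
  interpret M: module k M by fact
  interpret N: module k N by fact
  have "f \<zero>\<^bsub>M\<^esub> = f (\<zero>\<^bsub>k\<^esub> \<odot>\<^bsub>M\<^esub> \<zero>\<^bsub>M\<^esub>)" by simp
  also have "\<dots> = \<zero>\<^bsub>k\<^esub> \<odot>\<^bsub>N\<^esub> f \<zero>\<^bsub>M\<^esub>"
    by (rule linear_map_smult[OF assms(3)]) auto
  also have "\<dots> = \<zero>\<^bsub>N\<^esub>" using linear_map_closed[OF assms(3)] by simp
  finally show ?thesis .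
qed

lemma linear_map_neg:
  assumes "module k M" "module k N" "linear_map k M N f" "x \<in> carrier M"
  shows "f (\<ominus>\<^bsub>M\<^esub> x) = \<ominus>\<^bsub>N\<^esub> f x"
proof -
  interpret M: module k M by fact
  interpret N: module k N by fact
  have "\<ominus>\<^bsub>M\<^esub> x = (\<ominus>\<^bsub>k\<^esub> \<one>\<^bsub>k\<^esub>) \<odot>\<^bsub>M\<^esub> x" using assms(4) by (simp add: M.smult_l_minus)
  also have "f \<dots> = (\<ominus>\<^bsub>k\<^esub> \<one>\<^bsub>k\<^esub>) \<odot>\<^bsub>N\<^esub> f x"
    by (rule linear_map_smult[OF assms(3)]) (use assms(4) in auto)
  also have "\<dots> = \<ominus>\<^bsub>N\<^esub> f x"
    using linear_map_closed[OF assms(3,4)] by (simp add: N.smult_l_minus)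
  finally show ?thesis .
qed

lemma linear_map_diff:
  assumes "module k M" "module k N" "linear_map k M N f" "x \<in> carrier M" "y \<in> carrier M"
  shows "f (x \<ominus>\<^bsub>M\<^esub> y) = f x \<ominus>\<^bsub>N\<^esub> f y"
proof -
  interpret M: module k M by fact
  interpret N: module k N by fact
  show ?thesis
    using assms linear_map_add[OF assms(3), of x "\<ominus>\<^bsub>M\<^esub> y"] linear_map_neg[OF assms(1-3), of y]
    by (simp add: a_minus_def)
qed

lemma linear_map_finsum:
  assumes "module k M" "module k N" "linear_map k M N f" "finite A" "\<And>i. i \<in> A \<Longrightarrow> h i \<in> carrier M"
  shows "f (finsum M h A) = finsum N (\<lambda>i. f (h i)) A"
proof -
  interpret M: module k M by fact
  interpret N: module k N by fact
  show ?thesis using assms(4,5)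
  proof (induction A rule: finite_induct)
    case empty
    then show ?case using linear_map_zero[OF assms(1-3)] by simp
  next
    case (insert a A)
    have "f (finsum M h (insert a A)) = f (h a \<oplus>\<^bsub>M\<^esub> finsum M h A)"
      using insert by (subst M.finsum_insert) auto
    also have "\<dots> = f (h a) \<oplus>\<^bsub>N\<^esub> f (finsum M h A)"
      by (rule linear_map_add[OF assms(3)]) (use insert in auto)
    also have "\<dots> = finsum N (\<lambda>i. f (h i)) (insert a A)"
      using insert linear_map_closed[OF assms(3)] by (subst N.finsum_insert) auto
    finally show ?case .
  qed
qed

lemma linear_map_lincomb:
  assumes "module k M" "module k N" "linear_map k M N f" "finite A"
    "\<And>i. i \<in> A \<Longrightarrow> c i \<in> carrier k" "\<And>i. i \<in> A \<Longrightarrow> h i \<in> carrier M"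
  shows "f (\<Oplus>\<^bsub>M\<^esub>i\<in>A. c i \<odot>\<^bsub>M\<^esub> h i) = (\<Oplus>\<^bsub>N\<^esub>i\<in>A. c i \<odot>\<^bsub>N\<^esub> f (h i))"
proof -
  interpret M: module k M by fact
  interpret N: module k N by fact
  have "f (\<Oplus>\<^bsub>M\<^esub>i\<in>A. c i \<odot>\<^bsub>M\<^esub> h i) = (\<Oplus>\<^bsub>N\<^esub>i\<in>A. f (c i \<odot>\<^bsub>M\<^esub> h i))"
    using assms by (intro linear_map_finsum) auto
  also have "\<dots> = (\<Oplus>\<^bsub>N\<^esub>i\<in>A. c i \<odot>\<^bsub>N\<^esub> f (h i))"
    using assms by (intro N.finsum_cong') (auto simp: linear_map_smult linear_map_closed)
  finally show ?thesis .
qed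

lemma (in module) smult_lincomb:
  assumes "finite A" "a \<in> carrier R" "\<And>i. i \<in> A \<Longrightarrow> c i \<in> carrier R" "\<And>i. i \<in> A \<Longrightarrow> h i \<in> carrier M"
  shows "a \<odot>\<^bsub>M\<^esub> (\<Oplus>\<^bsub>M\<^esub>i\<in>A. c i \<odot>\<^bsub>M\<^esub> h i) = (\<Oplus>\<^bsub>M\<^esub>i\<in>A. (a \<otimes> c i) \<odot>\<^bsub>M\<^esub> h i)"
  using assms
  by (subst finsum_smult_ldistr) (auto intro!: M.finsum_cong' simp: smult_assoc1)

lemma linear_map_smultI:
  assumes "module k N" "linear_map k M N f" "c \<in> carrier k"
  shows "linear_map k M N (\<lambda>x. c \<odot>\<^bsub>N\<^esub> f x)"
proof -
  interpret N: module k N by fact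
  note L = linear_mapD[OF assms(2)]
  show ?thesis
    using assms(3) L
    by (intro linear_mapI)
      (auto simp: N.smult_r_distr N.smult_assoc1[symmetric] N.m_comm)
qed

lemma linear_map_add_fun:
  assumes "module k N" "linear_map k M N f" "linear_map k M N h"
  shows "linear_map k M N (\<lambda>x. f x \<oplus>\<^bsub>N\<^esub> h x)"
proof -
  interpret N: module k N by fact
  show ?thesis
    using linear_mapD[OF assms(2)] linear_mapD[OF assms(3)]
    by (intro linear_mapI) (auto simp: N.smult_r_distr N.a_ac)
qed

lemma linear_map_smult_fixed:
  assumes "module k N" "linear_map k M (self_module k) f" "y \<in> carrier N"
  shows "linear_map k M N (\<lambda>x. f x \<odot>\<^bsub>N\<^esub> y)"
proof -
  interpret N: module k N by fact
  show ?thesis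
    using linear_mapD[OF assms(2)] assms(3)
    by (intro linear_mapI) (auto simp: N.smult_l_distr N.smult_assoc1 self_module_def)
qed

section \<open>Submodules cut out by linear conditions, and induction over spanning sets\<close>

lemma submodule_equalizer:
  assumes "module k M" "module k N" "linear_map k M N f" "linear_map k M N h"
  shows "submodule {x \<in> carrier M. f x = h x} k M"
proof -
  interpret M: module k M by fact
  show ?thesis
    using linear_mapD[OF assms(3)] linear_mapD[OF assms(4)]
      linear_map_neg[OF assms(1-3)] linear_map_neg[OF assms(1,2,4)]
      linear_map_zero[OF assms(1-3)] linear_map_zero[OF assms(1,2,4)]
    by (intro M.submoduleI) auto
qed

lemma submodule_vimage:
  assumes "module k M" "module k N" "linear_map k M N f" "submodule Q k N"
  shows "submodule {x \<in> carrier M. f x \<in> Q} k M"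
proof -
  interpret M: module k M by fact
  interpret N: module k N by fact
  note Q = N.submoduleE[OF assms(4)]
  have "\<zero>\<^bsub>N\<^esub> \<in> Q"
    using subgroup.one_closed[OF submodule.axioms(1)[OF assms(4)]] by simp
  then show ?thesis
    using linear_mapD[OF assms(3)] linear_map_neg[OF assms(1-3)] linear_map_zero[OF assms(1-3)] Q
    by (intro M.submoduleI) auto
qed

lemma submodule_INT:
  assumes "module k M" "\<And>i. i \<in> I \<Longrightarrow> submodule (Q i) k M" "I \<noteq> {}"
  shows "submodule (\<Inter>i\<in>I. Q i) k M"
proof -
  interpret M: module k M by fact
  have "\<zero>\<^bsub>M\<^esub> \<in> Q i" if "i \<in> I" for i
    using subgroup.one_closed[OF submodule.axioms(1)[OF assms(2)[OF that]]] by simp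
  moreover have "(\<Inter>i\<in>I. Q i) \<subseteq> carrier M"
    using assms(3) M.submoduleE(1)[OF assms(2)] by fast
  ultimately show ?thesis
    using M.submoduleE(3,4,5)[OF assms(2)] by (intro M.submoduleI) simp_all
qed

lemma submodule_Collect_Ball:
  assumes "module k M" "\<And>i. i \<in> I \<Longrightarrow> submodule {x \<in> carrier M. Q i x} k M"
  shows "submodule {x \<in> carrier M. \<forall>i\<in>I. Q i x} k M"
\<comment> \<open>An intersection over an empty index set would be the whole type and not the
  carrier.\<close>
proof (cases "I = {}")
  case True
  then show ?thesis using module.carrier_is_submodule[OF assms(1)] by simp
next
  case False
  then have "{x \<in> carrier M. \<forall>i\<in>I. Q i x} = (\<Inter>i\<in>I. {x \<in> carrier M. Q i x})" by auto
  then show ?thesis using submodule_INT[OF assms False] by simp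
qed

lemma spans_induct:
  assumes "spans k M B" "submodule {x \<in> carrier M. Q x} k M" "\<And>x. x \<in> B \<Longrightarrow> Q x"
    "x \<in> carrier M"
  shows "Q x"
proof -
  have "B \<subseteq> {x \<in> carrier M. Q x}" using assms(1,3) by (auto simp: spans_def)
  then show ?thesis using assms(1,2,4) unfolding spans_def by blast
qed

text \<open>The set on which two linear maps agree is a submodule, so it is everything once it
  contains a spanning set.\<close>

lemma spans_ext:
  assumes "spans k M B" "module k M" "module k N" "linear_map k M N f" "linear_map k M N h"
    "\<And>x. x \<in> B \<Longrightarrow> f x = h x" "x \<in> carrier M"
  shows "f x = h x"
  using spans_induct[OF assms(1) submodule_equalizer[OF assms(2-5)] assms(6,7)] .

lemma spans_closed: "spans k M B \<Longrightarrow> x \<in> B \<Longrightarrow> x \<in> carrier M"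
  by (auto simp: spans_def)

lemma spans_image:
  assumes "spans k M B" "module k M" "module k N" "linear_map k M N f" "carrier N \<subseteq> f ` carrier M"
  shows "spans k N (f ` B)"
  unfolding spans_def
proof (intro conjI allI impI)
  show "f ` B \<subseteq> carrier N"
    using spans_closed[OF assms(1)] linear_map_closed[OF assms(4)] by auto
  fix Q assume Q: "submodule Q k N" "f ` B \<subseteq> Q"
  have "f x \<in> Q" if "x \<in> carrier M" for x
    using spans_induct[OF assms(1) submodule_vimage[OF assms(2-4) Q(1)] _ that] Q(2) by auto
  then show "carrier N \<subseteq> Q" using assms(5) by auto
qed

section \<open>Bilinear maps\<close>

lemma bilinearI:
  assumes "\<And>x. x \<in> carrier M \<Longrightarrow> linear_map k N P (f x)"
    and "\<And>y. y \<in> carrier N \<Longrightarrow> linear_map k M P (\<lambda>x. f x y)"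
  shows "bilinear k M N P f"
  using assms by (auto simp: bilinear_def)

lemma bilinearD:
  assumes "bilinear k M N P f"
  shows bilinear_right: "x \<in> carrier M \<Longrightarrow> linear_map k N P (f x)"
    and bilinear_left: "y \<in> carrier N \<Longrightarrow> linear_map k M P (\<lambda>x. f x y)"
    and bilinear_closed: "x \<in> carrier M \<Longrightarrow> y \<in> carrier N \<Longrightarrow> f x y \<in> carrier P"
  using assms by (auto simp: bilinear_def linear_map_def)

lemma bilinear_cong:
  assumes "bilinear k M N P f" "module k M" "module k N"
    "\<And>x y. x \<in> carrier M \<Longrightarrow> y \<in> carrier N \<Longrightarrow> h x y = f x y"
  shows "bilinear k M N P h"
  using bilinearD[OF assms(1)]
  by (intro bilinearI linear_map_cong[of k M P _ "\<lambda>x. h x _"] linear_map_cong[of k N P _ "h _"])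
    (use assms in auto)

text \<open>For fixed left arguments and scalars, additivity and homogeneity on the left are
  equations between maps that are linear in the right argument, so a spanning set of right arguments
  decides them.\<close>

lemma bilinearI_span:
  assumes "module k M" "module k N" "module k P" "spans k N B"
    "\<And>x. x \<in> carrier M \<Longrightarrow> linear_map k N P (f x)"
    "\<And>y. y \<in> B \<Longrightarrow> linear_map k M P (\<lambda>x. f x y)"
  shows "bilinear k M N P f"
proof (intro bilinearI assms(5) linear_mapI)
  interpret M: module k M by fact
  interpret P: module k P by fact
  fix y assume y: "y \<in> carrier N"
  show "f x y \<in> carrier P" if "x \<in> carrier M" for x
    using linear_map_closed[OF assms(5)[OF that] y] .
  show "f (x \<oplus>\<^bsub>M\<^esub> x') y = f x y \<oplus>\<^bsub>P\<^esub> f x' y" if "x \<in> carrier M" "x' \<in> carrier M" for x x'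
    by (rule spans_ext[OF assms(4,2,3) _ _ _ y])
      (use that linear_map_add[OF assms(6)] in \<open>auto intro: assms(3,5) linear_map_add_fun\<close>)
  show "f (r \<odot>\<^bsub>M\<^esub> x) y = r \<odot>\<^bsub>P\<^esub> f x y" if "r \<in> carrier k" "x \<in> carrier M" for r x
    by (rule spans_ext[OF assms(4,2,3) _ _ _ y])
      (use that linear_map_smult[OF assms(6)] in \<open>auto intro: assms(3,5) linear_map_smultI\<close>)
qed

lemma bilinear_ext:
  assumes "spans k M B" "spans k N B'" "module k M" "module k N" "module k P"
    "bilinear k M N P f" "bilinear k M N P h"
    "\<And>x y. x \<in> B \<Longrightarrow> y \<in> B' \<Longrightarrow> f x y = h x y" "x \<in> carrier M" "y \<in> carrier N"
  shows "f x y = h x y"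
proof (rule spans_ext[OF assms(1,3,5) _ _ _ assms(9)])
  fix x' assume x': "x' \<in> B"
  then show "f x' y = h x' y"
    using spans_closed[OF assms(1)]
    by (intro spans_ext[OF assms(2,4,5) bilinear_right[OF assms(6)] bilinear_right[OF assms(7)] _ assms(10)])
      (auto simp: assms(8))
qed (rule bilinear_left[OF assms(6,10)] bilinear_left[OF assms(7,10)])+

lemma bilinear_comp:
  "bilinear k M N P f \<Longrightarrow> linear_map k P Q h \<Longrightarrow> bilinear k M N Q (\<lambda>x y. h (f x y))"
  by (auto simp: bilinear_def intro: linear_map_comp)

lemma bilinear_comp_args:
  assumes f: "bilinear k M N P f" and u: "linear_map k M' M u" and v: "linear_map k N' N v"
  shows "bilinear k M' N' P (\<lambda>x y. f (u x) (v y))"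
proof (rule bilinearI)
  show "linear_map k N' P (\<lambda>y. f (u x) (v y))" if "x \<in> carrier M'" for x
    using linear_map_comp[OF v bilinear_right[OF f linear_map_closed[OF u that]]] .
  show "linear_map k M' P (\<lambda>x. f (u x) (v y))" if "y \<in> carrier N'" for y
    using linear_map_comp[OF u bilinear_left[OF f linear_map_closed[OF v that]]] .
qed

lemma bilinear_zero:
  assumes "bilinear k M N P f" "module k M" "module k N" "module k P"
  shows "x \<in> carrier M \<Longrightarrow> f x \<zero>\<^bsub>N\<^esub> = \<zero>\<^bsub>P\<^esub>" "y \<in> carrier N \<Longrightarrow> f \<zero>\<^bsub>M\<^esub> y = \<zero>\<^bsub>P\<^esub>"
  using linear_map_zero[OF assms(3,4) bilinear_right[OF assms(1)]]
    linear_map_zero[OF assms(2,4) bilinear_left[OF assms(1)]] by auto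

section \<open>Free modules and quotients\<close>

locale base_field = field k for k (structure)
begin

lemma free_module_simps:
  "carrier (free_module k U) = {f. (\<forall>x. f x \<in> carrier k) \<and> finite {x. f x \<noteq> \<zero>} \<and> {x. f x \<noteq> \<zero>} \<subseteq> U}"
  "\<zero>\<^bsub>free_module k U\<^esub> = (\<lambda>x. \<zero>)"
  "f \<oplus>\<^bsub>free_module k U\<^esub> h = (\<lambda>x. f x \<oplus> h x)"
  "r \<odot>\<^bsub>free_module k U\<^esub> f = (\<lambda>x. r \<otimes> f x)"
  by (simp_all add: free_module_def)

lemma module_free: "module k (free_module k U)"
proof -
  let ?M = "free_module k U"
  have supp: "finite {x. f x \<oplus> h x \<noteq> \<zero>} \<and> {x. f x \<oplus> h x \<noteq> \<zero>} \<subseteq> U"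
    if "f \<in> carrier ?M" "h \<in> carrier ?M" for f h
  proof -
    have "{x. f x \<oplus> h x \<noteq> \<zero>} \<subseteq> {x. f x \<noteq> \<zero>} \<union> {x. h x \<noteq> \<zero>}" by auto
    from finite_subset[OF this] this show ?thesis using that by (auto simp: free_module_simps)
  qed
  have supp': "finite {x. r \<otimes> f x \<noteq> \<zero>} \<and> {x. r \<otimes> f x \<noteq> \<zero>} \<subseteq> U"
    if "f \<in> carrier ?M" "r \<in> carrier k" for f r
  proof -
    have "{x. r \<otimes> f x \<noteq> \<zero>} \<subseteq> {x. f x \<noteq> \<zero>}" using that by auto
    from finite_subset[OF this] this show ?thesis using that by (auto simp: free_module_simps)
  qed
  have neg: "\<exists>h\<in>carrier ?M. (\<lambda>x. h x \<oplus> f x) = (\<lambda>x. \<zero>)" if "f \<in> carrier ?M" for f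
    by (rule bexI[of _ "\<lambda>x. \<ominus> \<one> \<otimes> f x"])
      (use that supp'[OF that, of "\<ominus> \<one>"] in \<open>auto simp: free_module_simps l_minus l_neg\<close>)
  have "abelian_group ?M"
    by (rule abelian_groupI)
      (use supp neg in \<open>auto simp: free_module_simps a_ac\<close>)
  then show ?thesis
    by (intro moduleI is_cring)
      (use supp' in \<open>auto simp: free_module_simps l_distr r_distr m_assoc\<close>)
qed

lemma single_closed: "a \<in> U \<Longrightarrow> single k a \<in> carrier (free_module k U)"
  by (auto simp: free_module_simps single_def)

lemma single_support: "{x. single k a x \<noteq> \<zero>} = {a}"
  by (auto simp: single_def)

text \<open>Induction on the support: setting one value to zero shrinks the support by one point,
  and the lost part is a multiple of a basis element.\<close>

lemma spans_free: "spans k (free_module k U) (single k ` U)"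
  unfolding spans_def
proof (intro conjI allI impI)
  show "single k ` U \<subseteq> carrier (free_module k U)" using single_closed by auto
  fix N assume N: "submodule N k (free_module k U)" "single k ` U \<subseteq> N"
  interpret M: module k "free_module k U" by (rule module_free)
  note NE = M.submoduleE[OF N(1)]
  have z: "\<zero>\<^bsub>free_module k U\<^esub> \<in> N"
    using subgroup.one_closed[OF submodule.axioms(1)[OF N(1)]] by simp
  have "f \<in> carrier (free_module k U) \<Longrightarrow> {x. f x \<noteq> \<zero>} = A \<Longrightarrow> f \<in> N" if "finite A" for A f
    using that
  proof (induction A arbitrary: f rule: finite_induct)
    case empty
    then have "f = \<zero>\<^bsub>free_module k U\<^esub>" by (auto simp: free_module_simps)
    then show ?case using z by simp
  next
    case (insert a A)
    define h where "h = f(a := \<zero>)"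
    have hA: "{x. h x \<noteq> \<zero>} = A" using insert.hyps(2) insert.prems(2) by (auto simp: h_def)
    have "h \<in> carrier (free_module k U)"
      using insert.prems hA insert.hyps(1) by (auto simp: free_module_simps h_def)
    then have hN: "h \<in> N" using insert.IH hA by blast
    have a: "a \<in> U" "f a \<in> carrier k" using insert.prems by (auto simp: free_module_simps)
    then have "f a \<odot>\<^bsub>free_module k U\<^esub> single k a \<in> N" using NE(4) N(2) by auto
    then have "f a \<odot>\<^bsub>free_module k U\<^esub> single k a \<oplus>\<^bsub>free_module k U\<^esub> h \<in> N"
      using NE(5) hN by blast
    moreover have "f a \<odot>\<^bsub>free_module k U\<^esub> single k a \<oplus>\<^bsub>free_module k U\<^esub> h = f"
      using insert.prems(1) by (auto simp: free_module_simps single_def h_def fun_eq_iff)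
    ultimately show ?case by simp
  qed
  then show "carrier (free_module k U) \<subseteq> N" by (auto simp: free_module_simps)
qed

text \<open>\<open>lin_ext\<close> sums over the support, which changes under addition and scaling.
  Passing to a common finite superset makes such sums comparable.\<close>

lemma lin_ext_superset:
  assumes "module k P" "h \<in> U \<rightarrow> carrier P" "r \<in> carrier (free_module k U)"
    "finite A" "{x. r x \<noteq> \<zero>} \<subseteq> A" "A \<subseteq> U"
  shows "lin_ext k P h r = (\<Oplus>\<^bsub>P\<^esub>x\<in>A. r x \<odot>\<^bsub>P\<^esub> h x)"
proof -
  interpret P: module k P by fact
  show ?thesis unfolding lin_ext_def
    by (rule P.add.finprod_mono_neutral_cong_left)
      (use assms in \<open>auto simp: free_module_simps Pi_iff subset_iff intro!: P.smult_closed P.smult_l_null\<close>)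
qed

lemma linear_lin_ext:
  assumes "module k P" "h \<in> U \<rightarrow> carrier P"
  shows "linear_map k (free_module k U) P (lin_ext k P h)"
proof (rule linear_mapI)
  interpret P: module k P by fact
  interpret M: module k "free_module k U" by (rule module_free)
  fix r assume r: "r \<in> carrier (free_module k U)"
  then have rk: "r x \<in> carrier k" for x by (auto simp: free_module_simps)
  have rU: "finite {x. r x \<noteq> \<zero>}" "{x. r x \<noteq> \<zero>} \<subseteq> U" using r by (auto simp: free_module_simps)
  have hP: "h x \<in> carrier P" if "x \<in> U" for x using assms(2) that by auto
  show "lin_ext k P h r \<in> carrier P"
    unfolding lin_ext_def using rk rU hP by (intro P.finsum_closed) (auto intro!: P.smult_closed)
  show "lin_ext k P h (r \<oplus>\<^bsub>free_module k U\<^esub> s) = lin_ext k P h r \<oplus>\<^bsub>P\<^esub> lin_ext k P h s"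
    if s: "s \<in> carrier (free_module k U)" for s
  proof -
    let ?A = "{x. r x \<noteq> \<zero>} \<union> {x. s x \<noteq> \<zero>}"
    have sk: "s x \<in> carrier k" for x using s by (auto simp: free_module_simps)
    have A: "finite ?A" "?A \<subseteq> U" using r s by (auto simp: free_module_simps)
    have "lin_ext k P h (r \<oplus>\<^bsub>free_module k U\<^esub> s)
        = (\<Oplus>\<^bsub>P\<^esub>x\<in>?A. (r \<oplus>\<^bsub>free_module k U\<^esub> s) x \<odot>\<^bsub>P\<^esub> h x)"
      using M.a_closed[OF r s] A by (intro lin_ext_superset[OF assms]) (auto simp: free_module_simps(3))
    also have "\<dots> = (\<Oplus>\<^bsub>P\<^esub>x\<in>?A. r x \<odot>\<^bsub>P\<^esub> h x \<oplus>\<^bsub>P\<^esub> s x \<odot>\<^bsub>P\<^esub> h x)"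
      using rk sk A hP by (intro P.finsum_cong') (auto simp: free_module_simps(3) P.smult_l_distr subset_iff)
    also have "\<dots> = (\<Oplus>\<^bsub>P\<^esub>x\<in>?A. r x \<odot>\<^bsub>P\<^esub> h x) \<oplus>\<^bsub>P\<^esub> (\<Oplus>\<^bsub>P\<^esub>x\<in>?A. s x \<odot>\<^bsub>P\<^esub> h x)"
      using rk sk A hP by (intro P.finsum_addf) (auto simp: subset_iff)
    finally show ?thesis using lin_ext_superset[OF assms r A(1) _ A(2)] lin_ext_superset[OF assms s A(1) _ A(2)]
      by auto
  qed
  show "lin_ext k P h (c \<odot>\<^bsub>free_module k U\<^esub> r) = c \<odot>\<^bsub>P\<^esub> lin_ext k P h r" if c: "c \<in> carrier k" for c
  proof -
    have "lin_ext k P h (c \<odot>\<^bsub>free_module k U\<^esub> r)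
        = (\<Oplus>\<^bsub>P\<^esub>x\<in>{x. r x \<noteq> \<zero>}. (c \<odot>\<^bsub>free_module k U\<^esub> r) x \<odot>\<^bsub>P\<^esub> h x)"
      using M.smult_closed[OF c r] c rU by (intro lin_ext_superset[OF assms]) (auto simp: free_module_simps(4))
    also have "\<dots> = (\<Oplus>\<^bsub>P\<^esub>x\<in>{x. r x \<noteq> \<zero>}. c \<odot>\<^bsub>P\<^esub> (r x \<odot>\<^bsub>P\<^esub> h x))"
      using rk rU hP c by (intro P.finsum_cong') (auto simp: free_module_simps(4) P.smult_assoc1 subset_iff)
    also have "\<dots> = c \<odot>\<^bsub>P\<^esub> lin_ext k P h r"
      unfolding lin_ext_def using rk rU hP c
      by (intro P.finsum_smult_ldistr[symmetric]) (auto simp: subset_iff)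
    finally show ?thesis .
  qed
qed

lemma lin_ext_single:
  assumes "module k P" "h a \<in> carrier P"
  shows "lin_ext k P h (single k a) = h a"
proof -
  interpret P: module k P by fact
  have "lin_ext k P h (single k a) = (\<Oplus>\<^bsub>P\<^esub>x\<in>{a}. single k a x \<odot>\<^bsub>P\<^esub> h x)"
    by (simp only: lin_ext_def single_support)
  also have "\<dots> = h a"
    using assms(2) by (subst P.finsum_insert) (auto simp: single_def)
  finally show ?thesis .
qed

definition bil_ext ::
    "('a, 'p, 'n) module_scheme \<Rightarrow> ('x \<Rightarrow> 'y \<Rightarrow> 'p) \<Rightarrow> ('x \<Rightarrow> 'a) \<Rightarrow> ('y \<Rightarrow> 'a) \<Rightarrow> 'p" where
  "bil_ext P h r s = lin_ext k P (\<lambda>x. lin_ext k P (h x) s) r"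

lemma bil_ext_single:
  assumes "module k P" "h a b \<in> carrier P"
  shows "bil_ext P h (single k a) (single k b) = h a b"
proof -
  have "lin_ext k P (h a) (single k b) = h a b" by (rule lin_ext_single) fact+
  then show ?thesis unfolding bil_ext_def using assms by (subst lin_ext_single) auto
qed

text \<open>Linearity in \<open>r\<close> is that of the outer \<open>lin_ext\<close>. Linearity in
  \<open>s\<close> need only be checked at basis elements \<open>r\<close>, where the outer
  extension collapses to the inner one.\<close>

lemma bilinear_bil_ext:
  assumes P: "module k P" and h: "\<And>x y. x \<in> U \<Longrightarrow> y \<in> V \<Longrightarrow> h x y \<in> carrier P"
  shows "bilinear k (free_module k U) (free_module k V) P (bil_ext P h)"
proof -
  have inner: "linear_map k (free_module k V) P (lin_ext k P (h x))" if "x \<in> U" for x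
    using that h by (intro linear_lin_ext[OF P]) auto
  have outer: "linear_map k (free_module k U) P (\<lambda>r. bil_ext P h r s)"
    if "s \<in> carrier (free_module k V)" for s
    unfolding bil_ext_def using linear_map_closed[OF inner that] by (intro linear_lin_ext[OF P]) auto
  have "bilinear k (free_module k V) (free_module k U) P (\<lambda>s r. bil_ext P h r s)"
  proof (rule bilinearI_span[OF module_free module_free P spans_free])
    fix y assume "y \<in> single k ` U"
    then obtain a where a: "a \<in> U" "y = single k a" by auto
    show "linear_map k (free_module k V) P (\<lambda>s. bil_ext P h y s)"
    proof (rule linear_map_cong[OF inner[OF a(1)] module_free])
      fix s assume "s \<in> carrier (free_module k V)"
      then show "bil_ext P h y s = lin_ext k P (h a) s"
        unfolding bil_ext_def a(2) using linear_map_closed[OF inner[OF a(1)]]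
        by (subst lin_ext_single[OF P]) auto
    qed
  qed (use outer in auto)
  then show ?thesis by (auto simp: bilinear_def)
qed

lemma module_self: "module k (self_module k)"
  by (rule moduleI)
    (auto simp: self_module_def l_distr r_distr m_assoc is_cring l_neg r_neg a_ac
      intro!: abelian_groupI bexI[of _ "\<ominus> _"])

end

section \<open>Quotient modules and maps out of them\<close>

locale quotient = M?: module k M for k (structure) and M (structure) +
  fixes N
  assumes sub: "submodule N k M"
begin

lemma abelian_subgroup: "abelian_subgroup N M"
  by (intro abelian_subgroupI3 additive_subgroupI submodule.axioms(1)[OF sub] module.axioms(2)[OF M.module_axioms])

sublocale abelian_subgroup N M by (rule abelian_subgroup)

lemma quot_module_simps:
  "carrier (quot_module M N) = (\<lambda>x. N +>\<^bsub>M\<^esub> x) ` carrier M"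
  "\<zero>\<^bsub>quot_module M N\<^esub> = N"
  "x \<in> carrier M \<Longrightarrow> y \<in> carrier M
     \<Longrightarrow> (N +>\<^bsub>M\<^esub> x) \<oplus>\<^bsub>quot_module M N\<^esub> (N +>\<^bsub>M\<^esub> y) = N +>\<^bsub>M\<^esub> (x \<oplus>\<^bsub>M\<^esub> y)"
  by (auto simp: quot_module_def ring.defs module.defs FactRing_def A_RCOSETS_defs a_r_coset_def a_rcos_sum[unfolded a_r_coset_def])

text \<open>The scalar action is defined as a union over all representatives. It is a single coset
  because two representatives differ by an element of \<open>N\<close>, and \<open>N\<close> is
  stable under scalars.\<close>

lemma quot_smult:
  assumes "r \<in> carrier k" "x \<in> carrier M"
  shows "r \<odot>\<^bsub>quot_module M N\<^esub> (N +>\<^bsub>M\<^esub> x) = N +>\<^bsub>M\<^esub> (r \<odot>\<^bsub>M\<^esub> x)"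
proof -
  have "N +>\<^bsub>M\<^esub> (r \<odot>\<^bsub>M\<^esub> y) = N +>\<^bsub>M\<^esub> (r \<odot>\<^bsub>M\<^esub> x)" if "y \<in> N +>\<^bsub>M\<^esub> x" for y
  proof -
    have y: "y \<in> carrier M" using a_elemrcos_carrier assms(2) that by blast
    have "y \<oplus>\<^bsub>M\<^esub> \<ominus>\<^bsub>M\<^esub> x \<in> N" using a_rcos_module_imp assms(2) that by blast
    then have "r \<odot>\<^bsub>M\<^esub> (y \<oplus>\<^bsub>M\<^esub> \<ominus>\<^bsub>M\<^esub> x) \<in> N" using M.submoduleE(4)[OF sub] assms(1) by blast
    then have "r \<odot>\<^bsub>M\<^esub> y \<oplus>\<^bsub>M\<^esub> \<ominus>\<^bsub>M\<^esub> (r \<odot>\<^bsub>M\<^esub> x) \<in> N"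
      using assms y by (simp add: M.smult_r_distr M.smult_r_minus)
    then have "r \<odot>\<^bsub>M\<^esub> y \<in> N +>\<^bsub>M\<^esub> (r \<odot>\<^bsub>M\<^esub> x)"
      using assms y by (intro a_rcos_module_rev) auto
    then show ?thesis using a_repr_independence' assms by blast
  qed
  moreover have "x \<in> N +>\<^bsub>M\<^esub> x" using a_rcos_self assms(2) by blast
  ultimately have "(\<Union>y\<in>N +>\<^bsub>M\<^esub> x. N +>\<^bsub>M\<^esub> (r \<odot>\<^bsub>M\<^esub> y)) = N +>\<^bsub>M\<^esub> (r \<odot>\<^bsub>M\<^esub> x)" by blast
  then show ?thesis by (simp add: quot_module_def ring.defs module.defs)
qed

lemma coset_zero: "N +>\<^bsub>M\<^esub> \<zero>\<^bsub>M\<^esub> = N"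
  using a_rcos_const[of "\<zero>\<^bsub>M\<^esub>"] by simp

lemma module_quot: "module k (quot_module M N)"
proof (rule moduleI)
  let ?Q = "quot_module M N"
  show "abelian_group ?Q"
  proof (rule abelian_groupI)
    show "\<exists>y\<in>carrier ?Q. y \<oplus>\<^bsub>?Q\<^esub> x = \<zero>\<^bsub>?Q\<^esub>" if x: "x \<in> carrier ?Q" for x
    proof -
      obtain a where a: "a \<in> carrier M" "x = N +>\<^bsub>M\<^esub> a" using x by (auto simp: quot_module_simps)
      then show ?thesis
        by (intro bexI[of _ "N +>\<^bsub>M\<^esub> (\<ominus>\<^bsub>M\<^esub> a)"]) (auto simp: quot_module_simps M.l_neg coset_zero)
    qed
    show "\<zero>\<^bsub>?Q\<^esub> \<in> carrier ?Q" using coset_zero by (auto simp: quot_module_simps image_iff intro!: bexI[of _ "\<zero>\<^bsub>M\<^esub>"])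
    show "\<zero>\<^bsub>?Q\<^esub> \<oplus>\<^bsub>?Q\<^esub> x = x" if x: "x \<in> carrier ?Q" for x
    proof -
      obtain a where a: "a \<in> carrier M" "x = N +>\<^bsub>M\<^esub> a" using x by (auto simp: quot_module_simps)
      then show ?thesis using quot_module_simps(3)[of "\<zero>\<^bsub>M\<^esub>" a] by (simp add: quot_module_simps(2) coset_zero)
    qed
  qed (auto simp: quot_module_simps M.a_ac)
qed (auto simp: quot_module_simps(1,3) quot_smult M.smult_l_distr M.smult_r_distr M.smult_assoc1 M.R.is_cring)

lemma linear_coset: "linear_map k M (quot_module M N) (\<lambda>x. N +>\<^bsub>M\<^esub> x)"
  by (rule linear_mapI) (auto simp: quot_module_simps quot_smult)

lemma quot_rep:
  assumes "U \<in> carrier (quot_module M N)"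
  shows "(SOME r. r \<in> U) \<in> carrier M" "N +>\<^bsub>M\<^esub> (SOME r. r \<in> U) = U"
proof -
  obtain a where a: "a \<in> carrier M" "U = N +>\<^bsub>M\<^esub> a" using assms by (auto simp: quot_module_simps)
  then have "a \<in> U" using a_rcos_self by blast
  then have "(SOME r. r \<in> U) \<in> U" by (rule someI)
  then show "(SOME r. r \<in> U) \<in> carrier M" "N +>\<^bsub>M\<^esub> (SOME r. r \<in> U) = U"
    using a a_elemrcos_carrier a_repr_independence' by auto
qed

lemma coset_eq_imp:
  assumes "x \<in> carrier M" "y \<in> carrier M" "N +>\<^bsub>M\<^esub> x = N +>\<^bsub>M\<^esub> y"
  shows "x \<ominus>\<^bsub>M\<^esub> y \<in> N"
  using a_rcos_module_imp[OF assms(2), of x] a_rcos_self[OF assms(1)] assms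
  by (simp add: a_minus_def)

text \<open>The universal property in the shape in which the definitions use it, with a
  representative picked by \<open>SOME\<close>: two representatives differ by an element of
  \<open>N\<close>, which \<open>f\<close> kills.\<close>

lemma quot_lift:
  assumes P: "module k P" and f: "linear_map k M P f" and ker: "\<And>x. x \<in> N \<Longrightarrow> f x = \<zero>\<^bsub>P\<^esub>"
  shows quot_lift_coset: "x \<in> carrier M \<Longrightarrow> f (SOME r. r \<in> N +>\<^bsub>M\<^esub> x) = f x"
    and linear_quot_lift: "linear_map k (quot_module M N) P (\<lambda>U. f (SOME r. r \<in> U))"
proof -
  interpret P: module k P by fact
  have eq: "f x = f y" if "x \<in> carrier M" "y \<in> carrier M" "N +>\<^bsub>M\<^esub> x = N +>\<^bsub>M\<^esub> y" for x y
  proof -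
    have "f x \<ominus>\<^bsub>P\<^esub> f y = \<zero>\<^bsub>P\<^esub>"
      using linear_map_diff[OF M.module_axioms P f that(1,2)] ker[OF coset_eq_imp[OF that]] by simp
    moreover have "f x = (f x \<ominus>\<^bsub>P\<^esub> f y) \<oplus>\<^bsub>P\<^esub> f y"
      using linear_map_closed[OF f] that by (simp add: a_minus_def P.a_assoc P.l_neg)
    ultimately show ?thesis using linear_map_closed[OF f] that by simp
  qed
  have *: "f (SOME r. r \<in> N +>\<^bsub>M\<^esub> x) = f x" if "x \<in> carrier M" for x
    using quot_rep[of "N +>\<^bsub>M\<^esub> x"] that by (intro eq) (auto simp: quot_module_simps)
  show "x \<in> carrier M \<Longrightarrow> f (SOME r. r \<in> N +>\<^bsub>M\<^esub> x) = f x" by (rule *)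
  show "linear_map k (quot_module M N) P (\<lambda>U. f (SOME r. r \<in> U))"
    by (rule linear_mapI)
      (auto simp: quot_module_simps(1,3) quot_smult * linear_mapD[OF f])
qed

lemma spans_quot: "spans k M B \<Longrightarrow> spans k (quot_module M N) ((\<lambda>x. N +>\<^bsub>M\<^esub> x) ` B)"
  by (rule spans_image[OF _ M.module_axioms module_quot linear_coset])
    (auto simp: quot_module_simps)

end

section \<open>Tensor products\<close>

context base_field
begin

lemma submodule_gen:
  assumes "module k M" "S \<subseteq> carrier M"
  shows "submodule (submodule_gen k M S) k M" "S \<subseteq> submodule_gen k M S"
    "\<And>N. submodule N k M \<Longrightarrow> S \<subseteq> N \<Longrightarrow> submodule_gen k M S \<subseteq> N"
proof -
  have "{N. submodule N k M \<and> S \<subseteq> N} \<noteq> {}"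
    using module.carrier_is_submodule[OF assms(1)] assms(2) by auto
  then have "submodule (\<Inter>N\<in>{N. submodule N k M \<and> S \<subseteq> N}. N) k M"
    by (intro submodule_INT[OF assms(1)]) auto
  then show "submodule (submodule_gen k M S) k M" by (simp add: submodule_gen_def)
qed (auto simp: submodule_gen_def)

lemma tensor_rels_closed:
  assumes "module k M" "module k N"
  shows "tensor_rels k M N \<subseteq> carrier (free_module k (carrier M \<times> carrier N))"
proof -
  interpret M: module k M by fact
  interpret N: module k N by fact
  interpret F: module k "free_module k (carrier M \<times> carrier N)" by (rule module_free)
  show ?thesis
    by (auto simp: tensor_rels_def Let_def intro!: F.M.minus_closed F.a_closed F.smult_closed single_closed)
qed

lemma quotient_tensor:
  assumes "module k M" "module k N"
  shows "quotient k (free_module k (carrier M \<times> carrier N)) (tensor_null k M N)"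
  unfolding tensor_null_def
  by (intro quotient.intro quotient_axioms.intro module_free submodule_gen tensor_rels_closed assms)

lemma module_tensor:
  assumes "module k M" "module k N"
  shows "module k (tensor k M N)"
  unfolding tensor_def by (rule quotient.module_quot[OF quotient_tensor[OF assms]])

lemma pure_closed:
  assumes "module k M" "module k N" "x \<in> carrier M" "y \<in> carrier N"
  shows "pure k M N x y \<in> carrier (tensor k M N)"
  using assms unfolding tensor_def pure_def quotient.quot_module_simps(1)[OF quotient_tensor[OF assms(1,2)]]
  by (auto intro: single_closed)

text \<open>Each of the four laws equates two cosets whose representatives differ by a member of one
  of the four families of relations.\<close>

lemma bilinear_pure:
  assumes "module k M" "module k N"
  shows "bilinear k M N (tensor k M N) (pure k M N)"
proof -
  let ?F = "free_module k (carrier M \<times> carrier N)"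
  interpret M: module k M by fact
  interpret N: module k N by fact
  interpret Q: quotient k ?F "tensor_null k M N" by (rule quotient_tensor[OF assms])
  have rel: "tensor_rels k M N \<subseteq> tensor_null k M N"
    unfolding tensor_null_def by (rule submodule_gen(2)[OF module_free tensor_rels_closed[OF assms]])
  have eq: "tensor_null k M N +>\<^bsub>?F\<^esub> u = tensor_null k M N +>\<^bsub>?F\<^esub> v"
    if "u \<in> carrier ?F" "v \<in> carrier ?F" "u \<ominus>\<^bsub>?F\<^esub> v \<in> tensor_rels k M N" for u v
  proof -
    have "u \<oplus>\<^bsub>?F\<^esub> \<ominus>\<^bsub>?F\<^esub> v \<in> tensor_null k M N" using rel that(3) by (auto simp: a_minus_def)
    then have "u \<in> tensor_null k M N +>\<^bsub>?F\<^esub> v" using that by (intro Q.a_rcos_module_rev) auto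
    then show ?thesis using Q.a_repr_independence' that(2) by blast
  qed
  have cl: "pure k M N x y \<in> carrier (tensor k M N)" if "x \<in> carrier M" "y \<in> carrier N" for x y
    using pure_closed[OF assms that] .
  note sc = single_closed[of "(_, _)" "carrier M \<times> carrier N", simplified]
  have l: "pure k M N (x \<oplus>\<^bsub>M\<^esub> x') y = pure k M N x y \<oplus>\<^bsub>tensor k M N\<^esub> pure k M N x' y"
    if "x \<in> carrier M" "x' \<in> carrier M" "y \<in> carrier N" for x x' y
    unfolding pure_def tensor_def using that
    by (subst Q.quot_module_simps(3), simp add: sc, simp add: sc, intro eq)
      (auto simp: sc tensor_rels_def Let_def intro!: Q.M.M.a_closed)
  have r: "pure k M N x (y \<oplus>\<^bsub>N\<^esub> y') = pure k M N x y \<oplus>\<^bsub>tensor k M N\<^esub> pure k M N x y'"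
    if "x \<in> carrier M" "y \<in> carrier N" "y' \<in> carrier N" for x y y'
    unfolding pure_def tensor_def using that
    by (subst Q.quot_module_simps(3), simp add: sc, simp add: sc, intro eq)
      (auto simp: sc tensor_rels_def Let_def intro!: Q.M.M.a_closed)
  have ls: "pure k M N (c \<odot>\<^bsub>M\<^esub> x) y = c \<odot>\<^bsub>tensor k M N\<^esub> pure k M N x y"
    if "x \<in> carrier M" "c \<in> carrier k" "y \<in> carrier N" for c x y
    unfolding pure_def tensor_def using that
    by (subst Q.quot_smult, simp, simp add: sc, intro eq)
      (auto simp: sc tensor_rels_def Let_def intro!: Q.M.smult_closed)
  have rs: "pure k M N x (c \<odot>\<^bsub>N\<^esub> y) = c \<odot>\<^bsub>tensor k M N\<^esub> pure k M N x y"
    if "x \<in> carrier M" "c \<in> carrier k" "y \<in> carrier N" for c x y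
    unfolding pure_def tensor_def using that
    by (subst Q.quot_smult, simp, simp add: sc, intro eq)
      (auto simp: sc tensor_rels_def Let_def intro!: Q.M.smult_closed)
  show ?thesis by (intro bilinearI linear_mapI cl l r ls rs) auto
qed

text \<open>The kernel of the linear extension of \<open>f\<close> is a submodule, and bilinearity
  of \<open>f\<close> puts the relations into it. Hence it contains the null submodule and the
  extension descends to the quotient.\<close>

lemma tensor_lift:
  assumes M: "module k M" and N: "module k N" and P: "module k P" and f: "bilinear k M N P f"
  shows linear_tensor_lift: "linear_map k (tensor k M N) P (tensor_lift k P f)"
    and tensor_lift_pure: "x \<in> carrier M \<Longrightarrow> y \<in> carrier N \<Longrightarrow> tensor_lift k P f (pure k M N x y) = f x y"
proof -
  let ?F = "free_module k (carrier M \<times> carrier N)"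
  interpret M: module k M by fact
  interpret N: module k N by fact
  interpret P: module k P by fact
  interpret Q: quotient k ?F "tensor_null k M N" by (rule quotient_tensor[OF M N])
  let ?L = "lin_ext k P (\<lambda>(x, y). f x y)"
  have L: "linear_map k ?F P ?L"
    by (rule linear_lin_ext[OF P]) (auto intro: bilinear_closed[OF f])
  have s: "?L (single k (x, y)) = f x y" if "x \<in> carrier M" "y \<in> carrier N" for x y
    using bilinear_closed[OF f that] by (subst lin_ext_single[OF P]) auto
  note sc = single_closed[of "(_, _)" "carrier M \<times> carrier N", simplified]
  have fc: "f x y \<in> carrier P" if "x \<in> carrier M" "y \<in> carrier N" for x y
    using bilinear_closed[OF f that] .
  have z: "a \<ominus>\<^bsub>P\<^esub> a = \<zero>\<^bsub>P\<^esub>" if "a \<in> carrier P" for a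
    using that by (simp add: a_minus_def P.r_neg)
  have "tensor_rels k M N \<subseteq> {x \<in> carrier ?F. ?L x = \<zero>\<^bsub>P\<^esub>}"
  proof (intro subsetI CollectI conjI)
    fix u assume u: "u \<in> tensor_rels k M N"
    then show "u \<in> carrier ?F" using tensor_rels_closed[OF M N] by auto
    show "?L u = \<zero>\<^bsub>P\<^esub>"
      using u unfolding tensor_rels_def Let_def
      by (elim UnE; clarify)
        (simp_all add: linear_map_diff[OF Q.M.module_axioms P L] linear_mapD[OF L] sc s fc z
          linear_mapD[OF bilinear_right[OF f]] linear_mapD[OF bilinear_left[OF f]] Q.M.M.a_closed)
  qed
  moreover have "submodule {x \<in> carrier ?F. ?L x = \<zero>\<^bsub>P\<^esub>} k ?F"
    by (rule submodule_equalizer[OF module_free P L, of "\<lambda>_. \<zero>\<^bsub>P\<^esub>"]) (simp add: linear_map_def)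
  ultimately have "tensor_null k M N \<subseteq> {x \<in> carrier ?F. ?L x = \<zero>\<^bsub>P\<^esub>}"
    unfolding tensor_null_def
    by (intro submodule_gen(3) module_free tensor_rels_closed[OF M N])
  then have ker: "\<And>x. x \<in> tensor_null k M N \<Longrightarrow> ?L x = \<zero>\<^bsub>P\<^esub>" by auto
  have tl: "tensor_lift k P f = (\<lambda>U. ?L (SOME r. r \<in> U))" by (simp add: tensor_lift_def fun_eq_iff)
  show "linear_map k (tensor k M N) P (tensor_lift k P f)"
    unfolding tl tensor_def by (rule Q.linear_quot_lift[OF P L ker])
  show "tensor_lift k P f (pure k M N x y) = f x y" if "x \<in> carrier M" "y \<in> carrier N"
    unfolding tl pure_def using Q.quot_lift_coset[OF P L ker] sc that s by simp
qed

lemma spans_tensor: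
  assumes M: "module k M" and N: "module k N" and B: "spans k M B" and B': "spans k N B'"
  shows "spans k (tensor k M N) {pure k M N x y | x y. x \<in> B \<and> y \<in> B'}"
  unfolding spans_def
proof (intro conjI allI impI)
  let ?F = "free_module k (carrier M \<times> carrier N)"
  interpret Q: quotient k ?F "tensor_null k M N" by (rule quotient_tensor[OF M N])
  note bil = bilinear_pure[OF M N]
  show "{pure k M N x y |x y. x \<in> B \<and> y \<in> B'} \<subseteq> carrier (tensor k M N)"
    using spans_closed[OF B] spans_closed[OF B'] pure_closed[OF M N] by auto
  fix K assume K: "submodule K k (tensor k M N)" "{pure k M N x y |x y. x \<in> B \<and> y \<in> B'} \<subseteq> K"
  \<comment> \<open>The arguments are freed one at a time: first the right one with the left still
    in \<open>B\<close>, then the left one.\<close>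
  have 1: "pure k M N x y \<in> K" if "x \<in> B" "y \<in> carrier N" for x y
    by (rule spans_induct[OF B' submodule_vimage[OF N module_tensor[OF M N]
        bilinear_right[OF bil spans_closed[OF B that(1)]] K(1)] _ that(2)]) (use K(2) that in auto)
  have 2: "pure k M N x y \<in> K" if "x \<in> carrier M" "y \<in> carrier N" for x y
    by (rule spans_induct[OF B submodule_vimage[OF M module_tensor[OF M N]
        bilinear_left[OF bil that(2)] K(1)] _ that(1)]) (use 1 that in auto)
  have "spans k (tensor k M N) ((\<lambda>x. tensor_null k M N +>\<^bsub>?F\<^esub> x) ` single k ` (carrier M \<times> carrier N))"
    unfolding tensor_def by (rule Q.spans_quot[OF spans_free])
  moreover have "(\<lambda>x. tensor_null k M N +>\<^bsub>?F\<^esub> x) ` single k ` (carrier M \<times> carrier N) \<subseteq> K"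
    using 2 by (auto simp: pure_def)
  ultimately show "carrier (tensor k M N) \<subseteq> K" using K(1) unfolding spans_def by blast
qed

lemma spans_carrier: "spans k M (carrier M)"
  by (auto simp: spans_def)

text \<open>Linearity in the parameter \<open>a\<close> is tested on pure tensors, where the lift is
  explicit. Iterated, this handles maps that are linear in three or four arguments.\<close>

lemma bilinear_tensor_lift_right:
  assumes A: "module k A" and M: "module k M" and N: "module k N" and P: "module k P"
    and G: "\<And>a. a \<in> carrier A \<Longrightarrow> bilinear k M N P (G a)"
    and lin: "\<And>x y. x \<in> carrier M \<Longrightarrow> y \<in> carrier N \<Longrightarrow> linear_map k A P (\<lambda>a. G a x y)"
  shows "bilinear k A (tensor k M N) P (\<lambda>a. tensor_lift k P (G a))"
proof (rule bilinearI_span[OF A module_tensor[OF M N] P spans_tensor[OF M N spans_carrier spans_carrier]])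
  show "linear_map k (tensor k M N) P (tensor_lift k P (G a))" if "a \<in> carrier A" for a
    by (rule linear_tensor_lift[OF M N P G[OF that]])
  show "linear_map k A P (\<lambda>a. tensor_lift k P (G a) u)"
    if "u \<in> {pure k M N x y |x y. x \<in> carrier M \<and> y \<in> carrier N}" for u
  proof -
    obtain x y where u: "u = pure k M N x y" "x \<in> carrier M" "y \<in> carrier N" using \<open>u \<in> _\<close> by auto
    show ?thesis
      by (rule linear_map_cong[OF lin[OF u(2,3)] A])
        (use u tensor_lift_pure[OF M N P G] in auto)
  qed
qed

lemma bilinear_swap: "bilinear k M N P f \<Longrightarrow> bilinear k N M P (\<lambda>y x. f x y)"
  by (auto simp: bilinear_def)

lemma bilinear_tensor_lift_left:
  assumes "module k A" "module k M" "module k N" "module k P"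
    and "\<And>a. a \<in> carrier A \<Longrightarrow> bilinear k M N P (\<lambda>x y. G x y a)"
    and "\<And>x y. x \<in> carrier M \<Longrightarrow> y \<in> carrier N \<Longrightarrow> linear_map k A P (G x y)"
  shows "bilinear k (tensor k M N) A P (\<lambda>u a. tensor_lift k P (\<lambda>x y. G x y a) u)"
  using bilinear_swap[OF bilinear_tensor_lift_right[of A M N P "\<lambda>a x y. G x y a"]] assms by blast

lemma tensor_map:
  assumes M: "module k M" and N: "module k N" and M': "module k M'" and N': "module k N'"
    and f: "linear_map k M M' f" and h: "linear_map k N N' h"
  shows linear_tensor_map: "linear_map k (tensor k M N) (tensor k M' N') (tensor_map k M' N' f h)"
    and tensor_map_pure: "x \<in> carrier M \<Longrightarrow> y \<in> carrier N
      \<Longrightarrow> tensor_map k M' N' f h (pure k M N x y) = pure k M' N' (f x) (h y)"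
proof -
  have b: "bilinear k M N (tensor k M' N') (\<lambda>x y. pure k M' N' (f x) (h y))"
    by (rule bilinear_comp_args[OF bilinear_pure[OF M' N'] f h])
  show "linear_map k (tensor k M N) (tensor k M' N') (tensor_map k M' N' f h)"
    "x \<in> carrier M \<Longrightarrow> y \<in> carrier N
      \<Longrightarrow> tensor_map k M' N' f h (pure k M N x y) = pure k M' N' (f x) (h y)"
    unfolding tensor_map_def
    using tensor_lift[OF M N module_tensor[OF M' N'] b] by auto
qed

lemma flip:
  assumes A: "module k A" and B: "module k B"
  shows linear_flip: "linear_map k (tensor k A B) (tensor k B A) (flip k A B)"
    and flip_pure: "x \<in> carrier A \<Longrightarrow> y \<in> carrier B
      \<Longrightarrow> flip k A B (pure k A B x y) = pure k B A y x"
  unfolding flip_def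
  using tensor_lift[OF A B module_tensor[OF B A] bilinear_swap[OF bilinear_pure[OF B A]]] by auto

lemma linear_pure_left:
  assumes "module k M" "module k N" "linear_map k A M f" "y \<in> carrier N"
  shows "linear_map k A (tensor k M N) (\<lambda>x. pure k M N (f x) y)"
  using linear_map_comp[OF assms(3) bilinear_left[OF bilinear_pure[OF assms(1,2)] assms(4)]] .

lemma linear_pure_right:
  assumes "module k M" "module k N" "linear_map k A N f" "x \<in> carrier M"
  shows "linear_map k A (tensor k M N) (\<lambda>y. pure k M N x (f y))"
  using linear_map_comp[OF assms(3) bilinear_right[OF bilinear_pure[OF assms(1,2)] assms(4)]] .

lemmas tensor_intros = module_tensor pure_closed linear_map_id linear_pure_left linear_pure_right

lemma tensor_assoc:
  assumes A: "module k A" and B: "module k B" and C: "module k C"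
  shows linear_tensor_assoc: "linear_map k (tensor k (tensor k A B) C) (tensor k A (tensor k B C))
      (tensor_assoc k A B C)"
    and tensor_assoc_pure: "a \<in> carrier A \<Longrightarrow> b \<in> carrier B \<Longrightarrow> c \<in> carrier C
      \<Longrightarrow> tensor_assoc k A B C (pure k (tensor k A B) C (pure k A B a b) c)
        = pure k A (tensor k B C) a (pure k B C b c)"
proof -
  let ?T = "tensor k A (tensor k B C)"
  let ?G = "\<lambda>a b c. pure k A (tensor k B C) a (pure k B C b c)"
  note m = module_tensor[OF A B] module_tensor[OF B C] module_tensor[OF A module_tensor[OF B C]] A B C
  have G: "bilinear k A B ?T (\<lambda>a b. ?G a b c)" if "c \<in> carrier C" for c
    by (intro bilinearI tensor_intros m that)
  have b: "bilinear k (tensor k A B) C ?T (\<lambda>u c. tensor_lift k ?T (\<lambda>a b. ?G a b c) u)"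
    by (intro bilinear_tensor_lift_left m G tensor_intros)
  show "linear_map k (tensor k (tensor k A B) C) ?T (tensor_assoc k A B C)"
    unfolding tensor_assoc_def Let_def by (rule linear_tensor_lift[OF _ _ _ b]) (rule m)+
  show "tensor_assoc k A B C (pure k (tensor k A B) C (pure k A B a b) c) = ?G a b c"
    if "a \<in> carrier A" "b \<in> carrier B" "c \<in> carrier C"
    using that unfolding tensor_assoc_def Let_def
    by (simp add: tensor_lift_pure[OF _ _ _ b] m pure_closed tensor_lift_pure[OF _ _ _ G])
qed

text \<open>The map is a nest of three lifts, and each lift must be linear in the variables bound
  further out. \<open>G\<close>, \<open>G1\<close>, \<open>G2\<close>, \<open>G3\<close> and
  \<open>b\<close> establish this from the inside outwards.\<close>

lemma middle_in:
  assumes A: "module k A" and B: "module k B" and C: "module k C" and D: "module k D"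
  shows linear_middle_in: "linear_map k (tensor k (tensor k A B) (tensor k C D))
      (tensor k (tensor k A (tensor k B C)) D) (middle_in k A B C D)"
    and middle_in_pure: "a \<in> carrier A \<Longrightarrow> b \<in> carrier B \<Longrightarrow> c \<in> carrier C \<Longrightarrow> d \<in> carrier D
      \<Longrightarrow> middle_in k A B C D (pure k (tensor k A B) (tensor k C D) (pure k A B a b) (pure k C D c d))
        = pure k (tensor k A (tensor k B C)) D (pure k A (tensor k B C) a (pure k B C b c)) d"
proof -
  let ?T = "tensor k (tensor k A (tensor k B C)) D"
  let ?G = "\<lambda>a b c d. pure k (tensor k A (tensor k B C)) D (pure k A (tensor k B C) a (pure k B C b c)) d"
  note m = A B C D module_tensor[OF A B] module_tensor[OF C D] module_tensor[OF B C]
    module_tensor[OF A module_tensor[OF B C]] module_tensor[OF module_tensor[OF A module_tensor[OF B C]] D]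
  have G: "bilinear k C D ?T (?G a b)" if "a \<in> carrier A" "b \<in> carrier B" for a b
    by (intro bilinearI tensor_intros m that)
  have G1: "bilinear k A (tensor k C D) ?T (\<lambda>a v. tensor_lift k ?T (?G a b) v)" if "b \<in> carrier B" for b
    by (intro bilinear_tensor_lift_right m G that tensor_intros)
  have G2: "bilinear k B (tensor k C D) ?T (\<lambda>b v. tensor_lift k ?T (?G a b) v)" if "a \<in> carrier A" for a
    by (intro bilinear_tensor_lift_right m G that tensor_intros)
  have G3: "bilinear k A B ?T (\<lambda>a b. tensor_lift k ?T (?G a b) v)" if "v \<in> carrier (tensor k C D)" for v
    by (intro bilinearI bilinear_left[OF G1] bilinear_left[OF G2] that)
  have b: "bilinear k (tensor k A B) (tensor k C D) ?T
      (\<lambda>u v. tensor_lift k ?T (\<lambda>a b. tensor_lift k ?T (?G a b) v) u)"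
    by (intro bilinear_tensor_lift_left m G3 bilinear_right[OF G2])
  show "linear_map k (tensor k (tensor k A B) (tensor k C D)) ?T (middle_in k A B C D)"
    unfolding middle_in_def Let_def by (rule linear_tensor_lift[OF _ _ _ b]) (rule m)+
  show "middle_in k A B C D (pure k (tensor k A B) (tensor k C D) (pure k A B a b) (pure k C D c d)) = ?G a b c d"
    if "a \<in> carrier A" "b \<in> carrier B" "c \<in> carrier C" "d \<in> carrier D"
    using that unfolding middle_in_def Let_def
    by (simp add: tensor_lift_pure[OF _ _ _ b] m pure_closed tensor_lift_pure[OF _ _ _ G]
      tensor_lift_pure[OF _ _ _ G3])
qed

lemma middle_out:
  assumes A: "module k A" and B: "module k B" and C: "module k C" and D: "module k D"
  shows linear_middle_out: "linear_map k (tensor k (tensor k A (tensor k B C)) D)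
      (tensor k (tensor k A B) (tensor k C D)) (middle_out k A B C D)"
    and middle_out_pure: "a \<in> carrier A \<Longrightarrow> b \<in> carrier B \<Longrightarrow> c \<in> carrier C \<Longrightarrow> d \<in> carrier D
      \<Longrightarrow> middle_out k A B C D (pure k (tensor k A (tensor k B C)) D (pure k A (tensor k B C) a (pure k B C b c)) d)
        = pure k (tensor k A B) (tensor k C D) (pure k A B a b) (pure k C D c d)"
proof -
  let ?T = "tensor k (tensor k A B) (tensor k C D)"
  let ?G = "\<lambda>a b c d. pure k (tensor k A B) (tensor k C D) (pure k A B a b) (pure k C D c d)"
  note m = A B C D module_tensor[OF A B] module_tensor[OF C D] module_tensor[OF B C]
    module_tensor[OF A module_tensor[OF B C]] module_tensor[OF module_tensor[OF A B] module_tensor[OF C D]]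
  have G: "bilinear k B C ?T (\<lambda>b c. ?G a b c d)" if "a \<in> carrier A" "d \<in> carrier D" for a d
    by (intro bilinearI tensor_intros m that)
  have G1: "bilinear k A (tensor k B C) ?T (\<lambda>a v. tensor_lift k ?T (\<lambda>b c. ?G a b c d) v)"
    if "d \<in> carrier D" for d
    by (intro bilinear_tensor_lift_right m G that tensor_intros)
  have G2: "bilinear k D (tensor k B C) ?T (\<lambda>d v. tensor_lift k ?T (\<lambda>b c. ?G a b c d) v)"
    if "a \<in> carrier A" for a
    by (intro bilinear_tensor_lift_right m G that tensor_intros)
  have b: "bilinear k (tensor k A (tensor k B C)) D ?T
      (\<lambda>u d. tensor_lift k ?T (\<lambda>a v. tensor_lift k ?T (\<lambda>b c. ?G a b c d) v) u)"
    by (intro bilinear_tensor_lift_left m G1 bilinear_left[OF G2])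
  show "linear_map k (tensor k (tensor k A (tensor k B C)) D) ?T (middle_out k A B C D)"
    unfolding middle_out_def Let_def by (rule linear_tensor_lift[OF _ _ _ b]) (rule m)+
  show "middle_out k A B C D (pure k (tensor k A (tensor k B C)) D (pure k A (tensor k B C) a (pure k B C b c)) d) = ?G a b c d"
    if "a \<in> carrier A" "b \<in> carrier B" "c \<in> carrier C" "d \<in> carrier D"
    using that unfolding middle_out_def Let_def
    by (simp add: tensor_lift_pure[OF _ _ _ b] m pure_closed tensor_lift_pure[OF _ _ _ G]
      tensor_lift_pure[OF _ _ _ G1])
qed

text \<open>The formula on pure tensors covers only the case in which \<open>T\<close> returns a
  pure tensor. This suffices because \<open>flip\<close>, \<open>R\<close> and \<open>W\<close> do
  so on the families at which they are evaluated.\<close>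

lemma apply_middle:
  assumes A: "module k A" and B: "module k B" and C: "module k C" and D: "module k D"
    and B': "module k B'" and C': "module k C'"
    and T: "linear_map k (tensor k B C) (tensor k B' C') T"
  shows linear_apply_middle: "linear_map k (tensor k (tensor k A B) (tensor k C D))
      (tensor k (tensor k A B') (tensor k C' D)) (apply_middle k A B C D B' C' T)"
    and apply_middle_pure: "a \<in> carrier A \<Longrightarrow> b \<in> carrier B \<Longrightarrow> c \<in> carrier C \<Longrightarrow> d \<in> carrier D
      \<Longrightarrow> b' \<in> carrier B' \<Longrightarrow> c' \<in> carrier C' \<Longrightarrow> T (pure k B C b c) = pure k B' C' b' c'
      \<Longrightarrow> apply_middle k A B C D B' C' T
            (pure k (tensor k A B) (tensor k C D) (pure k A B a b) (pure k C D c d))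
        = pure k (tensor k A B') (tensor k C' D) (pure k A B' a b') (pure k C' D c' d)"
proof -
  note m = A B C D B' C' module_tensor[OF B C] module_tensor[OF B' C']
    module_tensor[OF A module_tensor[OF B C]] module_tensor[OF A module_tensor[OF B' C']]
  have l1: "linear_map k (tensor k A (tensor k B C)) (tensor k A (tensor k B' C'))
      (tensor_map k A (tensor k B' C') (\<lambda>a. a) T)"
    by (intro linear_tensor_map m linear_map_id T)
  have l2: "linear_map k (tensor k (tensor k A (tensor k B C)) D) (tensor k (tensor k A (tensor k B' C')) D)
      (tensor_map k (tensor k A (tensor k B' C')) D (tensor_map k A (tensor k B' C') (\<lambda>a. a) T) (\<lambda>d. d))"
    by (intro linear_tensor_map m linear_map_id l1)
  show "linear_map k (tensor k (tensor k A B) (tensor k C D))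
      (tensor k (tensor k A B') (tensor k C' D)) (apply_middle k A B C D B' C' T)"
    unfolding apply_middle_def comp_def
    by (rule linear_map_comp[OF linear_map_comp[OF linear_middle_in l2] linear_middle_out]) (rule m)+
  show "apply_middle k A B C D B' C' T
            (pure k (tensor k A B) (tensor k C D) (pure k A B a b) (pure k C D c d))
        = pure k (tensor k A B') (tensor k C' D) (pure k A B' a b') (pure k C' D c' d)"
    if "a \<in> carrier A" "b \<in> carrier B" "c \<in> carrier C" "d \<in> carrier D"
      "b' \<in> carrier B'" "c' \<in> carrier C'" "T (pure k B C b c) = pure k B' C' b' c'"
    using that unfolding apply_middle_def
    by (simp add: middle_in_pure m tensor_map_pure[OF _ _ _ _ l1 linear_map_id]
      tensor_map_pure[OF _ _ _ _ linear_map_id T] pure_closed middle_out_pure)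
qed

end

text \<open>The relations see only carrier, addition and scalars. A tensor product may therefore be
  formed over the bare module underlying an algebra or coalgebra record.\<close>

lemma tensor_record_cong:
  assumes "carrier M' = carrier M" "add M' = add M" "smult M' = smult M"
    "carrier N' = carrier N" "add N' = add N" "smult N' = smult N"
  shows tensor_cong: "tensor k M' N' = tensor k M N"
    and pure_cong: "pure k M' N' = pure k M N"
proof -
  have "tensor_null k M' N' = tensor_null k M N"
    using assms by (simp add: tensor_null_def tensor_rels_def)
  then show "tensor k M' N' = tensor k M N" "pure k M' N' = pure k M N"
    using assms by (simp_all add: tensor_def pure_def fun_eq_iff)
qed

lemma tensor_map_record_cong:
  assumes "carrier M' = carrier M" "add M' = add M" "smult M' = smult M"
    "carrier N' = carrier N" "add N' = add N" "smult N' = smult N"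
  shows "tensor_map k M' N' f h = tensor_map k M N f h"
  unfolding tensor_map_def tensor_record_cong[OF assms] ..

lemma (in comm_monoid) finprod_Sigma:
  assumes "finite A" "\<And>x. x \<in> A \<Longrightarrow> finite (B x)" "\<And>x y. x \<in> A \<Longrightarrow> y \<in> B x \<Longrightarrow> f x y \<in> carrier G"
  shows "(\<Otimes>x\<in>A. \<Otimes>y\<in>B x. f x y) = (\<Otimes>p\<in>Sigma A B. f (fst p) (snd p))"
proof -
  have "Sigma A B = (\<Union>x\<in>A. Pair x ` B x)" by auto
  then have "(\<Otimes>p\<in>Sigma A B. f (fst p) (snd p)) = (\<Otimes>x\<in>A. \<Otimes>p\<in>Pair x ` B x. f (fst p) (snd p))"
    using assms by (simp only:) (intro finprod_UN_disjoint, auto simp: pairwise_def disjnt_iff)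
  also have "\<dots> = (\<Otimes>x\<in>A. \<Otimes>y\<in>B x. f x y)"
    using assms by (intro finprod_cong' refl) (auto simp: finprod_reindex inj_on_def Pi_iff)
  finally show ?thesis by simp
qed

lemmas (in abelian_monoid) finsum_Sigma = add.finprod_Sigma

section \<open>Associative algebras\<close>

lemma assoc_algebraD:
  assumes "assoc_algebra k A"
  shows assoc_algebra_module: "module k A" and assoc_algebra_ring: "ring A"
    and bilinear_mult: "bilinear k A A A (monoid.mult A)"
proof -
  show m: "module k A" "ring A" using assms by (auto simp: assoc_algebra_def)
  interpret A: ring A by fact
  show "bilinear k A A A (monoid.mult A)"
    by (intro bilinearI linear_mapI) (use assms in \<open>auto simp: assoc_algebra_def A.l_distr A.r_distr\<close>)
qed

text \<open>The three arguments are widened from \<open>B\<close> to the carrier in turn; in each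
  pass both sides are linear in the argument that is being widened.\<close>

lemma assoc_on_span:
  assumes m: "module k A" and b: "bilinear k A A A f" and B: "spans k A B"
    and "\<And>x y z. x \<in> B \<Longrightarrow> y \<in> B \<Longrightarrow> z \<in> B \<Longrightarrow> f (f x y) z = f x (f y z)"
    and x: "x \<in> carrier A" and y: "y \<in> carrier A" and z: "z \<in> carrier A"
  shows "f (f x y) z = f x (f y z)"
proof -
  have 1: "f (f x y) z = f x (f y z)" if "x \<in> carrier A" "y \<in> B" "z \<in> B" for x y z
    using that spans_closed[OF B] assms(4)
    by (intro spans_ext[OF B m m linear_map_comp[OF bilinear_left[OF b] bilinear_left[OF b]]
          bilinear_left[OF b] _ that(1)] bilinear_closed[OF b]) auto
  have 2: "f (f x y) z = f x (f y z)" if "x \<in> carrier A" "y \<in> carrier A" "z \<in> B" for x y z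
    using that spans_closed[OF B] 1
    by (intro spans_ext[OF B m m linear_map_comp[OF bilinear_right[OF b] bilinear_left[OF b]]
          linear_map_comp[OF bilinear_left[OF b] bilinear_right[OF b]] _ that(2)] bilinear_closed[OF b]) auto
  show ?thesis
    using x y spans_closed[OF B] 2
    by (intro spans_ext[OF B m m bilinear_right[OF b]
          linear_map_comp[OF bilinear_right[OF b] bilinear_right[OF b]] _ z] bilinear_closed[OF b]) auto
qed

lemma assoc_algebraI_span:
  assumes m: "module k A" and b: "bilinear k A A A (monoid.mult A)" and B: "spans k A B"
    and one: "\<one>\<^bsub>A\<^esub> \<in> carrier A"
    and assoc: "\<And>x y z. x \<in> B \<Longrightarrow> y \<in> B \<Longrightarrow> z \<in> B
      \<Longrightarrow> (x \<otimes>\<^bsub>A\<^esub> y) \<otimes>\<^bsub>A\<^esub> z = x \<otimes>\<^bsub>A\<^esub> (y \<otimes>\<^bsub>A\<^esub> z)"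
    and unit: "\<And>x. x \<in> B \<Longrightarrow> \<one>\<^bsub>A\<^esub> \<otimes>\<^bsub>A\<^esub> x = x" "\<And>x. x \<in> B \<Longrightarrow> x \<otimes>\<^bsub>A\<^esub> \<one>\<^bsub>A\<^esub> = x"
  shows "assoc_algebra k A"
proof -
  interpret A: module k A by fact
  note L = linear_mapD[OF bilinear_left[OF b]] and R = linear_mapD[OF bilinear_right[OF b]]
  have "ring A"
  proof (intro ringI monoidI module.axioms(2)[OF m] one)
    show "x \<otimes>\<^bsub>A\<^esub> y \<otimes>\<^bsub>A\<^esub> z = x \<otimes>\<^bsub>A\<^esub> (y \<otimes>\<^bsub>A\<^esub> z)"
      if "x \<in> carrier A" "y \<in> carrier A" "z \<in> carrier A" for x y z
      by (rule assoc_on_span[OF m b B assoc that])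
    show "\<one>\<^bsub>A\<^esub> \<otimes>\<^bsub>A\<^esub> x = x" if "x \<in> carrier A" for x
      by (rule spans_ext[OF B m m bilinear_right[OF b one] linear_map_id unit(1) that])
    show "x \<otimes>\<^bsub>A\<^esub> \<one>\<^bsub>A\<^esub> = x" if "x \<in> carrier A" for x
      by (rule spans_ext[OF B m m bilinear_left[OF b one] linear_map_id unit(2) that])
  qed (auto simp: L R)
  then show ?thesis using m L R by (auto simp: assoc_algebra_def)
qed

context base_field
begin

lemma smash_mult:
  assumes L: "module k L" and H: "module k H" and mL: "bilinear k L L L (monoid.mult L)"
    and mH: "bilinear k H H H (monoid.mult H)" and R: "linear_map k (tensor k H L) (tensor k L H) R"
  shows bilinear_smash_mult:
      "bilinear k (tensor k L H) (tensor k L H) (tensor k L H) (smash_mult k L H R)"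
    and smash_mult_pure: "l \<in> carrier L \<Longrightarrow> h \<in> carrier H \<Longrightarrow> l' \<in> carrier L \<Longrightarrow> h' \<in> carrier H
      \<Longrightarrow> l'' \<in> carrier L \<Longrightarrow> h'' \<in> carrier H \<Longrightarrow> R (pure k H L h l') = pure k L H l'' h''
      \<Longrightarrow> smash_mult k L H R (pure k L H l h) (pure k L H l' h')
        = pure k L H (l \<otimes>\<^bsub>L\<^esub> l'') (h'' \<otimes>\<^bsub>H\<^esub> h')"
proof -
  note m = L H module_tensor[OF L H] module_tensor[OF L L] module_tensor[OF H H]
  have lL: "linear_map k (tensor k L L) L (mult_map k L)"
    unfolding mult_map_def by (rule linear_tensor_lift[OF L L L mL])
  have lH: "linear_map k (tensor k H H) H (mult_map k H)"
    unfolding mult_map_def by (rule linear_tensor_lift[OF H H H mH])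
  have l: "linear_map k (tensor k (tensor k L H) (tensor k L H)) (tensor k L H)
      (\<lambda>u. tensor_map k L H (mult_map k L) (mult_map k H) (apply_middle k L H L H L H R u))"
    by (rule linear_map_comp[OF linear_apply_middle linear_tensor_map]) (rule m lL lH R)+
  show "bilinear k (tensor k L H) (tensor k L H) (tensor k L H) (smash_mult k L H R)"
    unfolding smash_mult_def by (rule bilinear_comp[OF bilinear_pure l]) (rule m)+
  show "smash_mult k L H R (pure k L H l h) (pure k L H l' h')
        = pure k L H (l \<otimes>\<^bsub>L\<^esub> l'') (h'' \<otimes>\<^bsub>H\<^esub> h')"
    if "l \<in> carrier L" "h \<in> carrier H" "l' \<in> carrier L" "h' \<in> carrier H"
      "l'' \<in> carrier L" "h'' \<in> carrier H" "R (pure k H L h l') = pure k L H l'' h''"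
    using that unfolding smash_mult_def
    by (simp add: apply_middle_pure[OF L H L H L H R] tensor_map_pure[OF m(4,5) L H lL lH] pure_closed m
        tensor_lift_pure[OF L L L mL, folded mult_map_def] tensor_lift_pure[OF H H H mH, folded mult_map_def])
qed

lemma smash_comult:
  assumes L: "module k L" and H: "module k H" and cL: "linear_map k L (tensor k L L) (comult L)"
    and cH: "linear_map k H (tensor k H H) (comult H)" and W: "linear_map k (tensor k L H) (tensor k H L) W"
  shows "linear_map k (tensor k L H) (tensor k (tensor k L H) (tensor k L H)) (smash_comult k L H W)"
  unfolding smash_comult_def
  by (rule linear_map_comp[OF linear_tensor_map linear_apply_middle]) (rule L H module_tensor cL cH W)+

lemma tensor_algebra:
  assumes A: "assoc_algebra k A" and B: "assoc_algebra k B"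
  shows assoc_tensor_algebra: "assoc_algebra k (tensor_algebra k A B)"
    and tensor_algebra_mult_pure: "a \<in> carrier A \<Longrightarrow> b \<in> carrier B \<Longrightarrow> a' \<in> carrier A \<Longrightarrow> b' \<in> carrier B
      \<Longrightarrow> pure k A B a b \<otimes>\<^bsub>tensor_algebra k A B\<^esub> pure k A B a' b' = pure k A B (a \<otimes>\<^bsub>A\<^esub> a') (b \<otimes>\<^bsub>B\<^esub> b')"
    and bilinear_tensor_algebra_mult: "bilinear k (tensor k A B) (tensor k A B) (tensor k A B)
      (monoid.mult (tensor_algebra k A B))"
proof -
  interpret A: ring A by (rule assoc_algebra_ring[OF A])
  interpret B: ring B by (rule assoc_algebra_ring[OF B])
  note mA = assoc_algebra_module[OF A] and mB = assoc_algebra_module[OF B]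
  note s = bilinear_smash_mult[OF mA mB bilinear_mult[OF A] bilinear_mult[OF B] linear_flip[OF mB mA]]
  have p: "smash_mult k A B (flip k B A) (pure k A B a b) (pure k A B a' b') = pure k A B (a \<otimes>\<^bsub>A\<^esub> a') (b \<otimes>\<^bsub>B\<^esub> b')"
    if "a \<in> carrier A" "b \<in> carrier B" "a' \<in> carrier A" "b' \<in> carrier B" for a b a' b'
    using that by (intro smash_mult_pure[OF mA mB bilinear_mult[OF A] bilinear_mult[OF B] linear_flip[OF mB mA]]
        flip_pure[OF mB mA]) auto
  let ?B = "{pure k A B x y |x y. x \<in> carrier A \<and> y \<in> carrier B}"
  have sp: "spans k (tensor_algebra k A B) ?B"
    using spans_tensor[OF mA mB spans_carrier spans_carrier]
      tensor_algebra_def[of k A B]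
    unfolding spans_def submodule_def subgroup_def submodule_axioms_def
    by (simp add: m_inv_def)
  have mT: "module k (tensor_algebra k A B)"
    by (rule module_record_cong[OF module_tensor[OF mA mB]]) (simp_all add: tensor_algebra_def)
  have bT: "bilinear k (tensor_algebra k A B) (tensor_algebra k A B) (tensor_algebra k A B)
      (monoid.mult (tensor_algebra k A B))"
    using s by (simp add: tensor_algebra_def bilinear_def linear_map_def)
  have one: "\<one>\<^bsub>tensor_algebra k A B\<^esub> = pure k A B \<one>\<^bsub>A\<^esub> \<one>\<^bsub>B\<^esub>" by (simp add: tensor_algebra_def)
  have mult: "monoid.mult (tensor_algebra k A B) = smash_mult k A B (flip k B A)"
    by (simp add: tensor_algebra_def)
  show "assoc_algebra k (tensor_algebra k A B)"
    by (rule assoc_algebraI_span[OF mT bT sp])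
      (auto simp: one mult p A.m_assoc B.m_assoc spans_closed[OF sp] tensor_algebra_def pure_closed[OF mA mB])
  show "pure k A B a b \<otimes>\<^bsub>tensor_algebra k A B\<^esub> pure k A B a' b' = pure k A B (a \<otimes>\<^bsub>A\<^esub> a') (b \<otimes>\<^bsub>B\<^esub> b')"
    if "a \<in> carrier A" "b \<in> carrier B" "a' \<in> carrier A" "b' \<in> carrier B"
    using p[OF that] by (simp add: mult)
  show "bilinear k (tensor k A B) (tensor k A B) (tensor k A B) (monoid.mult (tensor_algebra k A B))"
    using s by (simp add: mult)
qed

section \<open>Monoid algebras and free algebras\<close>

lemma monoid_algebra_simps:
  "carrier (monoid_algebra k G) = carrier (free_module k (carrier G))"
  "add (monoid_algebra k G) = add (free_module k (carrier G))"
  "ring.zero (monoid_algebra k G) = ring.zero (free_module k (carrier G))"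
  "smult (monoid_algebra k G) = smult (free_module k (carrier G))"
  "\<one>\<^bsub>monoid_algebra k G\<^esub> = single k \<one>\<^bsub>G\<^esub>"
  by (simp_all add: monoid_algebra_def)

lemma module_monoid_algebra: "module k (monoid_algebra k G)"
  by (rule module_record_cong[OF module_free]) (simp_all add: monoid_algebra_simps)

lemma spans_record_cong:
  assumes "carrier M' = carrier M" "add M' = add M" "ring.zero M' = ring.zero M" "smult M' = smult M"
    "spans k M B"
  shows "spans k M' B"
  using assms by (simp add: spans_def submodule_def subgroup_def submodule_axioms_def m_inv_def)

text \<open>Evaluation at \<open>z\<close> is a linear functional, so it passes through the finite
  sum.\<close>

lemma lin_ext_eval:
  assumes h: "h \<in> V \<rightarrow> carrier (free_module k U)" and r: "r \<in> carrier (free_module k V)"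
  shows "lin_ext k (free_module k U) h r z = (\<Oplus>x\<in>{x. r x \<noteq> \<zero>}. r x \<otimes> h x z)"
proof -
  have "linear_map k (free_module k U) (self_module k) (\<lambda>f. f z)"
    by (rule linear_mapI) (auto simp: free_module_simps self_module_def)
  then have "lin_ext k (free_module k U) h r z = (\<Oplus>\<^bsub>self_module k\<^esub>x\<in>{x. r x \<noteq> \<zero>}. r x \<odot>\<^bsub>self_module k\<^esub> h x z)"
    unfolding lin_ext_def using h r
    by (intro linear_map_lincomb[OF module_free module_self]) (auto simp: free_module_simps(1)[of V] subset_iff Pi_iff)
  also have "\<dots> = (\<Oplus>x\<in>{x. r x \<noteq> \<zero>}. r x \<otimes> h x z)"
    by (subst finsum_record_cong[of _ k]) (simp_all add: self_module_def)
  finally show ?thesis .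
qed

text \<open>Once the convolution is recognised as a bilinear extension, its bilinearity needs no
  bookkeeping of supports.\<close>

lemma monoid_algebra_mult:
  assumes G: "monoid G" and f: "f \<in> carrier (monoid_algebra k G)" and h: "h \<in> carrier (monoid_algebra k G)"
  shows "f \<otimes>\<^bsub>monoid_algebra k G\<^esub> h
    = bil_ext (free_module k (carrier G)) (\<lambda>a b. single k (a \<otimes>\<^bsub>G\<^esub> b)) f h"
proof
  fix z
  interpret G: monoid G by fact
  let ?F = "free_module k (carrier G)" and ?A = "{x. f x \<noteq> \<zero>}" and ?B = "{x. h x \<noteq> \<zero>}"
  let ?s = "\<lambda>a b. single k (a \<otimes>\<^bsub>G\<^esub> b) z"
  have k: "f x \<in> carrier k" "h x \<in> carrier k" "?s a b \<in> carrier k" for x a b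
    using f h by (auto simp: monoid_algebra_simps free_module_simps single_def)
  have fin: "finite ?A" "finite ?B" "?A \<subseteq> carrier G" "?B \<subseteq> carrier G" and fh: "f \<in> carrier ?F" "h \<in> carrier ?F"
    using f h by (auto simp: monoid_algebra_simps free_module_simps)
  have s: "(\<lambda>b. single k (a \<otimes>\<^bsub>G\<^esub> b)) \<in> carrier G \<rightarrow> carrier ?F" if "a \<in> carrier G" for a
    using that by (auto intro: single_closed)
  \<comment> \<open>The sum over the pairs with product \<open>z\<close> is enlarged to the full
    rectangle of the supports; the condition on the product turns into the factor \<open>?s\<close>,
    which is zero off it.\<close>
  have "(f \<otimes>\<^bsub>monoid_algebra k G\<^esub> h) z = (\<Oplus>p\<in>?A \<times> ?B. f (fst p) \<otimes> (h (snd p) \<otimes> ?s (fst p) (snd p)))"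
    unfolding monoid_algebra_def
    by (simp, intro add.finprod_mono_neutral_cong_left) (use k fin in \<open>auto simp: single_def\<close>)
  also have "\<dots> = (\<Oplus>a\<in>?A. \<Oplus>b\<in>?B. f a \<otimes> (h b \<otimes> ?s a b))"
    by (rule finsum_Sigma[symmetric, of ?A "\<lambda>_. ?B" "\<lambda>a b. f a \<otimes> (h b \<otimes> ?s a b)"]) (use k fin in auto)
  also have "\<dots> = (\<Oplus>a\<in>?A. f a \<otimes> (lin_ext k ?F (\<lambda>b. single k (a \<otimes>\<^bsub>G\<^esub> b)) h z))"
  proof (rule finsum_cong')
    have ev: "lin_ext k ?F (\<lambda>b. single k (a \<otimes>\<^bsub>G\<^esub> b)) h z = (\<Oplus>b\<in>?B. h b \<otimes> ?s a b)" if "a \<in> ?A" for a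
      using fin that by (intro lin_ext_eval[OF s fh(2)]) auto
    show "(\<Oplus>b\<in>?B. f a \<otimes> (h b \<otimes> ?s a b)) = f a \<otimes> lin_ext k ?F (\<lambda>b. single k (a \<otimes>\<^bsub>G\<^esub> b)) h z"
      if "a \<in> ?A" for a
      unfolding ev[OF that] using k fin by (intro finsum_rdistr[symmetric]) auto
    show "(\<lambda>a. f a \<otimes> lin_ext k ?F (\<lambda>b. single k (a \<otimes>\<^bsub>G\<^esub> b)) h z) \<in> ?A \<rightarrow> carrier k"
      using k by (auto simp: ev intro!: finsum_closed m_closed)
  qed simp
  also have "\<dots> = bil_ext ?F (\<lambda>a b. single k (a \<otimes>\<^bsub>G\<^esub> b)) f h z"
    unfolding bil_ext_def using linear_map_closed[OF linear_lin_ext[OF module_free s] fh(2)]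
    by (intro lin_ext_eval[OF _ fh(1), symmetric]) auto
  finally show "(f \<otimes>\<^bsub>monoid_algebra k G\<^esub> h) z = bil_ext ?F (\<lambda>a b. single k (a \<otimes>\<^bsub>G\<^esub> b)) f h z" .
qed

lemma bilinear_monoid_algebra_mult:
  assumes G: "monoid G"
  shows "bilinear k (monoid_algebra k G) (monoid_algebra k G) (monoid_algebra k G)
    (monoid.mult (monoid_algebra k G))"
proof -
  let ?F = "free_module k (carrier G)"
  have "bilinear k ?F ?F ?F (bil_ext ?F (\<lambda>a b. single k (a \<otimes>\<^bsub>G\<^esub> b)))"
    by (intro bilinear_bil_ext module_free single_closed monoid.m_closed[OF G])
  then have "bilinear k ?F ?F ?F (monoid.mult (monoid_algebra k G))"
    by (rule bilinear_cong[OF _ module_free module_free])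
      (simp add: monoid_algebra_mult[OF G] monoid_algebra_simps(1))
  then show ?thesis by (simp add: bilinear_def linear_map_def monoid_algebra_simps(1,2,4))
qed

lemma monoid_algebra_mult_single:
  "single k a \<otimes>\<^bsub>monoid_algebra k G\<^esub> single k b = single k (a \<otimes>\<^bsub>G\<^esub> b)"
proof
  fix z
  have "{p. single k a (fst p) \<noteq> \<zero> \<and> single k b (snd p) \<noteq> \<zero> \<and> fst p \<otimes>\<^bsub>G\<^esub> snd p = z}
      = (if a \<otimes>\<^bsub>G\<^esub> b = z then {(a, b)} else {})"
    by (auto simp: single_def split: if_splits)
  then show "(single k a \<otimes>\<^bsub>monoid_algebra k G\<^esub> single k b) z = single k (a \<otimes>\<^bsub>G\<^esub> b) z"
    by (auto simp: monoid_algebra_def single_def)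
qed

lemma spans_monoid_algebra: "spans k (monoid_algebra k G) (single k ` carrier G)"
  by (rule spans_record_cong[OF _ _ _ _ spans_free]) (simp_all add: monoid_algebra_simps)

lemma assoc_monoid_algebra:
  assumes G: "monoid G"
  shows "assoc_algebra k (monoid_algebra k G)"
proof -
  interpret G: monoid G by fact
  show ?thesis
    by (rule assoc_algebraI_span[OF module_monoid_algebra bilinear_monoid_algebra_mult[OF G] spans_monoid_algebra])
      (auto simp: monoid_algebra_simps monoid_algebra_mult_single G.m_assoc single_closed)
qed

lemma assoc_free_algebra: "assoc_algebra k (free_algebra k U)"
  unfolding free_algebra_def
  by (rule assoc_monoid_algebra) (rule monoidI, auto simp: free_monoid_def)

lemma free_algebra_mult_single:
  "single k v \<otimes>\<^bsub>free_algebra k U\<^esub> single k w = single k (v @ w)"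
  by (simp add: free_algebra_def monoid_algebra_mult_single) (simp add: free_monoid_def)

lemma free_algebra_one: "\<one>\<^bsub>free_algebra k U\<^esub> = single k []"
  by (simp add: free_algebra_def monoid_algebra_simps) (simp add: free_monoid_def)

lemma spans_free_algebra: "spans k (free_algebra k U) (single k ` lists U)"
  using spans_monoid_algebra[of "free_monoid U"] by (simp add: free_algebra_def free_monoid_def)

lemma single_free_algebra_closed: "w \<in> lists U \<Longrightarrow> single k w \<in> carrier (free_algebra k U)"
  using spans_closed[OF spans_free_algebra] by blast

lemma free_algebra_lift:
  assumes A: "assoc_algebra k A" and v: "v \<in> U \<rightarrow> carrier A"
  shows linear_free_algebra_lift: "linear_map k (free_algebra k U) A (free_algebra_lift k A v)"
    and free_algebra_lift_single: "w \<in> lists U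
      \<Longrightarrow> free_algebra_lift k A v (single k w) = foldr (\<lambda>x y. v x \<otimes>\<^bsub>A\<^esub> y) w \<one>\<^bsub>A\<^esub>"
    and ring_hom_free_algebra_lift: "free_algebra_lift k A v \<in> ring_hom (free_algebra k U) A"
proof -
  interpret A: ring A by (rule assoc_algebra_ring[OF A])
  note m = assoc_algebra_module[OF A]
  let ?F = "free_algebra k U"
  interpret F: ring ?F by (rule assoc_algebra_ring[OF assoc_free_algebra])
  let ?f = "\<lambda>w. foldr (\<lambda>x y. v x \<otimes>\<^bsub>A\<^esub> y) w \<one>\<^bsub>A\<^esub>"
  have f: "?f w \<in> carrier A" if "w \<in> lists U" for w
    using that v by induction auto
  have f_app: "?f (w @ w') = ?f w \<otimes>\<^bsub>A\<^esub> ?f w'" if "w \<in> lists U" "w' \<in> lists U" for w w'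
    using that(1) by induction (use v f[OF that(2)] f in \<open>auto simp: A.m_assoc Pi_iff\<close>)
  have c: "carrier ?F = carrier (free_module k (lists U))" "add ?F = add (free_module k (lists U))"
    "smult ?F = smult (free_module k (lists U))"
    by (simp_all add: free_algebra_def monoid_algebra_simps free_monoid_def)
  show l: "linear_map k ?F A (free_algebra_lift k A v)"
    unfolding linear_map_record_cong[OF c refl refl refl] free_algebra_lift_def
    by (rule linear_lin_ext[OF m]) (use f in auto)
  show s: "free_algebra_lift k A v (single k w) = ?f w" if "w \<in> lists U" for w
    unfolding free_algebra_lift_def using f[OF that] by (rule lin_ext_single[OF m])
  show "free_algebra_lift k A v \<in> ring_hom ?F A"
  proof (rule ring_hom_memI)
    fix x y assume xy: "x \<in> carrier ?F" "y \<in> carrier ?F"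
    show "free_algebra_lift k A v (x \<otimes>\<^bsub>?F\<^esub> y) = free_algebra_lift k A v x \<otimes>\<^bsub>A\<^esub> free_algebra_lift k A v y"
      by (rule bilinear_ext[OF spans_free_algebra spans_free_algebra assoc_algebra_module[OF assoc_free_algebra]
            assoc_algebra_module[OF assoc_free_algebra] m bilinear_comp[OF bilinear_mult[OF assoc_free_algebra] l]
            bilinear_comp_args[OF bilinear_mult[OF A] l l] _ xy])
        (elim imageE, simp only: free_algebra_mult_single s f_app append_in_lists_conv)
  qed (use linear_mapD[OF l] s[of "[]"] in \<open>auto simp: free_algebra_one\<close>)
qed

section \<open>Quotient algebras\<close>

text \<open>Scaling by \<open>c\<close> is multiplication by \<open>c\<close> times the unit, so an
  ideal of the ring is stable under scalars.\<close>

lemma submodule_ideal: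
  assumes A: "assoc_algebra k A" and I: "ideal I A"
  shows "submodule I k A"
proof -
  interpret r: ring A by (rule assoc_algebra_ring[OF A])
  interpret m: module k A by (rule assoc_algebra_module[OF A])
  interpret I: ideal I A by fact
  show ?thesis
  proof (rule m.submoduleI)
    show "c \<odot>\<^bsub>A\<^esub> x \<in> I" if "c \<in> carrier k" "x \<in> I" for c x
    proof -
      have x: "x \<in> carrier A" using that I.a_Hcarr by blast
      have "c \<odot>\<^bsub>A\<^esub> x = (c \<odot>\<^bsub>A\<^esub> \<one>\<^bsub>A\<^esub>) \<otimes>\<^bsub>A\<^esub> x"
        using A that(1) x by (simp add: assoc_algebra_def)
      then show ?thesis using that by (simp add: I.I_l_closed)
    qed
  qed (use I.a_subset in auto)
qed

lemma quot_algebra: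
  assumes A: "assoc_algebra k A" and I: "ideal I A"
  shows quotient_ideal: "quotient k A I"
    and assoc_quot_algebra: "assoc_algebra k (quot_module A I)"
    and quot_algebra_mult: "x \<in> carrier A \<Longrightarrow> y \<in> carrier A
      \<Longrightarrow> (I +>\<^bsub>A\<^esub> x) \<otimes>\<^bsub>quot_module A I\<^esub> (I +>\<^bsub>A\<^esub> y) = I +>\<^bsub>A\<^esub> (x \<otimes>\<^bsub>A\<^esub> y)"
    and quot_algebra_one: "\<one>\<^bsub>quot_module A I\<^esub> = I +>\<^bsub>A\<^esub> \<one>\<^bsub>A\<^esub>"
proof -
  interpret r: ring A by (rule assoc_algebra_ring[OF A])
  interpret I: ideal I A by fact
  interpret Q: quotient k A I
    by (intro quotient.intro quotient_axioms.intro assoc_algebra_module[OF A] submodule_ideal[OF A I])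
  show "quotient k A I" by (rule Q.quotient_axioms)
  have m: "(I +>\<^bsub>A\<^esub> x) \<otimes>\<^bsub>quot_module A I\<^esub> (I +>\<^bsub>A\<^esub> y) = I +>\<^bsub>A\<^esub> (x \<otimes>\<^bsub>A\<^esub> y)"
    if "x \<in> carrier A" "y \<in> carrier A" for x y
    using I.rcoset_mult_add[OF that] by (simp add: quot_module_def ring.defs module.defs FactRing_def)
  then show "x \<in> carrier A \<Longrightarrow> y \<in> carrier A
      \<Longrightarrow> (I +>\<^bsub>A\<^esub> x) \<otimes>\<^bsub>quot_module A I\<^esub> (I +>\<^bsub>A\<^esub> y) = I +>\<^bsub>A\<^esub> (x \<otimes>\<^bsub>A\<^esub> y)" .
  show one: "\<one>\<^bsub>quot_module A I\<^esub> = I +>\<^bsub>A\<^esub> \<one>\<^bsub>A\<^esub>"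
    by (simp add: quot_module_def ring.defs module.defs FactRing_def)
  have bil: "bilinear k (quot_module A I) (quot_module A I) (quot_module A I) (monoid.mult (quot_module A I))"
    by (intro bilinearI linear_mapI)
      (use A in \<open>auto simp: Q.quot_module_simps(1,3) Q.quot_smult m r.l_distr r.r_distr assoc_algebra_def\<close>)
  show "assoc_algebra k (quot_module A I)"
    by (rule assoc_algebraI_span[OF Q.module_quot bil spans_carrier])
      (auto simp: Q.quot_module_simps(1) m one r.m_assoc)
qed

end

section \<open>Bicharacters on exponents and Gaussian binomial coefficients\<close>

text \<open>The homomorphism on exponents that sends the unit exponent of \<open>i\<close> to
  \<open>v i\<close>. Exponents are multisets, so that multiplying monomials and splitting off one
  variable become multiset operations.\<close>

definition mset_prod :: "('x, 'y) monoid_scheme \<Rightarrow> 'i set \<Rightarrow> ('i \<Rightarrow> 'x) \<Rightarrow> 'i multiset \<Rightarrow> 'x" where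
  "mset_prod N T v a = (\<Otimes>\<^bsub>N\<^esub>i\<in>T. v i [^]\<^bsub>N\<^esub> count a i)"

context comm_monoid
begin

lemma mset_prod_closed: "v \<in> T \<rightarrow> carrier G \<Longrightarrow> mset_prod G T v a \<in> carrier G"
  unfolding mset_prod_def by (rule finprod_closed) auto

lemma mset_prod_empty: "mset_prod G T v {#} = \<one>"
  by (simp add: mset_prod_def)

lemma mset_prod_union:
  assumes "v \<in> T \<rightarrow> carrier G"
  shows "mset_prod G T v (a + b) = mset_prod G T v a \<otimes> mset_prod G T v b"
proof -
  have "mset_prod G T v (a + b) = (\<Otimes>i\<in>T. v i [^] count a i \<otimes> v i [^] count b i)"
    unfolding mset_prod_def using assms by (intro finprod_cong') (auto simp: nat_pow_mult Pi_iff)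
  also have "\<dots> = mset_prod G T v a \<otimes> mset_prod G T v b"
    unfolding mset_prod_def using assms by (intro finprod_multf) auto
  finally show ?thesis .
qed

lemma mset_prod_mult:
  assumes "v \<in> T \<rightarrow> carrier G" "w \<in> T \<rightarrow> carrier G"
  shows "mset_prod G T (\<lambda>i. v i \<otimes> w i) a = mset_prod G T v a \<otimes> mset_prod G T w a"
proof -
  have "mset_prod G T (\<lambda>i. v i \<otimes> w i) a = (\<Otimes>i\<in>T. v i [^] count a i \<otimes> w i [^] count a i)"
    unfolding mset_prod_def using assms by (intro finprod_cong') (auto simp: nat_pow_distrib Pi_iff)
  also have "\<dots> = mset_prod G T v a \<otimes> mset_prod G T w a"
    unfolding mset_prod_def using assms by (intro finprod_multf) auto
  finally show ?thesis .
qed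

lemma mset_prod_single:
  assumes "v \<in> T \<rightarrow> carrier G" "i \<in> T" "finite T"
  shows "mset_prod G T v {#i#} = v i"
proof -
  have "mset_prod G T v {#i#} = (\<Otimes>j\<in>T. if i = j then v j else \<one>)"
    unfolding mset_prod_def using assms(1) by (intro finprod_cong') (auto simp: Pi_iff)
  also have "\<dots> = v i" using assms by (intro finprod_singleton) auto
  finally show ?thesis .
qed

lemma mset_prod_one: "(\<And>i. i \<in> T \<Longrightarrow> v i = \<one>) \<Longrightarrow> mset_prod G T v a = \<one>"
  unfolding mset_prod_def by (rule finprod_one_eqI) auto

lemma mset_prod_cong:
  "w \<in> T \<rightarrow> carrier G \<Longrightarrow> (\<And>i. i \<in> T \<Longrightarrow> v i = w i) \<Longrightarrow> mset_prod G T v a = mset_prod G T w a"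
  unfolding mset_prod_def by (intro finprod_cong') (auto simp: Pi_iff)

end

context base_field
begin

definition bichar :: "nat set \<Rightarrow> (nat \<Rightarrow> nat \<Rightarrow> 'a) \<Rightarrow> nat multiset \<Rightarrow> nat multiset \<Rightarrow> 'a" where
  "bichar T u a b = mset_prod k T (\<lambda>i. mset_prod k T (u i) b) a"

text \<open>Additivity on the left is \<open>mset_prod_union\<close>; additivity on the right holds
  in each factor and is collected by \<open>mset_prod_mult\<close>.\<close>

lemma bichar:
  assumes u: "\<And>i j. i \<in> T \<Longrightarrow> j \<in> T \<Longrightarrow> u i j \<in> carrier k" and fin: "finite T"
  shows bichar_closed: "bichar T u a b \<in> carrier k"
    and bichar_union_left: "bichar T u (a + a') b = bichar T u a b \<otimes> bichar T u a' b"
    and bichar_union_right: "bichar T u a (b + b') = bichar T u a b \<otimes> bichar T u a b'"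
    and bichar_single: "i \<in> T \<Longrightarrow> j \<in> T \<Longrightarrow> bichar T u {#i#} {#j#} = u i j"
proof -
  have c: "(\<lambda>i. mset_prod k T (u i) b) \<in> T \<rightarrow> carrier k" for b
    using u by (auto intro: mset_prod_closed)
  show "bichar T u a b \<in> carrier k" unfolding bichar_def by (rule mset_prod_closed[OF c])
  show "bichar T u (a + a') b = bichar T u a b \<otimes> bichar T u a' b"
    unfolding bichar_def by (rule mset_prod_union[OF c])
  have "bichar T u a (b + b') = mset_prod k T (\<lambda>i. mset_prod k T (u i) b \<otimes> mset_prod k T (u i) b') a"
    unfolding bichar_def using u c
    by (intro mset_prod_cong) (auto intro!: mset_prod_union mset_prod_closed m_closed)
  then show "bichar T u a (b + b') = bichar T u a b \<otimes> bichar T u a b'"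
    unfolding bichar_def by (simp add: mset_prod_mult[OF c c])
  show "bichar T u {#i#} {#j#} = u i j" if "i \<in> T" "j \<in> T"
    unfolding bichar_def using that u fin mset_prod_single[OF c that(1) fin]
    by (simp add: mset_prod_single Pi_iff)
qed

lemma bichar_empty:
  "bichar T u {#} b = \<one>" "bichar T u a {#} = \<one>"
  by (simp_all add: bichar_def mset_prod_empty mset_prod_one)

lemma bichar_inverse:
  assumes "\<And>i j. i \<in> T \<Longrightarrow> j \<in> T \<Longrightarrow> u i j \<in> carrier k" "\<And>i j. i \<in> T \<Longrightarrow> j \<in> T \<Longrightarrow> w i j \<in> carrier k"
    "\<And>i j. i \<in> T \<Longrightarrow> j \<in> T \<Longrightarrow> u i j \<otimes> w i j = \<one>"
  shows "bichar T u a b \<otimes> bichar T w a b = \<one>"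
proof -
  have c: "(\<lambda>i. mset_prod k T (u i) b) \<in> T \<rightarrow> carrier k" "(\<lambda>i. mset_prod k T (w i) b) \<in> T \<rightarrow> carrier k"
    using assms(1,2) by (auto intro: mset_prod_closed)
  have "mset_prod k T (u i) b \<otimes> mset_prod k T (w i) b = \<one>" if "i \<in> T" for i
    using assms that by (subst mset_prod_mult[symmetric]) (auto intro: mset_prod_one)
  then show ?thesis
    unfolding bichar_def by (subst mset_prod_mult[OF c, symmetric]) (auto intro: mset_prod_one)
qed

text \<open>\<open>qbin q r s\<close> is the Gaussian binomial coefficient of \<open>r + s\<close> over \<open>r\<close>.\<close>

fun qbin :: "'a \<Rightarrow> nat \<Rightarrow> nat \<Rightarrow> 'a" where
  "qbin q 0 s = \<one>"
| "qbin q (Suc r) 0 = \<one>"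
| "qbin q (Suc r) (Suc s) = qbin q r (Suc s) \<oplus> q [^] Suc r \<otimes> qbin q (Suc r) s"

lemma qbin_closed: "q \<in> carrier k \<Longrightarrow> qbin q r s \<in> carrier k"
  by (induction q r s rule: qbin.induct) auto

lemma qbin_0_right: "qbin q r 0 = \<one>"
  by (cases r) auto

text \<open>Includes the edges \<open>r = 0\<close> and \<open>s = 0\<close>, which the recursion
  treats apart. At \<open>r + s = 0\<close> both summands would be zero although the coefficient is
  1.\<close>

lemma qbin_pascal:
  assumes "q \<in> carrier k" "r + s > 0"
  shows "qbin q r s = (if r > 0 then qbin q (r - 1) s else \<zero>) \<oplus>
    (if s > 0 then q [^] r \<otimes> qbin q r (s - 1) else \<zero>)"
  using assms by (cases r; cases s) (auto simp: qbin_0_right qbin_closed)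

text \<open>Both sides are the Gaussian multinomial of \<open>r\<close>, \<open>s\<close>,
  \<open>l\<close>. The expression by q-factorials would require divisions that fail at a root of
  unity, hence an induction by Pascal's rule.\<close>

lemma qbin_cocycle:
  assumes q: "q \<in> carrier k"
  shows "qbin q (r + s) l \<otimes> qbin q r s = qbin q r (s + l) \<otimes> qbin q s l"
proof (induction "r + s + l" arbitrary: r s l rule: less_induct)
  case less
  note [simp] = qbin_closed[OF q] q
  show ?case
  proof (cases "r = 0 \<or> s = 0 \<or> l = 0")
    case True
    then show ?thesis by (auto simp: qbin_0_right)
  next
    case False
    then obtain r' s' l' where [simp]: "r = Suc r'" "s = Suc s'" "l = Suc l'"
      by (metis not0_implies_Suc)
    \<comment> \<open>The hypothesis is used with each of the three arguments lowered by one.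
      Weighted by 1, q^r and q^(r+s), the three equations add up to the claim.\<close>
    have 1: "qbin q (Suc (r' + s')) (Suc l') \<otimes> qbin q r' (Suc s') = qbin q r' (Suc (s' + Suc l')) \<otimes> qbin q (Suc s') (Suc l')"
      using less[of r' "Suc s'" "Suc l'"] by simp
    have 2: "qbin q (Suc (r' + s')) (Suc l') \<otimes> qbin q (Suc r') s' = qbin q (Suc r') (Suc (s' + l')) \<otimes> qbin q s' (Suc l')"
      using less[of "Suc r'" s' "Suc l'"] by simp
    have 3: "qbin q (Suc (Suc (r' + s'))) l' \<otimes> qbin q (Suc r') (Suc s') = qbin q (Suc r') (Suc (s' + l')) \<otimes> qbin q (Suc s') l'"
      using less[of "Suc r'" "Suc s'" l'] by simp
    have p: "q [^] Suc (Suc (r' + s')) = q [^] Suc r' \<otimes> q [^] Suc s'"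
      using nat_pow_mult[OF q, of "Suc r'" "Suc s'"] by simp
    let ?A = "qbin q (Suc (r' + s')) (Suc l')" and ?P = "q [^] Suc r'" and ?Q = "q [^] Suc s'"
    let ?B = "qbin q (Suc (Suc (r' + s'))) l'"
    have "qbin q (r + s) l \<otimes> qbin q r s = (?A \<oplus> (?P \<otimes> ?Q) \<otimes> ?B) \<otimes> qbin q (Suc r') (Suc s')"
      by (simp only: \<open>r = _\<close> \<open>s = _\<close> \<open>l = _\<close> add_Suc add_Suc_right qbin.simps p)
    also have "\<dots> = ?A \<otimes> (qbin q r' (Suc s') \<oplus> ?P \<otimes> qbin q (Suc r') s') \<oplus> (?P \<otimes> ?Q) \<otimes> (?B \<otimes> qbin q (Suc r') (Suc s'))"
      by (subst l_distr) (simp_all add: m_assoc del: nat_pow_Suc)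
    also have "\<dots> = ?A \<otimes> qbin q r' (Suc s') \<oplus> ?P \<otimes> (?A \<otimes> qbin q (Suc r') s') \<oplus> (?P \<otimes> ?Q) \<otimes> (?B \<otimes> qbin q (Suc r') (Suc s'))"
      by (simp add: r_distr m_lcomm del: nat_pow_Suc)
    also have "\<dots> = qbin q r' (Suc (s' + Suc l')) \<otimes> qbin q (Suc s') (Suc l')
      \<oplus> ?P \<otimes> (qbin q (Suc r') (Suc (s' + l')) \<otimes> qbin q s' (Suc l'))
      \<oplus> (?P \<otimes> ?Q) \<otimes> (qbin q (Suc r') (Suc (s' + l')) \<otimes> qbin q (Suc s') l')"
      by (simp only: 1 2 3)
    also have "\<dots> = qbin q r' (Suc (s' + Suc l')) \<otimes> qbin q (Suc s') (Suc l')
      \<oplus> ?P \<otimes> qbin q (Suc r') (Suc (s' + l')) \<otimes> (qbin q s' (Suc l') \<oplus> ?Q \<otimes> qbin q (Suc s') l')"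
      by (simp add: r_distr m_ac a_ac del: nat_pow_Suc qbin.simps)
    also have "\<dots> = (qbin q r' (Suc (s' + Suc l')) \<oplus> ?P \<otimes> qbin q (Suc r') (s' + Suc l')) \<otimes> qbin q (Suc s') (Suc l')"
      by (simp add: l_distr del: nat_pow_Suc)
    also have "\<dots> = qbin q r (s + l) \<otimes> qbin q s l" by simp
    finally show ?thesis .
  qed
qed

text \<open>\<open>qbin q 1 s\<close> is the q-integer 1 + q + ... + q^s, and multiplication by q -
  1 makes it telescope. Its zeros are thus read off from the order of \<open>q\<close>.\<close>

lemma qbin_1: "q \<in> carrier k \<Longrightarrow> (q \<ominus> \<one>) \<otimes> qbin q 1 s = q [^] Suc s \<ominus> \<one>"
proof (induction s)
  case 0
  then show ?case by (simp add: a_minus_def)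
next
  case (Suc s)
  have "(q \<ominus> \<one>) \<otimes> qbin q 1 (Suc s) = (q \<ominus> \<one>) \<oplus> q \<otimes> ((q \<ominus> \<one>) \<otimes> qbin q 1 s)"
    using Suc.prems qbin_closed[OF Suc.prems, of 1 s] by (simp add: r_distr m_lcomm)
  also have "\<dots> = (q \<ominus> \<one>) \<oplus> q \<otimes> (q [^] Suc s \<ominus> \<one>)" using Suc by simp
  also have "\<dots> = q [^] Suc (Suc s) \<ominus> \<one>"
  proof -
    have "q [^] Suc s \<in> carrier k" "q [^] Suc (Suc s) = q \<otimes> q [^] Suc s"
      using Suc.prems nat_pow_Suc2[OF Suc.prems, of "Suc s"] by auto
    then show ?thesis using Suc.prems by (simp only:) algebra
  qed
  finally show ?case .
qed

text \<open>For \<open>r + s = m\<close> the cocycle identity at \<open>(1, r - 1, s)\<close> writes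
  the coefficient times the q-integer of \<open>r\<close> as a multiple of the q-integer of
  \<open>m\<close>. The latter is zero, the former is not since \<open>r < m\<close>. For larger
  \<open>r + s\<close> both summands of Pascal's rule vanish by induction.\<close>

lemma qbin_eq_zero:
  assumes q: "primitive_root_of_unity k m q" and "r < m" "s < m" "m \<le> r + s"
  shows "qbin q r s = \<zero>"
  using assms(2-)
proof (induction "r + s" arbitrary: r s rule: less_induct)
  case less
  have qk [simp]: "q \<in> carrier k" and qm: "q [^] m = \<one>"
    and prim: "\<And>j. 0 < j \<Longrightarrow> j < m \<Longrightarrow> q [^] j \<noteq> \<one>"
    using q by (auto simp: primitive_root_of_unity_def)
  note [simp] = qbin_closed[OF qk]
  have eq0: "a = \<one>" if "a \<ominus> \<one> = \<zero>" "a \<in> carrier k" for a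
    using that by (simp add: r_right_minus_eq)
  have pos: "r > 0" "s > 0" using less.prems by auto
  show ?case
  proof (cases "r + s = m")
    case True
    \<comment> \<open>Both \<open>r\<close> and \<open>s\<close> are positive, so the order
      \<open>m\<close> is at least 2.\<close>
    have q1: "q \<noteq> \<one>" using prim[of 1] pos True by auto
    have "(q \<ominus> \<one>) \<otimes> qbin q 1 (r - 1 + s) = \<zero>"
      using qbin_1[OF qk, of "r - 1 + s"] pos True qm by (simp add: r_right_minus_eq)
    then have z: "qbin q 1 (r - 1 + s) = \<zero>"
      using integral_iff[of "q \<ominus> \<one>"] q1 eq0[OF _ qk] by auto
    have "(q \<ominus> \<one>) \<otimes> qbin q 1 (r - 1) = q [^] r \<ominus> \<one>"
      using qbin_1[OF qk, of "r - 1"] pos by simp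
    moreover have "q [^] r \<ominus> \<one> \<noteq> \<zero>" using prim[of r] pos less.prems eq0[of "q [^] r"] by auto
    ultimately have "(q \<ominus> \<one>) \<otimes> qbin q 1 (r - 1) \<noteq> \<zero>" by (rule ssubst)
    then have nz: "qbin q 1 (r - 1) \<noteq> \<zero>" by auto
    have "qbin q r s \<otimes> qbin q 1 (r - 1) = \<zero>"
      using qbin_cocycle[OF qk, of 1 "r - 1" s] pos z by (simp add: One_nat_def[symmetric] del: One_nat_def)
    then show ?thesis using nz integral_iff by auto
  next
    case False
    have "qbin q (r - 1) s = \<zero>" "qbin q r (s - 1) = \<zero>"
      using less.prems pos False by (auto intro!: less.hyps)
    then show ?thesis using qbin_pascal[of q r s] pos by simp
  qed
qed

end

locale hopf_datum = base_field k + C: comm_group C for k (structure) and C +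
  fixes t :: nat and g :: "nat \<Rightarrow> 'c" and gs :: "nat \<Rightarrow> 'c \<Rightarrow> 'a" and n :: "nat \<Rightarrow> nat"
  assumes g: "l \<in> {1..t} \<Longrightarrow> g l \<in> carrier C"
    and gs: "l \<in> {1..t} \<Longrightarrow> gs l \<in> hom C (units_of k)"
    and prim: "l \<in> {1..t} \<Longrightarrow> primitive_root_of_unity k (n l) (gs l (g l))"
    and skew: "r \<in> {1..t} \<Longrightarrow> l \<in> {1..t} \<Longrightarrow> r \<noteq> l \<Longrightarrow> gs r (g l) = inv (gs l (g r))"
begin

abbreviation T where "T \<equiv> {1..t}"
abbreviation exps where "exps a \<equiv> set_mset a \<subseteq> T"

text \<open>With \<open>x\<^sup>a\<close> the monomial in increasing order of the variables, these are the structure constants in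
  \<open>x\<^sub>i x\<^sub>j = q i j x\<^sub>j x\<^sub>i\<close>, \<open>x\<^sup>a x\<^sup>b = chi a b x\<^bsup>a+b\<^esup>\<close>, \<open>x\<^sup>a c = ev a c c x\<^sup>a\<close> and
  \<open>\<Delta> x\<^sup>a = \<Sum> gam b d x\<^sup>b \<otimes> grp b x\<^sup>d\<close> (sum over \<open>b + d = a\<close>), and \<open>lam\<close> is the inverse of \<open>chi\<close>.\<close>

definition q where "q i j = gs i (g j)"
definition chi where "chi = bichar T (\<lambda>i j. if j < i then q i j else \<one>)"
definition lam where "lam = bichar T (\<lambda>i j. if j < i then inv (q i j) else \<one>)"
definition ev where "ev a c = mset_prod k T (\<lambda>i. gs i c) a"
definition grp where "grp a = mset_prod C T g a"
definition qb where "qb b d = (\<Otimes>i\<in>T. qbin (q i i) (count b i) (count d i))"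
definition gam where "gam b d = qb b d \<otimes> lam b d"

section \<open>Calculus of the structure constants\<close>

lemma gs_Units: "i \<in> T \<Longrightarrow> c \<in> carrier C \<Longrightarrow> gs i c \<in> Units k"
  using gs[of i] by (auto simp: hom_def units_of_def)

lemma gs_closed: "i \<in> T \<Longrightarrow> c \<in> carrier C \<Longrightarrow> gs i c \<in> carrier k"
  using gs_Units by blast

lemma gs_mult: "i \<in> T \<Longrightarrow> c \<in> carrier C \<Longrightarrow> d \<in> carrier C \<Longrightarrow> gs i (c \<otimes>\<^bsub>C\<^esub> d) = gs i c \<otimes> gs i d"
  using gs[of i] by (auto simp: hom_def units_of_def)

lemma gs_one: "i \<in> T \<Longrightarrow> gs i \<one>\<^bsub>C\<^esub> = \<one>"
  using gs_mult[of i "\<one>\<^bsub>C\<^esub>" "\<one>\<^bsub>C\<^esub>"] gs_Units[of i "\<one>\<^bsub>C\<^esub>"]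
    Units_l_cancel[of "gs i \<one>\<^bsub>C\<^esub>" "gs i \<one>\<^bsub>C\<^esub>" \<one>]
  by auto

lemma q_Units: "i \<in> T \<Longrightarrow> j \<in> T \<Longrightarrow> q i j \<in> Units k"
  unfolding q_def by (intro gs_Units g)

lemma q_closed: "i \<in> T \<Longrightarrow> j \<in> T \<Longrightarrow> q i j \<in> carrier k"
  using q_Units by blast

lemma q_skew: "i \<in> T \<Longrightarrow> j \<in> T \<Longrightarrow> i \<noteq> j \<Longrightarrow> q i j \<otimes> q j i = \<one>"
  using skew[of i j] q_Units[of j i] by (simp add: q_def)

lemma chi:
  shows chi_closed: "chi a b \<in> carrier k"
    and chi_union_left: "chi (a + a') b = chi a b \<otimes> chi a' b"
    and chi_union_right: "chi a (b + b') = chi a b \<otimes> chi a b'"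
    and chi_single: "i \<in> T \<Longrightarrow> j \<in> T \<Longrightarrow> chi {#i#} {#j#} = (if j < i then q i j else \<one>)"
  unfolding chi_def by (rule bichar; use q_closed in auto)+

lemma lam:
  shows lam_closed: "lam a b \<in> carrier k"
    and lam_union_left: "lam (a + a') b = lam a b \<otimes> lam a' b"
    and lam_union_right: "lam a (b + b') = lam a b \<otimes> lam a b'"
  unfolding lam_def by (rule bichar; use q_Units in auto)+

lemma lam_chi: "lam a b \<otimes> chi a b = \<one>"
  unfolding lam_def chi_def using q_Units by (intro bichar_inverse) auto

lemma chi_empty: "chi {#} b = \<one>" "chi a {#} = \<one>"
  and lam_empty: "lam {#} b = \<one>" "lam a {#} = \<one>"
  by (simp_all add: chi_def lam_def bichar_empty)

lemma ev_closed: "c \<in> carrier C \<Longrightarrow> ev a c \<in> carrier k"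
  unfolding ev_def by (rule mset_prod_closed) (auto intro: gs_closed)

lemma ev_union: "c \<in> carrier C \<Longrightarrow> ev (a + b) c = ev a c \<otimes> ev b c"
  unfolding ev_def by (rule mset_prod_union) (auto intro: gs_closed)

lemma ev_mult: "c \<in> carrier C \<Longrightarrow> d \<in> carrier C \<Longrightarrow> ev a (c \<otimes>\<^bsub>C\<^esub> d) = ev a c \<otimes> ev a d"
  unfolding ev_def
  by (subst mset_prod_mult[symmetric]) (auto intro!: gs_closed mset_prod_cong gs_mult m_closed)

lemma ev_empty: "ev {#} c = \<one>"
  by (simp add: ev_def mset_prod_empty)

lemma ev_one: "ev a \<one>\<^bsub>C\<^esub> = \<one>"
  unfolding ev_def by (rule mset_prod_one) (simp add: gs_one)

lemma ev_single: "i \<in> T \<Longrightarrow> c \<in> carrier C \<Longrightarrow> ev {#i#} c = gs i c"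
  unfolding ev_def by (rule mset_prod_single) (auto intro: gs_closed)

lemma grp_closed: "grp a \<in> carrier C"
  unfolding grp_def using g by (intro C.mset_prod_closed) auto

lemma grp_union: "grp (a + b) = grp a \<otimes>\<^bsub>C\<^esub> grp b"
  unfolding grp_def using g by (intro C.mset_prod_union) auto

lemma grp_empty: "grp {#} = \<one>\<^bsub>C\<^esub>"
  by (simp add: grp_def C.mset_prod_empty)

lemma grp_single: "i \<in> T \<Longrightarrow> grp {#i#} = g i"
  unfolding grp_def using g by (intro C.mset_prod_single) auto

text \<open>Moving x_i past g^b costs \<open>q i j\<close> for every \<open>j\<close> in
  \<open>b\<close>. For \<open>j\<close> other than \<open>i\<close>, skewness makes
  \<open>q i j\<close> the quotient of the values of \<open>chi\<close> in the two orders; for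
  \<open>j = i\<close> that quotient is 1, and the power of \<open>q i i\<close>
  compensates.\<close>

lemma chi_commute:
  assumes i: "i \<in> T" and b: "exps b"
  shows "q i i [^] count b i \<otimes> chi {#i#} b = chi b {#i#} \<otimes> gs i (grp b)"
  using b
proof (induction b)
  case empty
  then show ?case using i by (simp add: chi_empty grp_empty gs_one)
next
  case (add j b)
  then have j: "j \<in> T" and IH: "q i i [^] count b i \<otimes> chi {#i#} b = chi b {#i#} \<otimes> gs i (grp b)"
    by auto
  let ?s = "if j = i then q i i else \<one>"
  note cl = chi_closed q_closed[OF i i] q_closed[OF i j] q_closed[OF j i] gs_closed[OF i grp_closed]
  have *: "?s \<otimes> chi {#i#} {#j#} = chi {#j#} {#i#} \<otimes> q i j"
    using chi_single[OF i j] chi_single[OF j i] cl q_skew[OF i j] m_comm[of "q i j" "q j i"]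
    by (cases i j rule: linorder_cases) auto
  have "q i i [^] count (add_mset j b) i = ?s \<otimes> q i i [^] count b i"
    using cl by (simp add: m_comm)
  moreover have "chi {#i#} (add_mset j b) = chi {#i#} {#j#} \<otimes> chi {#i#} b"
    "chi (add_mset j b) {#i#} = chi {#j#} {#i#} \<otimes> chi b {#i#}"
    using chi_union_right[of "{#i#}" "{#j#}" b] chi_union_left[of "{#j#}" b "{#i#}"] by auto
  moreover have "gs i (grp (add_mset j b)) = q i j \<otimes> gs i (grp b)"
    using grp_union[of "{#j#}" b] grp_single[OF j] gs_mult[OF i g[OF j] grp_closed, of b]
    by (simp add: q_def)
  moreover have "(?s \<otimes> q i i [^] count b i) \<otimes> (chi {#i#} {#j#} \<otimes> chi {#i#} b)
    = (?s \<otimes> chi {#i#} {#j#}) \<otimes> (q i i [^] count b i \<otimes> chi {#i#} b)"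
    using cl by (simp add: m_ac)
  moreover have "(chi {#j#} {#i#} \<otimes> q i j) \<otimes> (chi b {#i#} \<otimes> gs i (grp b))
    = (chi {#j#} {#i#} \<otimes> chi b {#i#}) \<otimes> (q i j \<otimes> gs i (grp b))"
    using cl by (simp add: m_ac)
  ultimately show ?case by (simp only: * IH)
qed

lemma qbin_q_closed: "i \<in> T \<Longrightarrow> qbin (q i i) r s \<in> carrier k"
  by (intro qbin_closed q_closed)

lemma qb_closed: "qb b d \<in> carrier k"
  unfolding qb_def by (rule finprod_closed) (auto simp del: atLeastAtMost_iff intro: qbin_q_closed)

lemma qb_cocycle: "qb (r + s) l \<otimes> qb r s = qb r (s + l) \<otimes> qb s l"
proof -
  have c: "(\<lambda>i. qbin (q i i) (count a i) (count b i)) \<in> T \<rightarrow> carrier k" for a b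
    by (auto simp del: atLeastAtMost_iff intro: qbin_q_closed)
  show ?thesis unfolding qb_def
    by (subst finprod_multf[symmetric, OF c c])+
      (auto simp del: atLeastAtMost_iff intro!: finprod_cong' qbin_cocycle qbin_q_closed q_closed m_closed)
qed

lemma qb_empty: "qb {#} d = \<one>" "qb b {#} = \<one>"
  unfolding qb_def by (rule finprod_one_eqI; simp add: qbin_0_right)+

lemma qb_split:
  assumes i: "i \<in> T"
  shows "qb b d = qbin (q i i) (count b i) (count d i)
    \<otimes> (\<Otimes>j\<in>T - {i}. qbin (q j j) (count b j) (count d j))"
proof -
  have "T = insert i (T - {i})" using i by auto
  moreover have "finprod k (\<lambda>i. qbin (q i i) (count b i) (count d i)) (insert i (T - {i}))
    = qbin (q i i) (count b i) (count d i) \<otimes> (\<Otimes>j\<in>T - {i}. qbin (q j j) (count b j) (count d j))"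
    using i by (intro finprod_insert) (auto simp del: atLeastAtMost_iff intro: qbin_q_closed)
  ultimately show ?thesis unfolding qb_def by simp
qed

text \<open>Removing a copy of \<open>i\<close> changes only the factor that belongs to
  \<open>i\<close>, so Pascal's rule for this factor extends to the product.\<close>

lemma qb_pascal:
  assumes i: "i \<in> T" and "i \<in># b + d"
  shows "qb b d = (if i \<in># b then qb (b - {#i#}) d else \<zero>) \<oplus>
    (if i \<in># d then q i i [^] count b i \<otimes> qb b (d - {#i#}) else \<zero>)"
proof -
  let ?R = "\<lambda>b d. \<Otimes>j\<in>T - {i}. qbin (q j j) (count b j) (count d j)"
  have R: "?R b d \<in> carrier k" for b d by (rule finprod_closed) (auto simp del: atLeastAtMost_iff intro: qbin_q_closed)
  have e: "?R (b - {#i#}) d = ?R b d" "?R b (d - {#i#}) = ?R b d"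
    by (intro finprod_cong'; simp add: qbin_q_closed Pi_iff)+
  have p: "count b i + count d i > 0" using assms(2) by auto
  have m: "0 < count a i \<longleftrightarrow> i \<in># a" for a :: "nat multiset" by auto
  note qk = q_closed[OF i i]
  have c: "qbin (q i i) a b \<in> carrier k" for a b by (rule qbin_closed[OF qk])
  show ?thesis
    unfolding qb_split[OF i] e
    by (subst qbin_pascal[OF qk p]) (use R c qk in \<open>simp add: l_distr m_assoc\<close>)
qed

lemma gam_closed: "gam b d \<in> carrier k"
  unfolding gam_def by (intro m_closed qb_closed lam_closed)

lemma gam_empty: "gam {#} d = \<one>" "gam b {#} = \<one>"
  by (simp_all add: gam_def qb_empty lam_empty)

text \<open>The \<open>qb\<close> parts match by the Gaussian identity in each variable; the
  \<open>lam\<close> parts match because either side expands to \<open>lam r s\<close>,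
  \<open>lam r l\<close> and \<open>lam s l\<close>.\<close>

lemma gam_cocycle: "gam (r + s) l \<otimes> gam r s = gam r (s + l) \<otimes> gam s l"
proof -
  note cl = qb_closed lam_closed
  have "gam (r + s) l \<otimes> gam r s = (qb (r + s) l \<otimes> qb r s) \<otimes> (lam r l \<otimes> (lam s l \<otimes> lam r s))"
    using cl by (simp add: gam_def lam_union_left m_ac)
  also have "\<dots> = gam r (s + l) \<otimes> gam s l"
    using cl by (simp add: qb_cocycle gam_def lam_union_right m_ac)
  finally show ?thesis .
qed

text \<open>The Gaussian factor of the one overflowing variable is zero. This lets the coproduct
  formula hold for exponents beyond the bounds as well.\<close>

lemma gam_eq_zero:
  assumes "i \<in> T" "count b i < n i" "count d i < n i" "n i \<le> count b i + count d i"
  shows "gam b d = \<zero>"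
proof -
  have "qbin (q i i) (count b i) (count d i) = \<zero>"
    unfolding q_def by (rule qbin_eq_zero[OF prim[OF assms(1)] assms(2-)])
  then have "qb b d = \<zero>"
    unfolding qb_split[OF assms(1)]
    by (simp add: finprod_closed qbin_q_closed Pi_iff)
  then show ?thesis by (simp add: gam_def lam_closed)
qed

text \<open>The coefficient at \<open>(b, d)\<close> of \<open>\<Delta>(x\<^sub>i x\<^sup>a) = \<Delta>(x\<^sub>i) \<Delta>(x\<^sup>a)\<close>.\<close>

lemma gam_recurrence:
  assumes i: "i \<in> T" and b: "exps b" and bd: "b + d = add_mset i a"
  shows "chi {#i#} a \<otimes> gam b d
    = (if i \<in># b then gam (b - {#i#}) d \<otimes> chi {#i#} (b - {#i#}) else \<zero>) \<oplus>
      (if i \<in># d then gam b (d - {#i#}) \<otimes> (gs i (grp b) \<otimes> chi {#i#} (d - {#i#})) else \<zero>)"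
proof -
  let ?L = "lam b d \<otimes> (chi {#i#} b \<otimes> chi {#i#} d)"
  let ?Q = "q i i [^] count b i"
  have cl: "chi x y \<in> carrier k" "lam x y \<in> carrier k" "qb x y \<in> carrier k" "gs i (grp x) \<in> carrier k" "?Q \<in> carrier k" for x y
    by (auto intro: chi_closed lam_closed qb_closed gs_closed[OF i] grp_closed q_closed[OF i i])
  have ii: "chi {#i#} {#i#} = \<one>" using chi_single[OF i i] by simp
  \<comment> \<open>\<open>chi\<close> is 1 on the pair \<open>(i, i)\<close>, so an extra x_i is
    invisible here and \<open>chi\<close> at \<open>a\<close> equals \<open>chi\<close> at
    \<open>b + d\<close>.\<close>
  have chi_add: "chi {#i#} (add_mset i x) = chi {#i#} x" for x
    using chi_union_right[of "{#i#}" "{#i#}" x] cl by (simp add: ii)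
  have "chi {#i#} a = chi {#i#} b \<otimes> chi {#i#} d"
    using chi_union_right[of "{#i#}" b d] by (simp add: bd chi_add)
  then have "chi {#i#} a \<otimes> gam b d = ?L \<otimes> qb b d"
    using cl by (simp add: gam_def m_ac)
  also have "\<dots> = ?L \<otimes> ((if i \<in># b then qb (b - {#i#}) d else \<zero>) \<oplus>
    (if i \<in># d then ?Q \<otimes> qb b (d - {#i#}) else \<zero>))"
    by (subst qb_pascal[OF i]) (use bd in auto)
  also have "\<dots> = (if i \<in># b then ?L \<otimes> qb (b - {#i#}) d else \<zero>) \<oplus>
    (if i \<in># d then ?L \<otimes> (?Q \<otimes> qb b (d - {#i#})) else \<zero>)"
    using cl by (simp add: r_distr)
  also have "(if i \<in># b then ?L \<otimes> qb (b - {#i#}) d else \<zero>)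
    = (if i \<in># b then gam (b - {#i#}) d \<otimes> chi {#i#} (b - {#i#}) else \<zero>)"
  proof (cases "i \<in># b")
    case True
    then obtain b0 where b0: "b = add_mset i b0" by (metis mset_add)
    \<comment> \<open>Taking \<open>i\<close> out of \<open>b\<close> releases
      \<open>lam {#i#} d\<close>, which cancels \<open>chi {#i#} d\<close>.\<close>
    have "lam b d = lam {#i#} d \<otimes> lam b0 d" using lam_union_left[of "{#i#}" b0 d] by (simp add: b0)
    then have "?L \<otimes> qb b0 d = (lam {#i#} d \<otimes> chi {#i#} d) \<otimes> (qb b0 d \<otimes> lam b0 d \<otimes> chi {#i#} b0)"
      using cl by (simp add: b0 chi_add m_ac)
    also have "\<dots> = gam b0 d \<otimes> chi {#i#} b0" using cl by (simp add: lam_chi gam_def)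
    finally show ?thesis by (simp add: b0)
  qed simp
  also have "(if i \<in># d then ?L \<otimes> (?Q \<otimes> qb b (d - {#i#})) else \<zero>)
    = (if i \<in># d then gam b (d - {#i#}) \<otimes> (gs i (grp b) \<otimes> chi {#i#} (d - {#i#})) else \<zero>)"
  proof (cases "i \<in># d")
    case True
    then obtain d0 where d0: "d = add_mset i d0" by (metis mset_add)
    have "lam b d = lam b {#i#} \<otimes> lam b d0" using lam_union_right[of b "{#i#}" d0] by (simp add: d0)
    then have "?L \<otimes> (?Q \<otimes> qb b d0)
        = lam b {#i#} \<otimes> (?Q \<otimes> chi {#i#} b) \<otimes> (qb b d0 \<otimes> lam b d0 \<otimes> chi {#i#} d0)"
      using cl by (simp add: d0 chi_add m_ac)
    \<comment> \<open>By \<open>chi_commute\<close> the power of \<open>q i i\<close> from Pascal's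
      rule becomes the scalar for moving x_i past g^b, and the remaining \<open>chi b {#i#}\<close>
      meets its inverse.\<close>
    also have "\<dots> = (lam b {#i#} \<otimes> chi b {#i#}) \<otimes> (gam b d0 \<otimes> (gs i (grp b) \<otimes> chi {#i#} d0))"
      unfolding chi_commute[OF i b] gam_def using cl by (simp add: m_ac)
    also have "\<dots> = gam b d0 \<otimes> (gs i (grp b) \<otimes> chi {#i#} d0)"
      using cl gam_closed by (simp add: lam_chi)
    finally show ?thesis by (simp add: d0)
  qed simp
  finally show ?thesis .
qed

end

section \<open>Graded bialgebras\<close>

text \<open>Every ordered pair of parts occurs once; the q-analogue of its multiplicity is carried
  by \<open>gam\<close>.\<close>

definition splits :: "'i multiset \<Rightarrow> ('i multiset \<times> 'i multiset) set" where
  "splits a = {p. fst p + snd p = a}"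

lemma finite_splits: "finite (splits a)"
proof -
  have "finite {b. b \<subseteq># a}"
  proof (induction a)
    case (add x a)
    have "{b. b \<subseteq># add_mset x a} \<subseteq> {b. b \<subseteq># a} \<union> add_mset x ` {b. b \<subseteq># a}"
    proof
      fix b assume b: "b \<in> {b. b \<subseteq># add_mset x a}"
      show "b \<in> {b. b \<subseteq># a} \<union> add_mset x ` {b. b \<subseteq># a}"
      proof (cases "x \<in># b")
        case True
        then obtain b' where b': "b = add_mset x b'" by (metis mset_add)
        then show ?thesis using b by auto
      next
        case False
        have "count b y \<le> count a y" for y
          using b False mset_subset_eq_count[of b "add_mset x a" y]
          by (cases "y = x") (auto simp: not_in_iff)
        then have "b \<subseteq># a" by (simp add: subseteq_mset_def)
        then show ?thesis by simp
      qed
    qed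
    then show ?case using add finite_subset by blast
  qed simp
  moreover have "splits a \<subseteq> (\<lambda>b. (b, a - b)) ` {b. b \<subseteq># a}"
    by (auto simp: splits_def image_iff)
  ultimately show ?thesis using finite_subset by blast
qed

lemma splits_subset:
  assumes "p \<in> splits a" "set_mset a \<subseteq> V"
  shows "set_mset (fst p) \<subseteq> V" "set_mset (snd p) \<subseteq> V"
  using assms by (auto simp: splits_def)

lemma splits_empty: "splits {#} = {({#}, {#})}"
  by (auto simp: splits_def)

lemma splits_single: "splits {#i#} = {({#}, {#i#}), ({#i#}, {#})}"
  by (auto simp: splits_def union_is_single)

context abelian_monoid
begin

text \<open>Either double sum runs over the ordered triples of parts with sum \<open>a\<close>; the
  reindexing \<open>?h\<close> only changes the bracketing.\<close>

lemma finsum_splits_assoc: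
  assumes "\<And>r s d. r + s + d = a \<Longrightarrow> F r s d \<in> carrier G"
  shows "(\<Oplus>\<^bsub>G\<^esub>p\<in>splits a. \<Oplus>\<^bsub>G\<^esub>u\<in>splits (fst p). F (fst u) (snd u) (snd p))
    = (\<Oplus>\<^bsub>G\<^esub>p\<in>splits a. \<Oplus>\<^bsub>G\<^esub>u\<in>splits (snd p). F (fst p) (fst u) (snd u))"
proof -
  let ?h = "\<lambda>w. ((fst (fst w) + fst (snd w), snd (snd w)), (fst (fst w), fst (snd w)))"
  have "(\<Oplus>\<^bsub>G\<^esub>p\<in>splits a. \<Oplus>\<^bsub>G\<^esub>u\<in>splits (fst p). F (fst u) (snd u) (snd p))
    = (\<Oplus>\<^bsub>G\<^esub>w\<in>Sigma (splits a) (\<lambda>p. splits (fst p)). F (fst (snd w)) (snd (snd w)) (snd (fst w)))"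
    by (rule finsum_Sigma) (simp_all add: finite_splits, auto simp: splits_def intro: assms)
  also have "Sigma (splits a) (\<lambda>p. splits (fst p)) = ?h ` Sigma (splits a) (\<lambda>p. splits (snd p))"
    (is "?L = ?R")
  proof
    show "?L \<subseteq> ?R"
    proof
      fix w assume "w \<in> ?L"
      then show "w \<in> ?R"
        by (intro image_eqI[of _ _ "((fst (snd w), snd (snd w) + snd (fst w)), (snd (snd w), snd (fst w)))"])
          (auto simp: splits_def add.assoc)
    qed
  qed (auto simp: splits_def add.assoc)
  also have "(\<Oplus>\<^bsub>G\<^esub>w\<in>?h ` Sigma (splits a) (\<lambda>p. splits (snd p)). F (fst (snd w)) (snd (snd w)) (snd (fst w)))
    = (\<Oplus>\<^bsub>G\<^esub>w\<in>Sigma (splits a) (\<lambda>p. splits (snd p)). F (fst (fst w)) (fst (snd w)) (snd (snd w)))"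
    by (subst finsum_reindex) (auto simp: splits_def inj_on_def add.assoc intro: assms)
  also have "\<dots> = (\<Oplus>\<^bsub>G\<^esub>p\<in>splits a. \<Oplus>\<^bsub>G\<^esub>u\<in>splits (snd p). F (fst p) (fst u) (snd u))"
    by (rule finsum_Sigma[symmetric]) (simp_all add: finite_splits, auto simp: splits_def add.assoc[symmetric] intro: assms)
  finally show ?thesis .
qed

text \<open>Adding \<open>i\<close> to the first part is a bijection onto those splits of
  \<open>add_mset i a\<close> whose first part contains \<open>i\<close>. Together with the version
  on the right, it brings the two summands of Delta(x_i) to a common index set.\<close>

lemma finsum_splits_add_left:
  assumes "\<And>b d. b + d = a \<Longrightarrow> F b d \<in> carrier G"
  shows "(\<Oplus>\<^bsub>G\<^esub>p\<in>splits (add_mset i a). if i \<in># fst p then F (fst p - {#i#}) (snd p) else \<zero>\<^bsub>G\<^esub>)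
    = (\<Oplus>\<^bsub>G\<^esub>p\<in>splits a. F (fst p) (snd p))"
proof -
  let ?h = "\<lambda>p. (add_mset i (fst p), snd p)"
  let ?f = "\<lambda>p. if i \<in># fst p then F (fst p - {#i#}) (snd p) else \<zero>\<^bsub>G\<^esub>"
  have im: "?h ` splits a = {p \<in> splits (add_mset i a). i \<in># fst p}"
  proof
    show "{p \<in> splits (add_mset i a). i \<in># fst p} \<subseteq> ?h ` splits a"
    proof
      fix p assume p: "p \<in> {p \<in> splits (add_mset i a). i \<in># fst p}"
      then obtain b where "fst p = add_mset i b" by (metis (mono_tags, lifting) mem_Collect_eq mset_add)
      then show "p \<in> ?h ` splits a"
        using p by (intro image_eqI[of _ _ "(b, snd p)"]) (auto simp: splits_def prod_eq_iff)
    qed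
  qed (auto simp: splits_def)
  have "(\<Oplus>\<^bsub>G\<^esub>p\<in>splits (add_mset i a). ?f p) = (\<Oplus>\<^bsub>G\<^esub>p\<in>?h ` splits a. ?f p)"
    unfolding im
  proof (rule add.finprod_mono_neutral_cong_right)
    show "?f \<in> splits (add_mset i a) \<rightarrow> carrier G"
    proof
      fix p assume p: "p \<in> splits (add_mset i a)"
      show "?f p \<in> carrier G"
      proof (cases "i \<in># fst p")
        case True
        then obtain b where "fst p = add_mset i b" by (metis mset_add)
        then show ?thesis using p by (auto simp: splits_def intro: assms)
      qed simp
    qed
  qed (auto simp: finite_splits)
  also have "\<dots> = (\<Oplus>\<^bsub>G\<^esub>p\<in>splits a. F (fst p) (snd p))"
    by (subst finsum_reindex) (auto simp: splits_def inj_on_def prod_eq_iff intro: assms)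
  finally show ?thesis .
qed

lemma finsum_splits_swap:
  assumes "\<And>b d. b + d = a \<Longrightarrow> F b d \<in> carrier G"
  shows "(\<Oplus>\<^bsub>G\<^esub>p\<in>splits a. F (fst p) (snd p)) = (\<Oplus>\<^bsub>G\<^esub>p\<in>splits a. F (snd p) (fst p))"
proof -
  have "splits a = prod.swap ` splits a" by (force simp: splits_def add.commute image_iff)
  then have "(\<Oplus>\<^bsub>G\<^esub>p\<in>splits a. F (fst p) (snd p)) = (\<Oplus>\<^bsub>G\<^esub>p\<in>prod.swap ` splits a. F (fst p) (snd p))" by simp
  also have "\<dots> = (\<Oplus>\<^bsub>G\<^esub>p\<in>splits a. F (snd p) (fst p))"
    by (subst finsum_reindex) (auto simp: splits_def add.commute intro: assms)
  finally show ?thesis .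
qed

lemma finsum_splits_add_right:
  assumes "\<And>b d. b + d = a \<Longrightarrow> F b d \<in> carrier G"
  shows "(\<Oplus>\<^bsub>G\<^esub>p\<in>splits (add_mset i a). if i \<in># snd p then F (fst p) (snd p - {#i#}) else \<zero>\<^bsub>G\<^esub>)
    = (\<Oplus>\<^bsub>G\<^esub>p\<in>splits a. F (fst p) (snd p))"
proof -
  have cl: "(if i \<in># d then F b (d - {#i#}) else \<zero>\<^bsub>G\<^esub>) \<in> carrier G" if "b + d = add_mset i a" for b d
  proof (cases "i \<in># d")
    case True
    then obtain d' where "d = add_mset i d'" by (metis mset_add)
    then show ?thesis using that by (auto intro: assms)
  qed simp
  have "(\<Oplus>\<^bsub>G\<^esub>p\<in>splits (add_mset i a). if i \<in># snd p then F (fst p) (snd p - {#i#}) else \<zero>\<^bsub>G\<^esub>)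
    = (\<Oplus>\<^bsub>G\<^esub>p\<in>splits (add_mset i a). if i \<in># fst p then F (snd p) (fst p - {#i#}) else \<zero>\<^bsub>G\<^esub>)"
    by (rule finsum_splits_swap[of "add_mset i a" "\<lambda>b d. if i \<in># d then F b (d - {#i#}) else \<zero>\<^bsub>G\<^esub>"]) (rule cl)
  also have "\<dots> = (\<Oplus>\<^bsub>G\<^esub>p\<in>splits a. F (snd p) (fst p))"
    by (rule finsum_splits_add_left[of a "\<lambda>d b. F b d"]) (auto intro: assms simp: add.commute)
  also have "\<dots> = (\<Oplus>\<^bsub>G\<^esub>p\<in>splits a. F (fst p) (snd p))"
    by (rule finsum_splits_swap[symmetric]) (rule assms)
  finally show ?thesis .
qed

lemma finsum_splits_left_empty:
  assumes "F {#} a \<in> carrier G"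
  shows "(\<Oplus>\<^bsub>G\<^esub>p\<in>splits a. if fst p = {#} then F (fst p) (snd p) else \<zero>\<^bsub>G\<^esub>) = F {#} a"
proof -
  have "(\<Oplus>\<^bsub>G\<^esub>p\<in>splits a. if fst p = {#} then F (fst p) (snd p) else \<zero>\<^bsub>G\<^esub>)
    = (\<Oplus>\<^bsub>G\<^esub>p\<in>splits a. if ({#}, a) = p then F (fst p) (snd p) else \<zero>\<^bsub>G\<^esub>)"
    using assms by (intro finsum_cong') (auto simp: splits_def)
  also have "\<dots> = F {#} a"
proof -
    let ?F = "\<lambda>p. if ({#}, a) = p then F {#} a else \<zero>\<^bsub>G\<^esub>"
    have "(\<Oplus>\<^bsub>G\<^esub>p\<in>splits a. if ({#}, a) = p then F (fst p) (snd p) else \<zero>\<^bsub>G\<^esub>) = (\<Oplus>\<^bsub>G\<^esub>p\<in>splits a. ?F p)"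
      using assms by (intro finsum_cong') auto
    also have "\<dots> = F {#} a"
      by (rule finsum_singleton[of _ _ "\<lambda>_. F {#} a"]) (use assms finite_splits in \<open>auto simp: splits_def\<close>)
    finally show ?thesis .
  qed
  finally show ?thesis .
qed

lemma finsum_splits_right_empty:
  assumes "F a {#} \<in> carrier G"
  shows "(\<Oplus>\<^bsub>G\<^esub>p\<in>splits a. if snd p = {#} then F (fst p) (snd p) else \<zero>\<^bsub>G\<^esub>) = F a {#}"
proof -
  have "(\<Oplus>\<^bsub>G\<^esub>p\<in>splits a. if snd p = {#} then F (fst p) (snd p) else \<zero>\<^bsub>G\<^esub>)
    = (\<Oplus>\<^bsub>G\<^esub>p\<in>splits a. if fst p = {#} then F (snd p) (fst p) else \<zero>\<^bsub>G\<^esub>)"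
    using assms by (intro finsum_splits_swap[of a "\<lambda>b d. if d = {#} then F b d else \<zero>\<^bsub>G\<^esub>"]) auto
  also have "\<dots> = F a {#}"
    by (rule finsum_splits_left_empty[of "\<lambda>d b. F b d"]) (rule assms)
  finally show ?thesis .
qed

end

section \<open>Coalgebras with structure constants \<open>gam\<close>\<close>

context hopf_datum
begin

text \<open>One criterion serves three coalgebras: \<open>H\<close> with a one-point
  \<open>J\<close>, the group algebra in degree \<open>{#}\<close>, and the smash biproduct.
  \<open>sh c b\<close> is the group label of the right-hand factor, which in the last case is
  \<open>c\<close> times g^b.\<close>

lemma coalgebra_graded:
  fixes A :: "('a, 's, 'z) bialg_scheme" and f :: "'i \<Rightarrow> nat multiset \<Rightarrow> 's"
  assumes A: "module k A" and co: "linear_map k A (tensor k A A) (comult A)"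
    and cu: "linear_map k A (self_module k) (counit A)"
    and sp: "spans k A {f c a | c a. c \<in> J \<and> exps a}"
    and sh: "\<And>c a. c \<in> J \<Longrightarrow> exps a \<Longrightarrow> sh c a \<in> J"
      "\<And>c a b. c \<in> J \<Longrightarrow> exps a \<Longrightarrow> exps b \<Longrightarrow> sh (sh c a) b = sh c (a + b)"
      "\<And>c. c \<in> J \<Longrightarrow> sh c {#} = c"
    and D: "\<And>c a. c \<in> J \<Longrightarrow> exps a \<Longrightarrow> comult A (f c a)
      = (\<Oplus>\<^bsub>tensor k A A\<^esub>p\<in>splits a. gam (fst p) (snd p) \<odot>\<^bsub>tensor k A A\<^esub>
          pure k A A (f c (fst p)) (f (sh c (fst p)) (snd p)))"
    and E: "\<And>c a. c \<in> J \<Longrightarrow> exps a \<Longrightarrow> counit A (f c a) = (if a = {#} then \<one> else \<zero>)"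
  shows "coalgebra k A"
proof -
  let ?B = "{f c a | c a. c \<in> J \<and> exps a}"
  let ?AA = "tensor k A A" and ?AAA = "tensor k A (tensor k A A)"
  interpret A: module k A by fact
  note mAA = module_tensor[OF A A]
  note mA3 = module_tensor[OF A mAA] and mA3' = module_tensor[OF mAA A]
  interpret AA: module k ?AA by (rule mAA)
  interpret A3: module k ?AAA by (rule mA3)
  have fc: "f c a \<in> carrier A" if "c \<in> J" "exps a" for c a
    using spans_closed[OF sp] that by blast
  note pc = pure_closed[OF A A] and pc3 = pure_closed[OF A mAA]
  have l1: "linear_map k ?AA (tensor k ?AA A) (tensor_map k ?AA A (comult A) (\<lambda>y. y))"
    and l2: "linear_map k ?AA ?AAA (tensor_map k A ?AA (\<lambda>y. y) (comult A))"
    by (intro linear_tensor_map A mAA co linear_map_id)+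
  have l1': "linear_map k ?AA ?AAA (\<lambda>u. tensor_assoc k A A A (tensor_map k ?AA A (comult A) (\<lambda>y. y) u))"
    by (rule linear_map_comp[OF l1 linear_tensor_assoc[OF A A A]])
  have p1: "tensor_map k ?AA A (comult A) (\<lambda>y. y) (pure k A A x y) = pure k ?AA A (comult A x) y"
    and p2: "tensor_map k A ?AA (\<lambda>y. y) (comult A) (pure k A A x y) = pure k A ?AA x (comult A y)"
    if "x \<in> carrier A" "y \<in> carrier A" for x y
    using tensor_map_pure[OF A A mAA A co linear_map_id that]
      tensor_map_pure[OF A A A mAA linear_map_id co that] by auto
  have sub: "exps (fst p)" "exps (snd p)" if "p \<in> splits a" "exps a" for p a
    using splits_subset that by blast+
  let ?g = "\<lambda>p. gam (fst p) (snd p)"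
    and ?t = "\<lambda>c p. pure k A A (f c (fst p)) (f (sh c (fst p)) (snd p))"
    and ?l = "\<lambda>u. tensor_assoc k A A A (tensor_map k ?AA A (comult A) (\<lambda>y. y) u)"
    and ?r = "tensor_map k A ?AA (\<lambda>y. y) (comult A)"
  have tc: "?t c p \<in> carrier ?AA" if "c \<in> J" "exps a" "p \<in> splits a" for c a p
    using sub[OF that(3,2)] that(1) by (intro pc fc sh(1))
  note lincomb = linear_map_lincomb[where c = ?g and h = "?t _", OF mAA _ _ finite_splits gam_closed]
  have coassoc: "?l (comult A x) = ?r (comult A x)" if x: "x \<in> carrier A" for x
  proof (rule spans_ext[OF sp A mA3 linear_map_comp[OF co l1'] linear_map_comp[OF co l2] _ x])
    fix x assume "x \<in> ?B"
    then obtain c a where ca: "x = f c a" "c \<in> J" "exps a" by auto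
    let ?P = "\<lambda>r s d. pure k A ?AA (f c r) (pure k A A (f (sh c r) s) (f (sh c (r + s)) d))"
    \<comment> \<open>The common summand of the two iterated coproducts: the left one has this
      coefficient as it stands, the right one after \<open>gam_cocycle\<close>.\<close>
    let ?F = "\<lambda>r s d. (gam (r + s) d \<otimes> gam r s) \<odot>\<^bsub>?AAA\<^esub> ?P r s d"
    have Fc: "?F r s d \<in> carrier ?AAA" if "r + s + d = a" for r s d
      using that ca by (auto intro!: A3.smult_closed m_closed gam_closed pc3 pc fc sh(1))
    have "?l (comult A x) = (\<Oplus>\<^bsub>?AAA\<^esub>p\<in>splits a. ?g p \<odot>\<^bsub>?AAA\<^esub> ?l (?t c p))"
      unfolding ca(1) D[OF ca(2,3)] by (rule lincomb[OF mA3 l1' tc[OF ca(2,3)]])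
    also have "\<dots> = (\<Oplus>\<^bsub>?AAA\<^esub>p\<in>splits a. \<Oplus>\<^bsub>?AAA\<^esub>u\<in>splits (fst p). ?F (fst u) (snd u) (snd p))"
    proof (rule A3.finsum_cong')
      fix p assume p: "p \<in> splits a"
      note s = sub[OF p ca(3)]
      have c1: "f c (fst p) \<in> carrier A" "f (sh c (fst p)) (snd p) \<in> carrier A"
        using ca s by (auto intro!: fc sh(1))
      have tl: "linear_map k ?AA ?AAA (\<lambda>u. tensor_assoc k A A A (pure k ?AA A u (f (sh c (fst p)) (snd p))))"
        by (rule linear_map_comp[OF bilinear_left[OF bilinear_pure[OF mAA A] c1(2)] linear_tensor_assoc[OF A A A]])
      have "?l (?t c p) = (\<Oplus>\<^bsub>?AAA\<^esub>u\<in>splits (fst p). ?g u \<odot>\<^bsub>?AAA\<^esub>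
          tensor_assoc k A A A (pure k ?AA A (?t c u) (f (sh c (fst p)) (snd p))))"
        unfolding p1[OF c1] D[OF ca(2) s(1)] by (rule lincomb[OF mA3 tl tc[OF ca(2) s(1)]])
      then have "?g p \<odot>\<^bsub>?AAA\<^esub> ?l (?t c p) = (\<Oplus>\<^bsub>?AAA\<^esub>u\<in>splits (fst p). (?g p \<otimes> ?g u) \<odot>\<^bsub>?AAA\<^esub>
          tensor_assoc k A A A (pure k ?AA A (?t c u) (f (sh c (fst p)) (snd p))))"
        by (simp only:) (rule A3.smult_lincomb[OF finite_splits gam_closed gam_closed linear_map_closed[OF tl tc[OF ca(2) s(1)]]])
      also have "\<dots> = (\<Oplus>\<^bsub>?AAA\<^esub>u\<in>splits (fst p). ?F (fst u) (snd u) (snd p))"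
      proof (rule A3.finsum_cong')
        fix u assume u: "u \<in> splits (fst p)"
        have e: "fst u + snd u = fst p" using u by (simp add: splits_def)
        have "f c (fst u) \<in> carrier A" "f (sh c (fst u)) (snd u) \<in> carrier A"
          using ca sub[OF u s(1)] by (auto intro!: fc sh(1))
        then show "(?g p \<otimes> ?g u) \<odot>\<^bsub>?AAA\<^esub> tensor_assoc k A A A (pure k ?AA A (?t c u) (f (sh c (fst p)) (snd p)))
            = ?F (fst u) (snd u) (snd p)"
          using c1 by (simp add: e tensor_assoc_pure[OF A A A])
      qed (use p in \<open>auto simp: splits_def intro!: Fc\<close>)
      finally show "?g p \<odot>\<^bsub>?AAA\<^esub> ?l (?t c p) = (\<Oplus>\<^bsub>?AAA\<^esub>u\<in>splits (fst p). ?F (fst u) (snd u) (snd p))" .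
    qed (auto simp: splits_def intro!: A3.finsum_closed Fc)
    finally have L: "?l (comult A x) = (\<Oplus>\<^bsub>?AAA\<^esub>p\<in>splits a. \<Oplus>\<^bsub>?AAA\<^esub>u\<in>splits (fst p). ?F (fst u) (snd u) (snd p))" .
    have "?r (comult A x) = (\<Oplus>\<^bsub>?AAA\<^esub>p\<in>splits a. ?g p \<odot>\<^bsub>?AAA\<^esub> ?r (?t c p))"
      unfolding ca(1) D[OF ca(2,3)] by (rule lincomb[OF mA3 l2 tc[OF ca(2,3)]])
    also have "\<dots> = (\<Oplus>\<^bsub>?AAA\<^esub>p\<in>splits a. \<Oplus>\<^bsub>?AAA\<^esub>u\<in>splits (snd p). ?F (fst p) (fst u) (snd u))"
    proof (rule A3.finsum_cong')
      fix p assume p: "p \<in> splits a"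
      note s = sub[OF p ca(3)]
      have c1: "f c (fst p) \<in> carrier A" "f (sh c (fst p)) (snd p) \<in> carrier A" and J: "sh c (fst p) \<in> J"
        using ca s by (auto intro!: fc sh(1))
      note lr = bilinear_right[OF bilinear_pure[OF A mAA] c1(1)]
      have "?r (?t c p) = (\<Oplus>\<^bsub>?AAA\<^esub>u\<in>splits (snd p). ?g u \<odot>\<^bsub>?AAA\<^esub> pure k A ?AA (f c (fst p)) (?t (sh c (fst p)) u))"
        unfolding p2[OF c1] D[OF J s(2)] by (rule lincomb[OF mA3 lr tc[OF J s(2)]])
      then have "?g p \<odot>\<^bsub>?AAA\<^esub> ?r (?t c p) = (\<Oplus>\<^bsub>?AAA\<^esub>u\<in>splits (snd p). (?g p \<otimes> ?g u) \<odot>\<^bsub>?AAA\<^esub>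
          pure k A ?AA (f c (fst p)) (?t (sh c (fst p)) u))"
        by (simp only:) (rule A3.smult_lincomb[OF finite_splits gam_closed gam_closed linear_map_closed[OF lr tc[OF J s(2)]]])
      also have "\<dots> = (\<Oplus>\<^bsub>?AAA\<^esub>u\<in>splits (snd p). ?F (fst p) (fst u) (snd u))"
      proof (rule A3.finsum_cong')
        fix u assume u: "u \<in> splits (snd p)"
        have "?g p \<otimes> ?g u = gam (fst p + fst u) (snd u) \<otimes> gam (fst p) (fst u)"
          using u gam_cocycle[of "fst p" "fst u" "snd u"] by (simp add: splits_def)
        moreover have "sh (sh c (fst p)) (fst u) = sh c (fst p + fst u)"
          by (rule sh(2)[OF ca(2) s(1) sub(1)[OF u s(2)]])
        ultimately show "(?g p \<otimes> ?g u) \<odot>\<^bsub>?AAA\<^esub> pure k A ?AA (f c (fst p)) (?t (sh c (fst p)) u)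
            = ?F (fst p) (fst u) (snd u)" by simp
      qed (use p in \<open>auto simp: splits_def add.assoc intro!: Fc\<close>)
      finally show "?g p \<odot>\<^bsub>?AAA\<^esub> ?r (?t c p) = (\<Oplus>\<^bsub>?AAA\<^esub>u\<in>splits (snd p). ?F (fst p) (fst u) (snd u))" .
    qed (auto simp: splits_def add.assoc intro!: A3.finsum_closed Fc)
    finally have R: "?r (comult A x) = (\<Oplus>\<^bsub>?AAA\<^esub>p\<in>splits a. \<Oplus>\<^bsub>?AAA\<^esub>u\<in>splits (snd p). ?F (fst p) (fst u) (snd u))" .
    show "?l (comult A x) = ?r (comult A x)"
      unfolding L R by (rule A3.finsum_splits_assoc) (rule Fc)
  qed
  let ?e1 = "tensor_lift k A (\<lambda>y z. counit A y \<odot>\<^bsub>A\<^esub> z)" and ?e2 = "tensor_lift k A (\<lambda>y z. counit A z \<odot>\<^bsub>A\<^esub> y)"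
  have b1: "bilinear k A A A (\<lambda>y z. counit A y \<odot>\<^bsub>A\<^esub> z)" and b2: "bilinear k A A A (\<lambda>y z. counit A z \<odot>\<^bsub>A\<^esub> y)"
    using linear_map_closed[OF cu]
    by (auto simp: self_module_def intro!: bilinearI linear_map_smult_fixed[OF A cu] linear_map_smultI[OF A linear_map_id])
  note t1 = tensor_lift[OF A A A b1] and t2 = tensor_lift[OF A A A b2]
  have c1: "?e1 (comult A x) = x" if x: "x \<in> carrier A" for x
  proof (rule spans_ext[OF sp A A linear_map_comp[OF co t1(1)] linear_map_id _ x])
    fix x assume "x \<in> ?B"
    then obtain c a where ca: "x = f c a" "c \<in> J" "exps a" by auto
    have "?e1 (comult A x) = (\<Oplus>\<^bsub>A\<^esub>p\<in>splits a. ?g p \<odot>\<^bsub>A\<^esub> ?e1 (?t c p))"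
      unfolding ca(1) D[OF ca(2,3)] by (rule lincomb[OF A t1(1) tc[OF ca(2,3)]])
    \<comment> \<open>The counit annihilates every left part but \<open>{#}\<close>, and there
      \<open>gam_empty\<close> gives the coefficient 1.\<close>
    also have "\<dots> = (\<Oplus>\<^bsub>A\<^esub>p\<in>splits a. if fst p = {#} then f c (snd p) else \<zero>\<^bsub>A\<^esub>)"
      using ca sub by (intro A.finsum_cong') (auto simp: t1(2) fc sh E gam_closed gam_empty)
    also have "\<dots> = f c a"
      by (rule A.finsum_splits_left_empty[of "\<lambda>b d. f c d"]) (use ca fc in auto)
    finally show "?e1 (comult A x) = x" by (simp add: ca)
  qed
  have c2: "?e2 (comult A x) = x" if x: "x \<in> carrier A" for x
  proof (rule spans_ext[OF sp A A linear_map_comp[OF co t2(1)] linear_map_id _ x])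
    fix x assume "x \<in> ?B"
    then obtain c a where ca: "x = f c a" "c \<in> J" "exps a" by auto
    have "?e2 (comult A x) = (\<Oplus>\<^bsub>A\<^esub>p\<in>splits a. ?g p \<odot>\<^bsub>A\<^esub> ?e2 (?t c p))"
      unfolding ca(1) D[OF ca(2,3)] by (rule lincomb[OF A t2(1) tc[OF ca(2,3)]])
    also have "\<dots> = (\<Oplus>\<^bsub>A\<^esub>p\<in>splits a. if snd p = {#} then f c (fst p) else \<zero>\<^bsub>A\<^esub>)"
      using ca sub by (intro A.finsum_cong') (auto simp: t2(2) fc sh E gam_closed gam_empty)
    also have "\<dots> = f c a"
      by (rule A.finsum_splits_right_empty[of "\<lambda>b d. f c b"]) (use ca fc in auto)
    finally show "?e2 (comult A x) = x" by (simp add: ca)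
  qed
  show ?thesis unfolding coalgebra_def using A co cu coassoc c1 c2 by blast
qed

end

text \<open>\<open>e c a\<close> plays the role of c x^a. The formulas are demanded for all
  exponents, with \<open>e_zero\<close> expressing the nilpotency of the x_i, and no independence of
  the family is assumed. This separates the algebra from the construction by tensor
  products.\<close>

locale hopf_graded = hopf_datum +
  fixes S :: "('a, 's, 'z) bialg_scheme" and e :: "'c \<Rightarrow> nat multiset \<Rightarrow> 's"
  assumes module_S: "module k S" and bil: "bilinear k S S S (monoid.mult S)"
    and one_S: "\<one>\<^bsub>S\<^esub> = e \<one>\<^bsub>C\<^esub> {#}"
    and co: "linear_map k S (tensor k S S) (comult S)"
    and cu: "linear_map k S (self_module k) (counit S)"
    and sp: "spans k S {e c a | c a. c \<in> carrier C \<and> exps a}"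
    and e_mult: "c \<in> carrier C \<Longrightarrow> d \<in> carrier C \<Longrightarrow> exps a \<Longrightarrow> exps b
      \<Longrightarrow> e c a \<otimes>\<^bsub>S\<^esub> e d b = (ev a d \<otimes> chi a b) \<odot>\<^bsub>S\<^esub> e (c \<otimes>\<^bsub>C\<^esub> d) (a + b)"
    and e_comult: "c \<in> carrier C \<Longrightarrow> exps a
      \<Longrightarrow> comult S (e c a) = (\<Oplus>\<^bsub>tensor k S S\<^esub>p\<in>splits a. gam (fst p) (snd p) \<odot>\<^bsub>tensor k S S\<^esub>
          pure k S S (e c (fst p)) (e (c \<otimes>\<^bsub>C\<^esub> grp (fst p)) (snd p)))"
    and e_counit: "c \<in> carrier C \<Longrightarrow> exps a \<Longrightarrow> counit S (e c a) = (if a = {#} then \<one> else \<zero>)"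
    and e_zero: "c \<in> carrier C \<Longrightarrow> exps a \<Longrightarrow> i \<in> T \<Longrightarrow> n i \<le> count a i \<Longrightarrow> e c a = \<zero>\<^bsub>S\<^esub>"
begin

abbreviation xe where "xe i \<equiv> e \<one>\<^bsub>C\<^esub> {#i#}"
abbreviation basis where "basis \<equiv> {e c a | c a. c \<in> carrier C \<and> exps a}"

sublocale S: module k S by (rule module_S)

lemma e_closed: "c \<in> carrier C \<Longrightarrow> exps a \<Longrightarrow> e c a \<in> carrier S"
  using spans_closed[OF sp] by blast

text \<open>On the family, both bracketings are multiples of the same element; the scalars agree
  because \<open>chi\<close> is multiplicative in either argument and so is
  \<open>ev\<close>.\<close>

lemma assoc_S: "assoc_algebra k S"
proof (rule assoc_algebraI_span[OF module_S bil sp])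
    show "\<one>\<^bsub>S\<^esub> \<in> carrier S" by (simp add: one_S e_closed)
  show "\<one>\<^bsub>S\<^esub> \<otimes>\<^bsub>S\<^esub> x = x" if "x \<in> basis" for x
    using that by (auto simp: one_S e_mult ev_empty chi_empty e_closed)
  show "x \<otimes>\<^bsub>S\<^esub> \<one>\<^bsub>S\<^esub> = x" if "x \<in> basis" for x
    using that by (auto simp: one_S e_mult ev_one chi_empty e_closed)
  show "x \<otimes>\<^bsub>S\<^esub> y \<otimes>\<^bsub>S\<^esub> z = x \<otimes>\<^bsub>S\<^esub> (y \<otimes>\<^bsub>S\<^esub> z)" if x0: "x \<in> basis" and y0: "y \<in> basis" and z0: "z \<in> basis" for x y z
  proof -
    obtain c a where x: "x = e c a" "c \<in> carrier C" "exps a" using x0 by auto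
    obtain d b where y: "y = e d b" "d \<in> carrier C" "exps b" using y0 by auto
    obtain f h where z: "z = e f h" "f \<in> carrier C" "exps h" using z0 by auto
    have cl: "e (c \<otimes>\<^bsub>C\<^esub> d) (a + b) \<in> carrier S" "e (d \<otimes>\<^bsub>C\<^esub> f) (b + h) \<in> carrier S"
      "e (c \<otimes>\<^bsub>C\<^esub> (d \<otimes>\<^bsub>C\<^esub> f)) (a + (b + h)) \<in> carrier S" "x \<in> carrier S" "z \<in> carrier S"
      using x y z by (simp_all add: e_closed)
    have k: "ev a c \<in> carrier k" if "c \<in> carrier C" for a c using ev_closed that by auto
    have "x \<otimes>\<^bsub>S\<^esub> y \<otimes>\<^bsub>S\<^esub> z = (ev a d \<otimes> chi a b) \<odot>\<^bsub>S\<^esub> (e (c \<otimes>\<^bsub>C\<^esub> d) (a + b) \<otimes>\<^bsub>S\<^esub> z)"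
      using x y k chi_closed linear_map_smult[OF bilinear_left[OF bil cl(5)] _ cl(1)] by (simp add: e_mult)
    also have "\<dots> = (ev a d \<otimes> chi a b \<otimes> (ev (a + b) f \<otimes> chi (a + b) h)) \<odot>\<^bsub>S\<^esub> e (c \<otimes>\<^bsub>C\<^esub> (d \<otimes>\<^bsub>C\<^esub> f)) (a + (b + h))"
      using x y z k chi_closed cl by (simp add: e_mult S.smult_assoc1 C.m_assoc add.assoc)
    also have "ev a d \<otimes> chi a b \<otimes> (ev (a + b) f \<otimes> chi (a + b) h) = ev b f \<otimes> chi b h \<otimes> (ev a (d \<otimes>\<^bsub>C\<^esub> f) \<otimes> chi a (b + h))"
      using x y z k chi_closed by (simp add: ev_union ev_mult chi_union_left chi_union_right m_ac)
    also have "(ev b f \<otimes> chi b h \<otimes> (ev a (d \<otimes>\<^bsub>C\<^esub> f) \<otimes> chi a (b + h))) \<odot>\<^bsub>S\<^esub> e (c \<otimes>\<^bsub>C\<^esub> (d \<otimes>\<^bsub>C\<^esub> f)) (a + (b + h))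
      = (ev b f \<otimes> chi b h) \<odot>\<^bsub>S\<^esub> (x \<otimes>\<^bsub>S\<^esub> e (d \<otimes>\<^bsub>C\<^esub> f) (b + h))"
      using x y z k chi_closed cl by (simp add: e_mult S.smult_assoc1)
    also have "\<dots> = x \<otimes>\<^bsub>S\<^esub> (y \<otimes>\<^bsub>S\<^esub> z)"
      using x y z k chi_closed linear_map_smult[OF bilinear_right[OF bil cl(4)] _ cl(2)] by (simp add: e_mult)
    finally show ?thesis .
  qed
qed

sublocale SR: ring S by (rule assoc_algebra_ring[OF assoc_S])

lemma coalgebra_S: "coalgebra k S"
  by (rule coalgebra_graded[OF module_S co cu sp, where sh = "\<lambda>c a. c \<otimes>\<^bsub>C\<^esub> grp a"])
    (auto simp: grp_closed grp_union grp_empty C.m_assoc e_comult e_counit)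

lemma e_Elt_mult: "c \<in> carrier C \<Longrightarrow> d \<in> carrier C \<Longrightarrow> exps b
    \<Longrightarrow> e c {#} \<otimes>\<^bsub>S\<^esub> e d b = e (c \<otimes>\<^bsub>C\<^esub> d) b"
  by (simp add: e_mult ev_empty chi_empty e_closed)

lemma e_Var_mult: "i \<in> T \<Longrightarrow> d \<in> carrier C \<Longrightarrow> exps b
    \<Longrightarrow> e \<one>\<^bsub>C\<^esub> {#i#} \<otimes>\<^bsub>S\<^esub> e d b = (gs i d \<otimes> chi {#i#} b) \<odot>\<^bsub>S\<^esub> e d (add_mset i b)"
  using e_mult[of "\<one>\<^bsub>C\<^esub>" d "{#i#}" b] by (simp add: ev_single)

text \<open>\<open>lam\<close> undoes the factor \<open>chi\<close> of the product, so every member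
  of the family is a product of generators up to a unit.\<close>

lemma e_add_mset:
  assumes "i \<in> T" "exps a" "c \<in> carrier C"
  shows "e c (add_mset i a) = lam {#i#} a \<odot>\<^bsub>S\<^esub> (e c {#} \<otimes>\<^bsub>S\<^esub> (e \<one>\<^bsub>C\<^esub> {#i#} \<otimes>\<^bsub>S\<^esub> e \<one>\<^bsub>C\<^esub> a))"
proof -
  have a: "exps (add_mset i a)" using assms by auto
  have "e c {#} \<otimes>\<^bsub>S\<^esub> (e \<one>\<^bsub>C\<^esub> {#i#} \<otimes>\<^bsub>S\<^esub> e \<one>\<^bsub>C\<^esub> a) = chi {#i#} a \<odot>\<^bsub>S\<^esub> e c (add_mset i a)"
    using assms a linear_map_smult[OF bilinear_right[OF bil e_closed[of c "{#}"]] chi_closed e_closed[OF C.one_closed a]]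
    by (simp add: e_Var_mult gs_one chi_closed e_Elt_mult)
  then show ?thesis
    using assms a by (simp add: S.smult_assoc1[symmetric] lam_closed chi_closed lam_chi e_closed del: set_mset_add_mset_insert)
qed

text \<open>By \<open>e_add_mset\<close> the whole family is reached from the unit by left
  multiplications and scalars. Needed for the multiplicativity of the coproduct and for the
  surjectivity of \<open>psi\<close>.\<close>

lemma generated_by_gens:
  assumes Q: "submodule Q k S" and one: "e \<one>\<^bsub>C\<^esub> {#} \<in> Q"
    and Elt: "\<And>c u. c \<in> carrier C \<Longrightarrow> u \<in> Q \<Longrightarrow> e c {#} \<otimes>\<^bsub>S\<^esub> u \<in> Q"
    and Var: "\<And>i u. i \<in> T \<Longrightarrow> u \<in> Q \<Longrightarrow> e \<one>\<^bsub>C\<^esub> {#i#} \<otimes>\<^bsub>S\<^esub> u \<in> Q"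
  shows "carrier S \<subseteq> Q"
proof -
  have "e c a \<in> Q" if "c \<in> carrier C" "exps a" for c a
    using that(2,1)
  proof (induction a arbitrary: c)
    case empty
    then show ?case using Elt[OF empty(2) one] by (simp add: e_Elt_mult)
  next
    case (add i a)
    then have i: "i \<in> T" and a: "exps a" by auto
    show ?case
      unfolding e_add_mset[OF i a add.prems(2)]
      by (intro S.submoduleE(4)[OF Q lam_closed] Elt Var add.IH a i add.prems(2) C.one_closed)
  qed
  then show ?thesis using sp Q unfolding spans_def by blast
qed

section \<open>Multiplicativity of the counit and of the coproduct\<close>

abbreviation SS where "SS \<equiv> tensor_algebra k S S"

lemma counit_mult:
  assumes "u \<in> carrier S" "v \<in> carrier S"
  shows "counit S (u \<otimes>\<^bsub>S\<^esub> v) = counit S u \<otimes> counit S v"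
proof (rule bilinear_ext[OF sp sp module_S module_S module_self bilinear_comp[OF bil cu] _ _ assms])
  have self: "carrier (self_module k) = carrier k" "x \<odot>\<^bsub>self_module k\<^esub> y = x \<otimes> y" "x \<oplus>\<^bsub>self_module k\<^esub> y = x \<oplus> y" for x y
    by (simp_all add: self_module_def)
  have "bilinear k (self_module k) (self_module k) (self_module k) (\<otimes>)"
    by (intro bilinearI linear_mapI) (auto simp: self l_distr r_distr m_ac)
  then show "bilinear k S S (self_module k) (\<lambda>x y. counit S x \<otimes> counit S y)"
    by (rule bilinear_comp_args[OF _ cu cu])
  show "counit S (x \<otimes>\<^bsub>S\<^esub> y) = counit S x \<otimes> counit S y"
    if x0: "x \<in> basis" and y0: "y \<in> basis" for x y
  proof -
    obtain c a where x: "x = e c a" "c \<in> carrier C" "exps a" using x0 by auto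
    obtain d b where y: "y = e d b" "d \<in> carrier C" "exps b" using y0 by auto
    have "counit S (x \<otimes>\<^bsub>S\<^esub> y) = (ev a d \<otimes> chi a b) \<otimes> counit S (e (c \<otimes>\<^bsub>C\<^esub> d) (a + b))"
      using x y linear_map_smult[OF cu _ e_closed[of "c \<otimes>\<^bsub>C\<^esub> d" "a + b"]]
      by (simp add: e_mult self ev_closed chi_closed)
    \<comment> \<open>\<open>a + b\<close> is empty only if both are, and then the scalars
      \<open>ev\<close> and \<open>chi\<close> are 1; otherwise both sides are zero.\<close>
    then show ?thesis
      using x y ev_closed[of d a] chi_closed[of a b]
      by (auto simp: e_counit ev_empty chi_empty)
  qed
qed

lemma counit_ring_hom: "counit S \<in> ring_hom S k"
  using linear_map_closed[OF cu] linear_map_add[OF cu] counit_mult e_counit[of "\<one>\<^bsub>C\<^esub>" "{#}"]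
  by (intro ring_hom_memI) (auto simp: self_module_def one_S)

lemma comult_e_Elt: "c \<in> carrier C \<Longrightarrow> comult S (e c {#}) = pure k S S (e c {#}) (e c {#})"
proof -
  assume c: "c \<in> carrier C"
  interpret SS: module k "tensor k S S" by (rule module_tensor[OF module_S module_S])
  have "pure k S S (e c {#}) (e c {#}) \<in> carrier (tensor k S S)"
    using c by (intro pure_closed module_S e_closed) auto
  then show ?thesis
    using c by (simp add: e_comult splits_empty gam_empty grp_empty SS.finsum_insert SS.finsum_empty)
qed

lemma comult_e_Var: "i \<in> T \<Longrightarrow> comult S (e \<one>\<^bsub>C\<^esub> {#i#})
    = pure k S S (e \<one>\<^bsub>C\<^esub> {#i#}) (e (g i) {#}) \<oplus>\<^bsub>tensor k S S\<^esub> pure k S S \<one>\<^bsub>S\<^esub> (e \<one>\<^bsub>C\<^esub> {#i#})"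
proof -
  assume i: "i \<in> T"
  interpret SS: module k "tensor k S S" by (rule module_tensor[OF module_S module_S])
  have "pure k S S (e \<one>\<^bsub>C\<^esub> {#i#}) (e (g i) {#}) \<in> carrier (tensor k S S)"
    "pure k S S (e \<one>\<^bsub>C\<^esub> {#}) (e \<one>\<^bsub>C\<^esub> {#i#}) \<in> carrier (tensor k S S)"
    using i g[OF i] by (auto intro!: pure_closed module_S e_closed)
  then show ?thesis
    using i g[OF i]
    by (simp add: e_comult splits_single gam_empty grp_empty grp_single one_S SS.finsum_insert SS.finsum_empty SS.a_comm)
qed

text \<open>A group element merely multiplies the labels. For x_i the two summands of its coproduct
  raise the left or the right exponent, and comparing coefficients at a split of the raised exponent
  is \<open>gam_recurrence\<close>.\<close>

lemma comult_gen_mult: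
  assumes v: "v \<in> carrier S"
  shows comult_Elt_mult: "c \<in> carrier C \<Longrightarrow> comult S (e c {#} \<otimes>\<^bsub>S\<^esub> v) = comult S (e c {#}) \<otimes>\<^bsub>SS\<^esub> comult S v"
    and comult_Var_mult: "i \<in> T \<Longrightarrow> comult S (e \<one>\<^bsub>C\<^esub> {#i#} \<otimes>\<^bsub>S\<^esub> v) = comult S (e \<one>\<^bsub>C\<^esub> {#i#}) \<otimes>\<^bsub>SS\<^esub> comult S v"
proof -
  let ?T2 = "tensor k S S"
  note mT = module_tensor[OF module_S module_S]
  interpret T2: module k ?T2 by (rule mT)
  note b2 = bilinear_tensor_algebra_mult[OF assoc_S assoc_S]
  note pm = tensor_algebra_mult_pure[OF assoc_S assoc_S]
  note pc = pure_closed[OF module_S module_S] and bp = bilinear_pure[OF module_S module_S]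
  have sub: "exps (fst p)" "exps (snd p)" if "p \<in> splits a" "exps a" for p a
    using splits_subset that by blast+
  let ?t = "\<lambda>d p. pure k S S (e d (fst p)) (e (d \<otimes>\<^bsub>C\<^esub> grp (fst p)) (snd p))"
  have tc: "?t d p \<in> carrier ?T2" if "p \<in> splits b" "d \<in> carrier C" "exps b" for d p b
    using sub[OF that(1,3)] that(2) by (intro pc e_closed C.m_closed grp_closed)
  have expand: "u \<otimes>\<^bsub>SS\<^esub> comult S (e d b) = (\<Oplus>\<^bsub>?T2\<^esub>p\<in>splits b. gam (fst p) (snd p) \<odot>\<^bsub>?T2\<^esub> (u \<otimes>\<^bsub>SS\<^esub> ?t d p))"
    if u: "u \<in> carrier ?T2" and d: "d \<in> carrier C" and b: "exps b" for u d b
    unfolding e_comult[OF d b]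
    by (rule linear_map_lincomb[OF mT mT bilinear_right[OF b2 u] finite_splits gam_closed tc[OF _ d b]])
  show "comult S (e c {#} \<otimes>\<^bsub>S\<^esub> v) = comult S (e c {#}) \<otimes>\<^bsub>SS\<^esub> comult S v" if c: "c \<in> carrier C"
  proof (rule spans_ext[OF sp module_S mT _ _ _ v])
    have ec: "e c {#} \<in> carrier S" using c by (simp add: e_closed)
    show "linear_map k S ?T2 (\<lambda>v. comult S (e c {#} \<otimes>\<^bsub>S\<^esub> v))"
      by (rule linear_map_comp[OF bilinear_right[OF bil ec] co])
    show "linear_map k S ?T2 (\<lambda>v. comult S (e c {#}) \<otimes>\<^bsub>SS\<^esub> comult S v)"
      by (rule linear_map_comp[OF co bilinear_right[OF b2 linear_map_closed[OF co ec]]])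
    fix x assume "x \<in> basis"
    then obtain d b where x: "x = e d b" "d \<in> carrier C" "exps b" by auto
    have "comult S (e c {#}) \<otimes>\<^bsub>SS\<^esub> comult S x
      = (\<Oplus>\<^bsub>?T2\<^esub>p\<in>splits b. gam (fst p) (snd p) \<odot>\<^bsub>?T2\<^esub> (comult S (e c {#}) \<otimes>\<^bsub>SS\<^esub> ?t d p))"
      unfolding x(1) by (rule expand[OF linear_map_closed[OF co ec] x(2,3)])
    also have "\<dots> = (\<Oplus>\<^bsub>?T2\<^esub>p\<in>splits b. gam (fst p) (snd p) \<odot>\<^bsub>?T2\<^esub> ?t (c \<otimes>\<^bsub>C\<^esub> d) p)"
    proof (rule T2.finsum_cong')
      fix p assume p: "p \<in> splits b"
      then show "gam (fst p) (snd p) \<odot>\<^bsub>?T2\<^esub> (comult S (e c {#}) \<otimes>\<^bsub>SS\<^esub> ?t d p) = gam (fst p) (snd p) \<odot>\<^bsub>?T2\<^esub> ?t (c \<otimes>\<^bsub>C\<^esub> d) p"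
        using c x sub[OF p x(3)]
        by (simp add: comult_e_Elt pm e_closed grp_closed e_Elt_mult C.m_assoc del: atLeastAtMost_iff)
    qed (use c x in \<open>auto intro!: T2.smult_closed gam_closed tc[of _ b]\<close>)
    also have "\<dots> = comult S (e c {#} \<otimes>\<^bsub>S\<^esub> x)"
      using c x by (simp add: e_Elt_mult e_comult)
    finally show "comult S (e c {#} \<otimes>\<^bsub>S\<^esub> x) = comult S (e c {#}) \<otimes>\<^bsub>SS\<^esub> comult S x" by simp
  qed
  show "comult S (e \<one>\<^bsub>C\<^esub> {#i#} \<otimes>\<^bsub>S\<^esub> v) = comult S (e \<one>\<^bsub>C\<^esub> {#i#}) \<otimes>\<^bsub>SS\<^esub> comult S v" if i: "i \<in> T"
  proof (rule spans_ext[OF sp module_S mT _ _ _ v])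
    have ei: "e \<one>\<^bsub>C\<^esub> {#i#} \<in> carrier S" using i by (simp add: e_closed)
    show "linear_map k S ?T2 (\<lambda>v. comult S (e \<one>\<^bsub>C\<^esub> {#i#} \<otimes>\<^bsub>S\<^esub> v))"
      by (rule linear_map_comp[OF bilinear_right[OF bil ei] co])
    show "linear_map k S ?T2 (\<lambda>v. comult S (e \<one>\<^bsub>C\<^esub> {#i#}) \<otimes>\<^bsub>SS\<^esub> comult S v)"
      by (rule linear_map_comp[OF co bilinear_right[OF b2 linear_map_closed[OF co ei]]])
    fix x assume "x \<in> basis"
    then obtain d b where x: "x = e d b" "d \<in> carrier C" "exps b" by auto
    let ?u = "\<lambda>b' d'. pure k S S (e d b') (e (d \<otimes>\<^bsub>C\<^esub> grp b') d')"
    have uc: "?u b' d' \<in> carrier ?T2" if "exps b'" "exps d'" for b' d'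
      using that x by (intro pc e_closed C.m_closed grp_closed)
    \<comment> \<open>\<open>?F\<close> and \<open>?G\<close> are the contributions of x_i (x) g_i
      and of 1 (x) x_i. The factor \<open>gs i d\<close>, common to both, comes from moving x_i past
      \<open>d\<close>.\<close>
    let ?F = "\<lambda>b' d'. (gs i d \<otimes> (gam b' d' \<otimes> chi {#i#} b')) \<odot>\<^bsub>?T2\<^esub> ?u (add_mset i b') d'"
    let ?G = "\<lambda>b' d'. (gs i d \<otimes> (gam b' d' \<otimes> (gs i (grp b') \<otimes> chi {#i#} d'))) \<odot>\<^bsub>?T2\<^esub> ?u b' (add_mset i d')"
    have kc: "gs i d \<in> carrier k" "gs i (grp a) \<in> carrier k" "chi a a' \<in> carrier k" "gam a a' \<in> carrier k" for a a'
      using i x by (auto intro: gs_closed grp_closed chi_closed gam_closed)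
    have FG: "?F b' d' \<in> carrier ?T2" "?G b' d' \<in> carrier ?T2" if "b' + d' = b" for b' d'
      using that x i kc by (auto intro!: T2.smult_closed uc m_closed)
    have step: "gam (fst p) (snd p) \<odot>\<^bsub>?T2\<^esub> (comult S (e \<one>\<^bsub>C\<^esub> {#i#}) \<otimes>\<^bsub>SS\<^esub> ?t d p)
      = ?F (fst p) (snd p) \<oplus>\<^bsub>?T2\<^esub> ?G (fst p) (snd p)" if p: "p \<in> splits b" for p
    proof -
      note s = sub[OF p x(3)]
      let ?b = "fst p" and ?d = "snd p"
      have ib: "exps (add_mset i ?b)" "exps (add_mset i ?d)" using i s by auto
      have cl: "e d ?b \<in> carrier S" "e (d \<otimes>\<^bsub>C\<^esub> grp ?b) ?d \<in> carrier S" "e (g i) {#} \<in> carrier S"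
        "e d (add_mset i ?b) \<in> carrier S" "e (d \<otimes>\<^bsub>C\<^esub> grp ?b) (add_mset i ?d) \<in> carrier S"
        "e (d \<otimes>\<^bsub>C\<^esub> grp (add_mset i ?b)) ?d \<in> carrier S" "\<one>\<^bsub>S\<^esub> \<in> carrier S"
        using s ib x i g[OF i] grp_closed by (auto intro!: e_closed simp: one_S simp del: set_mset_add_mset_insert)
      \<comment> \<open>The g_i in the second leg updates its label to the one that belongs to the
        enlarged left exponent.\<close>
      have g1: "g i \<otimes>\<^bsub>C\<^esub> (d \<otimes>\<^bsub>C\<^esub> grp ?b) = d \<otimes>\<^bsub>C\<^esub> grp (add_mset i ?b)"
        using grp_union[of "{#i#}" ?b] grp_single[OF i] g[OF i] x grp_closed[of ?b]
        by (simp add: C.m_lcomm)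
      have t: "?t d p = pure k S S (e d ?b) (e (d \<otimes>\<^bsub>C\<^esub> grp ?b) ?d)" by simp
      have c1: "pure k S S (e \<one>\<^bsub>C\<^esub> {#i#}) (e (g i) {#}) \<in> carrier ?T2" "pure k S S \<one>\<^bsub>S\<^esub> (e \<one>\<^bsub>C\<^esub> {#i#}) \<in> carrier ?T2"
        using cl ei by (auto intro!: pc)
      have "comult S (e \<one>\<^bsub>C\<^esub> {#i#}) \<otimes>\<^bsub>SS\<^esub> ?t d p
        = pure k S S (e \<one>\<^bsub>C\<^esub> {#i#}) (e (g i) {#}) \<otimes>\<^bsub>SS\<^esub> ?t d p \<oplus>\<^bsub>?T2\<^esub> pure k S S \<one>\<^bsub>S\<^esub> (e \<one>\<^bsub>C\<^esub> {#i#}) \<otimes>\<^bsub>SS\<^esub> ?t d p"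
        unfolding comult_e_Var[OF i]
        by (rule linear_map_add[OF bilinear_left[OF b2 tc[OF p x(2,3)]] c1])
      also have "pure k S S (e \<one>\<^bsub>C\<^esub> {#i#}) (e (g i) {#}) \<otimes>\<^bsub>SS\<^esub> ?t d p
        = (gs i d \<otimes> chi {#i#} ?b) \<odot>\<^bsub>?T2\<^esub> ?u (add_mset i ?b) ?d"
        unfolding pm[OF ei cl(3) cl(1,2)]
        using linear_map_smult[OF bilinear_left[OF bp cl(6)] _ cl(4)] i x s kc g[OF i] grp_closed
        by (simp add: e_Var_mult e_Elt_mult g1)
      also have "pure k S S \<one>\<^bsub>S\<^esub> (e \<one>\<^bsub>C\<^esub> {#i#}) \<otimes>\<^bsub>SS\<^esub> ?t d p
        = (gs i d \<otimes> (gs i (grp ?b) \<otimes> chi {#i#} ?d)) \<odot>\<^bsub>?T2\<^esub> ?u ?b (add_mset i ?d)"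
        unfolding pm[OF cl(7) ei cl(1,2)]
        using linear_map_smult[OF bilinear_right[OF bp cl(1)] _ cl(5)] i x s kc grp_closed cl
        by (simp add: e_Var_mult gs_mult m_assoc)
      finally have "comult S (e \<one>\<^bsub>C\<^esub> {#i#}) \<otimes>\<^bsub>SS\<^esub> ?t d p
        = (gs i d \<otimes> chi {#i#} ?b) \<odot>\<^bsub>?T2\<^esub> ?u (add_mset i ?b) ?d
          \<oplus>\<^bsub>?T2\<^esub> (gs i d \<otimes> (gs i (grp ?b) \<otimes> chi {#i#} ?d)) \<odot>\<^bsub>?T2\<^esub> ?u ?b (add_mset i ?d)" .
      moreover have "?u (add_mset i ?b) ?d \<in> carrier ?T2" "?u ?b (add_mset i ?d) \<in> carrier ?T2"
        using s ib by (auto intro!: uc simp del: set_mset_add_mset_insert)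
      moreover have "gam ?b ?d \<otimes> (gs i d \<otimes> chi {#i#} ?b) = gs i d \<otimes> (gam ?b ?d \<otimes> chi {#i#} ?b)"
        "gam ?b ?d \<otimes> (gs i d \<otimes> (gs i (grp ?b) \<otimes> chi {#i#} ?d)) = gs i d \<otimes> (gam ?b ?d \<otimes> (gs i (grp ?b) \<otimes> chi {#i#} ?d))"
        using kc by (simp_all add: m_lcomm)
      ultimately show ?thesis
        using kc by (simp add: T2.smult_r_distr T2.smult_assoc1[symmetric])
    qed
    have "comult S (e \<one>\<^bsub>C\<^esub> {#i#}) \<otimes>\<^bsub>SS\<^esub> comult S x
      = (\<Oplus>\<^bsub>?T2\<^esub>p\<in>splits b. gam (fst p) (snd p) \<odot>\<^bsub>?T2\<^esub> (comult S (e \<one>\<^bsub>C\<^esub> {#i#}) \<otimes>\<^bsub>SS\<^esub> ?t d p))"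
      unfolding x(1) by (rule expand[OF linear_map_closed[OF co ei] x(2,3)])
    also have "\<dots> = (\<Oplus>\<^bsub>?T2\<^esub>p\<in>splits b. ?F (fst p) (snd p) \<oplus>\<^bsub>?T2\<^esub> ?G (fst p) (snd p))"
      using FG by (intro T2.finsum_cong' step T2.a_closed funcsetI refl) (auto simp: splits_def)
    also have "\<dots> = (\<Oplus>\<^bsub>?T2\<^esub>p\<in>splits b. ?F (fst p) (snd p)) \<oplus>\<^bsub>?T2\<^esub> (\<Oplus>\<^bsub>?T2\<^esub>p\<in>splits b. ?G (fst p) (snd p))"
      using FG by (intro T2.finsum_addf funcsetI) (auto simp: splits_def)
    \<comment> \<open>Both sums move to the splits of \<open>add_mset i b\<close>, padded by zero
      where \<open>i\<close> cannot be removed, so that they can be added term by term.\<close>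
    also have "\<dots> = (\<Oplus>\<^bsub>?T2\<^esub>p\<in>splits (add_mset i b). if i \<in># fst p then ?F (fst p - {#i#}) (snd p) else \<zero>\<^bsub>?T2\<^esub>)
      \<oplus>\<^bsub>?T2\<^esub> (\<Oplus>\<^bsub>?T2\<^esub>p\<in>splits (add_mset i b). if i \<in># snd p then ?G (fst p) (snd p - {#i#}) else \<zero>\<^bsub>?T2\<^esub>)"
      using T2.finsum_splits_add_left[of b ?F i, OF FG(1)] T2.finsum_splits_add_right[of b ?G i, OF FG(2)] by simp
    also have "\<dots> = (\<Oplus>\<^bsub>?T2\<^esub>p\<in>splits (add_mset i b).
      (if i \<in># fst p then ?F (fst p - {#i#}) (snd p) else \<zero>\<^bsub>?T2\<^esub>) \<oplus>\<^bsub>?T2\<^esub>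
      (if i \<in># snd p then ?G (fst p) (snd p - {#i#}) else \<zero>\<^bsub>?T2\<^esub>))"
    proof (rule T2.finsum_addf[symmetric])
      show "(\<lambda>p. if i \<in># fst p then ?F (fst p - {#i#}) (snd p) else \<zero>\<^bsub>?T2\<^esub>) \<in> splits (add_mset i b) \<rightarrow> carrier ?T2"
      proof
        fix p assume p: "p \<in> splits (add_mset i b)"
        show "(if i \<in># fst p then ?F (fst p - {#i#}) (snd p) else \<zero>\<^bsub>?T2\<^esub>) \<in> carrier ?T2"
        proof (cases "i \<in># fst p")
          case True
          then obtain b' where "fst p = add_mset i b'" by (metis mset_add)
          then show ?thesis using p FG(1)[of b' "snd p"] by (simp add: splits_def)
        qed simp
      qed
      show "(\<lambda>p. if i \<in># snd p then ?G (fst p) (snd p - {#i#}) else \<zero>\<^bsub>?T2\<^esub>) \<in> splits (add_mset i b) \<rightarrow> carrier ?T2"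
      proof
        fix p assume p: "p \<in> splits (add_mset i b)"
        show "(if i \<in># snd p then ?G (fst p) (snd p - {#i#}) else \<zero>\<^bsub>?T2\<^esub>) \<in> carrier ?T2"
        proof (cases "i \<in># snd p")
          case True
          then obtain b' where "snd p = add_mset i b'" by (metis mset_add)
          then show ?thesis using p FG(2)[of "fst p" b'] by (simp add: splits_def)
        qed simp
      qed
    qed
    also have "\<dots> = (\<Oplus>\<^bsub>?T2\<^esub>p\<in>splits (add_mset i b). (gs i d \<otimes> chi {#i#} b) \<odot>\<^bsub>?T2\<^esub> (gam (fst p) (snd p) \<odot>\<^bsub>?T2\<^esub> ?t d p))"
    proof (rule T2.finsum_cong')
      have ib: "exps (add_mset i b)" using i x by auto
      show "(\<lambda>p. (gs i d \<otimes> chi {#i#} b) \<odot>\<^bsub>?T2\<^esub> (gam (fst p) (snd p) \<odot>\<^bsub>?T2\<^esub> ?t d p)) \<in> splits (add_mset i b) \<rightarrow> carrier ?T2"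
        by (intro funcsetI T2.smult_closed m_closed kc tc[OF _ x(2) ib])
      fix p assume p: "p \<in> splits (add_mset i b)"
      note s = sub[OF p ib]
      let ?b = "fst p" and ?d = "snd p"
      have pb: "?b + ?d = add_mset i b" using p by (simp add: splits_def)
      let ?c1 = "if i \<in># ?b then gam (?b - {#i#}) ?d \<otimes> chi {#i#} (?b - {#i#}) else \<zero>"
      let ?c2 = "if i \<in># ?d then gam ?b (?d - {#i#}) \<otimes> (gs i (grp ?b) \<otimes> chi {#i#} (?d - {#i#})) else \<zero>"
      have cc: "?c1 \<in> carrier k" "?c2 \<in> carrier k" using kc by auto
      have u: "?u ?b ?d \<in> carrier ?T2" by (rule uc[OF s])
      have "(if i \<in># ?b then ?F (?b - {#i#}) ?d else \<zero>\<^bsub>?T2\<^esub>) = (gs i d \<otimes> ?c1) \<odot>\<^bsub>?T2\<^esub> ?u ?b ?d"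
        "(if i \<in># ?d then ?G ?b (?d - {#i#}) else \<zero>\<^bsub>?T2\<^esub>) = (gs i d \<otimes> ?c2) \<odot>\<^bsub>?T2\<^esub> ?u ?b ?d"
        using u kc(1) by auto
      then have "(if i \<in># ?b then ?F (?b - {#i#}) ?d else \<zero>\<^bsub>?T2\<^esub>) \<oplus>\<^bsub>?T2\<^esub> (if i \<in># ?d then ?G ?b (?d - {#i#}) else \<zero>\<^bsub>?T2\<^esub>)
        = (gs i d \<otimes> (?c1 \<oplus> ?c2)) \<odot>\<^bsub>?T2\<^esub> ?u ?b ?d"
        using u kc(1) cc by (simp only: r_distr T2.smult_l_distr m_closed)
      also have "?c1 \<oplus> ?c2 = chi {#i#} b \<otimes> gam ?b ?d"
        by (rule gam_recurrence[OF i s(1) pb, symmetric])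
      finally show "(if i \<in># ?b then ?F (?b - {#i#}) ?d else \<zero>\<^bsub>?T2\<^esub>) \<oplus>\<^bsub>?T2\<^esub> (if i \<in># ?d then ?G ?b (?d - {#i#}) else \<zero>\<^bsub>?T2\<^esub>)
        = (gs i d \<otimes> chi {#i#} b) \<odot>\<^bsub>?T2\<^esub> (gam ?b ?d \<odot>\<^bsub>?T2\<^esub> ?t d p)"
        using u kc by (simp add: T2.smult_assoc1[symmetric] m_assoc)
    qed simp
    also have "\<dots> = (gs i d \<otimes> chi {#i#} b) \<odot>\<^bsub>?T2\<^esub> comult S (e d (add_mset i b))"
    proof -
      have ib: "exps (add_mset i b)" using i x by auto
      show ?thesis unfolding e_comult[OF x(2) ib]
        by (rule T2.finsum_smult_ldistr[symmetric, OF finite_splits m_closed[OF kc(1,3)]])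
          (intro funcsetI T2.smult_closed kc tc[OF _ x(2) ib])
    qed
    also have "\<dots> = comult S (e \<one>\<^bsub>C\<^esub> {#i#} \<otimes>\<^bsub>S\<^esub> x)"
    proof -
      have ib: "exps (add_mset i b)" using i x by auto
      show ?thesis
        using linear_map_smult[OF co m_closed[OF kc(1,3)] e_closed[OF x(2) ib]] i x by (simp add: e_Var_mult)
    qed
    finally show "comult S (e \<one>\<^bsub>C\<^esub> {#i#} \<otimes>\<^bsub>S\<^esub> x) = comult S (e \<one>\<^bsub>C\<^esub> {#i#}) \<otimes>\<^bsub>SS\<^esub> comult S x" by simp
  qed
qed

text \<open>With all right factors \<open>v\<close> quantified inside \<open>?Q\<close>, the
  condition on \<open>u\<close> is linear and, by associativity on both sides, stable under left
  multiplication by generators.\<close>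

lemma comult_mult:
  assumes "u \<in> carrier S" "v \<in> carrier S"
  shows "comult S (u \<otimes>\<^bsub>S\<^esub> v) = comult S u \<otimes>\<^bsub>SS\<^esub> comult S v"
proof -
  let ?T2 = "tensor k S S"
  note mT = module_tensor[OF module_S module_S]
  note b2 = bilinear_tensor_algebra_mult[OF assoc_S assoc_S]
  interpret SS: ring SS by (rule assoc_algebra_ring[OF assoc_tensor_algebra[OF assoc_S assoc_S]])
  have SSc: "carrier SS = carrier ?T2" by (simp add: tensor_algebra_def)
  note cc = linear_map_closed[OF co, folded SSc]
  let ?Q = "{u \<in> carrier S. \<forall>v\<in>carrier S. comult S (u \<otimes>\<^bsub>S\<^esub> v) = comult S u \<otimes>\<^bsub>SS\<^esub> comult S v}"
  have "carrier S \<subseteq> ?Q"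
  proof (rule generated_by_gens)
    show "submodule ?Q k S"
    proof (rule submodule_Collect_Ball[OF module_S], rule submodule_equalizer[OF module_S mT])
      fix v assume v: "v \<in> carrier S"
      show "linear_map k S ?T2 (\<lambda>u. comult S (u \<otimes>\<^bsub>S\<^esub> v))"
        by (rule linear_map_comp[OF bilinear_left[OF bil v] co])
      show "linear_map k S ?T2 (\<lambda>u. comult S u \<otimes>\<^bsub>SS\<^esub> comult S v)"
        by (rule linear_map_comp[OF co bilinear_left[OF b2 linear_map_closed[OF co v]]])
    qed
    show "e \<one>\<^bsub>C\<^esub> {#} \<in> ?Q" using comult_Elt_mult by (simp add: e_closed)
    have gen: "x \<otimes>\<^bsub>S\<^esub> u \<in> ?Q" if x: "x \<in> carrier S" "\<And>v. v \<in> carrier S \<Longrightarrow> comult S (x \<otimes>\<^bsub>S\<^esub> v) = comult S x \<otimes>\<^bsub>SS\<^esub> comult S v"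
      and u: "u \<in> ?Q" for x u
      using x u by (auto simp: SR.m_assoc SS.m_assoc cc)
    show "e c {#} \<otimes>\<^bsub>S\<^esub> u \<in> ?Q" if "c \<in> carrier C" "u \<in> ?Q" for c u
      by (rule gen[OF _ comult_Elt_mult that(2)]) (use that in \<open>auto simp: e_closed\<close>)
    show "e \<one>\<^bsub>C\<^esub> {#i#} \<otimes>\<^bsub>S\<^esub> u \<in> ?Q" if "i \<in> T" "u \<in> ?Q" for i u
      by (rule gen[OF _ comult_Var_mult that(2)]) (use that in \<open>auto simp: e_closed\<close>)
  qed
  then show ?thesis using assms by blast
qed

lemma bialgebra_S: "bialgebra k S"
proof -
  have "comult S \<in> ring_hom S SS"
  proof (rule ring_hom_memI)
    show "comult S \<one>\<^bsub>S\<^esub> = \<one>\<^bsub>SS\<^esub>" by (simp add: one_S comult_e_Elt) (simp add: tensor_algebra_def one_S)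
  qed (use linear_mapD[OF co] comult_mult in \<open>auto simp: tensor_algebra_def\<close>)
  then show ?thesis unfolding bialgebra_def using assoc_S coalgebra_S counit_ring_hom by blast
qed

end

section \<open>The pointed Hopf algebra\<close>

text \<open>In a sorted word the copies of \<open>i\<close> form one block; this is what makes a
  power of x_i appear inside an ordered monomial.\<close>

lemma sorted_list_split:
  fixes l :: "'i :: linorder list"
  assumes "sorted l"
  shows "l = filter (\<lambda>j. j < i) l @ replicate (count (mset l) i) i @ filter (\<lambda>j. i < j) l"
  using assms
proof (induction l)
  case (Cons j l)
  consider "j < i" | "j = i" | "i < j" by (cases i j rule: linorder_cases) auto
  then show ?case
  proof cases
    case 1
    then have "j \<noteq> i" "\<not> i < j" by auto
    then show ?thesis using 1 Cons by simp
  next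
    case 2
    then have "filter (\<lambda>j. j < i) l = []" using Cons.prems by (auto simp: filter_empty_conv)
    then show ?thesis using Cons 2 by simp
  next
    case 3
    then have "filter (\<lambda>j. j < i) l = []" "count (mset l) i = 0" "filter (\<lambda>j. i < j) l = l"
      using Cons.prems by (auto simp: filter_empty_conv filter_id_conv count_mset_0_iff)
    moreover have "\<not> j < i" "j \<noteq> i" using 3 by auto
    ultimately show ?thesis using 3 by simp
  qed
qed simp

lemma submodule_image:
  assumes M: "module k M" and N: "module k N" and f: "linear_map k M N f"
  shows "submodule (f ` carrier M) k N"
proof -
  interpret M: module k M by fact
  interpret N: module k N by fact
  show ?thesis
  proof (rule N.submoduleI)
    show "\<zero>\<^bsub>N\<^esub> \<in> f ` carrier M"
      unfolding linear_map_zero[OF M N f, symmetric] by (rule imageI) simp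
  qed (auto simp: linear_map_neg[OF M N f, symmetric] linear_map_add[OF f, symmetric]
      linear_map_smult[OF f, symmetric] intro: linear_map_closed[OF f])
qed

section \<open>The relations of \<open>K\<close> and its ordered monomials\<close>

context hopf_datum
begin

abbreviation gens where "gens \<equiv> hopf_gens C t"
abbreviation F where "F \<equiv> free_algebra k gens"
abbreviation I where "I \<equiv> hopf_ideal k C t n gs g"
abbreviation A where "A \<equiv> quot_module F I"

definition cls where "cls w = I +>\<^bsub>F\<^esub> single k w"

lemma gens_cases:
  assumes "x \<in> gens"
  obtains (Elt) c where "x = Elt c" "c \<in> carrier C" | (Var) i where "x = Var i" "i \<in> T"
  using assms by (auto simp: hopf_gens_def)

lemma Elt_gens: "c \<in> carrier C \<Longrightarrow> Elt c \<in> gens" and Var_gens: "i \<in> T \<Longrightarrow> Var i \<in> gens"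
  by (auto simp: hopf_gens_def)

lemma word_closed: "w \<in> lists gens \<Longrightarrow> single k w \<in> carrier F"
  by (rule single_free_algebra_closed)

sublocale Falg: ring F by (rule assoc_algebra_ring[OF assoc_free_algebra])
sublocale Fmod: module k F by (rule assoc_algebra_module[OF assoc_free_algebra])

lemma hopf_rels_closed: "hopf_rels k C t n gs g \<subseteq> carrier F"
proof -
  have k: "gs j c \<in> carrier k" if "j \<in> T" "c \<in> carrier C" for j c using gs_closed that .
  show ?thesis
    by (auto simp: hopf_rels_def Let_def k g Elt_gens Var_gens in_lists_conv_set simp del: atLeastAtMost_iff
        intro!: Falg.minus_closed word_closed Fmod.smult_closed)
qed

lemma ideal_I: "ideal I F"
  unfolding hopf_ideal_def by (rule Falg.genideal_ideal[OF hopf_rels_closed])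

lemma rels_in_I: "hopf_rels k C t n gs g \<subseteq> I"
  unfolding hopf_ideal_def by (rule Falg.genideal_self[OF hopf_rels_closed])

lemma I_subset:
  assumes "ideal J F" "hopf_rels k C t n gs g \<subseteq> J"
  shows "I \<subseteq> J"
  unfolding hopf_ideal_def by (rule Falg.genideal_minimal[OF assms])

sublocale Q: quotient k F I by (rule quotient_ideal[OF assoc_free_algebra ideal_I])

lemma assoc_A: "assoc_algebra k A"
  by (rule assoc_quot_algebra[OF assoc_free_algebra ideal_I])

sublocale Aalg: ring A by (rule assoc_algebra_ring[OF assoc_A])
sublocale Amod: module k A by (rule assoc_algebra_module[OF assoc_A])

lemma cls_closed: "w \<in> lists gens \<Longrightarrow> cls w \<in> carrier A"
  using word_closed by (auto simp: cls_def Q.quot_module_simps)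

lemma cls_append: "v \<in> lists gens \<Longrightarrow> w \<in> lists gens \<Longrightarrow> cls (v @ w) = cls v \<otimes>\<^bsub>A\<^esub> cls w"
  using quot_algebra_mult[OF assoc_free_algebra ideal_I word_closed word_closed]
  by (simp add: cls_def free_algebra_mult_single)

lemma cls_Cons: "x \<in> gens \<Longrightarrow> w \<in> lists gens \<Longrightarrow> cls (x # w) = cls [x] \<otimes>\<^bsub>A\<^esub> cls w"
  using cls_append[of "[x]" w] by simp

lemma cls_Nil: "cls [] = \<one>\<^bsub>A\<^esub>"
  using quot_algebra_one[OF assoc_free_algebra ideal_I] by (simp add: cls_def free_algebra_one)

lemma coset_eqI:
  assumes "x \<ominus>\<^bsub>F\<^esub> y \<in> hopf_rels k C t n gs g" "x \<in> carrier F" "y \<in> carrier F"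
  shows "I +>\<^bsub>F\<^esub> x = I +>\<^bsub>F\<^esub> y"
proof -
  have "x \<oplus>\<^bsub>F\<^esub> \<ominus>\<^bsub>F\<^esub> y \<in> I" using assms rels_in_I by (auto simp: a_minus_def)
  then have "x \<in> I +>\<^bsub>F\<^esub> y" using assms by (intro Q.a_rcos_module_rev)
  then show ?thesis using Q.a_repr_independence' assms(3) by blast
qed

lemma cls_Elt_Elt:
  assumes "c \<in> carrier C" "d \<in> carrier C"
  shows "cls [Elt c, Elt d] = cls [Elt (c \<otimes>\<^bsub>C\<^esub> d)]"
  unfolding cls_def using assms
  by (intro coset_eqI word_closed) (auto simp: hopf_rels_def Let_def Elt_gens)

lemma cls_Elt_one: "cls [Elt \<one>\<^bsub>C\<^esub>] = \<one>\<^bsub>A\<^esub>"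
  unfolding cls_Nil[symmetric] cls_def
  by (intro coset_eqI word_closed) (auto simp: hopf_rels_def Let_def Elt_gens free_algebra_one)

lemma cls_smult_eqI:
  assumes "single k v \<ominus>\<^bsub>F\<^esub> r \<odot>\<^bsub>F\<^esub> single k w \<in> hopf_rels k C t n gs g"
    "v \<in> lists gens" "w \<in> lists gens" "r \<in> carrier k"
  shows "cls v = r \<odot>\<^bsub>A\<^esub> cls w"
  unfolding cls_def Q.quot_smult[OF assms(4) word_closed[OF assms(3)]]
  using assms by (intro coset_eqI word_closed Fmod.smult_closed)

lemma cls_Var_Elt:
  assumes "i \<in> T" "c \<in> carrier C"
  shows "cls [Var i, Elt c] = gs i c \<odot>\<^bsub>A\<^esub> cls [Elt c, Var i]"
  by (rule cls_smult_eqI)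
    (use assms in \<open>auto simp: hopf_rels_def Let_def Elt_gens Var_gens gs_closed simp del: atLeastAtMost_iff\<close>)

lemma cls_Var_Var:
  assumes "i \<in> T" "j \<in> T" "i \<noteq> j"
  shows "cls [Var i, Var j] = q i j \<odot>\<^bsub>A\<^esub> cls [Var j, Var i]"
  by (rule cls_smult_eqI)
    (use assms q_closed in \<open>auto simp: hopf_rels_def Let_def Elt_gens Var_gens q_def simp del: atLeastAtMost_iff\<close>)

lemma cls_power:
  assumes "i \<in> T"
  shows "cls (replicate (n i) (Var i)) = \<zero>\<^bsub>A\<^esub>"
proof -
  have "single k (replicate (n i) (Var i)) \<in> I"
    using rels_in_I assms by (auto simp: hopf_rels_def Let_def)
  then show ?thesis by (simp add: cls_def Q.a_rcos_const Q.quot_module_simps(2))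
qed

text \<open>The normal form c x^a in \<open>K\<close>, group element first and variables increasing.
  It is defined for every exponent; \<open>mon_zero\<close> takes care of those beyond the
  bounds.\<close>

definition mon where "mon c a = cls (Elt c # map Var (sorted_list_of_multiset a))"

lemma Vars_closed: "set l \<subseteq> T \<Longrightarrow> map Var l \<in> lists gens"
  by (auto simp: in_lists_conv_set simp del: atLeastAtMost_iff intro!: Var_gens)

lemma mon_closed: "c \<in> carrier C \<Longrightarrow> exps a \<Longrightarrow> mon c a \<in> carrier A"
  unfolding mon_def using Vars_closed[of "sorted_list_of_multiset a"] by (intro cls_closed) (simp add: Elt_gens)

lemma mon_Elt: "mon c {#} = cls [Elt c]"
  by (simp add: mon_def)

lemma Elt_mon:
  assumes "d \<in> carrier C" "c \<in> carrier C" "exps a"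
  shows "cls [Elt d] \<otimes>\<^bsub>A\<^esub> mon c a = mon (d \<otimes>\<^bsub>C\<^esub> c) a"
proof -
  let ?w = "map Var (sorted_list_of_multiset a)"
  have w: "?w \<in> lists gens" using assms Vars_closed by simp
  have "cls [Elt d] \<otimes>\<^bsub>A\<^esub> mon c a = cls ([Elt d, Elt c] @ ?w)"
    unfolding mon_def using assms w by (subst cls_Cons[symmetric]) (auto simp: Elt_gens)
  also have "\<dots> = cls [Elt (d \<otimes>\<^bsub>C\<^esub> c)] \<otimes>\<^bsub>A\<^esub> cls ?w"
    using assms w by (subst cls_append) (auto simp: Elt_gens cls_Elt_Elt)
  also have "\<dots> = mon (d \<otimes>\<^bsub>C\<^esub> c) a"
    unfolding mon_def using assms w by (intro cls_Cons[symmetric] Elt_gens C.m_closed)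
  finally show ?thesis .
qed

text \<open>On its way to its sorted place x_i passes exactly the x_j with \<open>j < i\<close>, at
  the price \<open>q i j\<close> each, and the product of these prices is
  \<open>chi\<close>.\<close>

lemma Var_Vars:
  assumes "i \<in> T" "set l \<subseteq> T" "sorted l"
  shows "cls [Var i] \<otimes>\<^bsub>A\<^esub> cls (map Var l) = chi {#i#} (mset l) \<odot>\<^bsub>A\<^esub> cls (map Var (insort i l))"
  using assms(2,3)
proof (induction l)
  case Nil
  then show ?case
    using assms(1) cls_closed[of "[Var i]"] by (simp add: chi_empty cls_Nil Var_gens del: atLeastAtMost_iff)
next
  case (Cons j l)
  then have j: "j \<in> T" and l: "set l \<subseteq> T" "sorted l" by auto
  have wl: "map Var l \<in> lists gens" "map Var (insort i l) \<in> lists gens" "map Var (j # l) \<in> lists gens"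
    using assms(1) j l by (auto intro!: Vars_closed simp: set_insort_key simp del: atLeastAtMost_iff list.map)
  have gi: "Var i \<in> gens" "Var j \<in> gens" using assms(1) j Var_gens by auto
  have chi_eq: "chi {#i#} (mset (j # l)) = (if j < i then q i j else \<one>) \<otimes> chi {#i#} (mset l)"
    using chi_union_right[of "{#i#}" "{#j#}" "mset l"] chi_single[OF assms(1) j] by simp
  show ?case
  proof (cases "i \<le> j")
    case True
    \<comment> \<open>No smaller variable is left, so x_i is already in place and no scalar may
      appear.\<close>
    have "chi {#i#} (mset l') = \<one>" if "\<forall>j\<in>set l'. i \<le> j" "set l' \<subseteq> T" for l'
      using that
    proof (induction l')
      case (Cons j' l')
      then have "j' \<in> T" "\<not> j' < i" by auto
      then show ?case
        using Cons chi_union_right[of "{#i#}" "{#j'#}" "mset l'"] chi_single[OF assms(1), of j'] by simp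
    qed (simp add: chi_empty)
    moreover have "\<forall>j'\<in>set (j # l). i \<le> j'" using True Cons.prems by auto
    ultimately have "chi {#i#} (mset (j # l)) = \<one>" using Cons.prems(1) by blast
    then show ?thesis
      using True cls_Cons[OF gi(1) wl(3)] cls_closed[of "Var i # map Var (j # l)"] gi wl(3) by simp
  next
    case False
    then have ji: "j < i" "i \<noteq> j" by auto
    have c1: "cls [Var j] \<in> carrier A" "cls [Var i] \<in> carrier A" "cls (map Var l) \<in> carrier A"
      "cls (map Var (insort i l)) \<in> carrier A"
      using gi wl by (auto intro!: cls_closed)
    have qk: "q i j \<in> carrier k" by (rule q_closed[OF assms(1) j])
    note L = linear_map_smult[OF bilinear_left[OF bilinear_mult[OF assoc_A]]]
    note R = linear_map_smult[OF bilinear_right[OF bilinear_mult[OF assoc_A]]]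
    have "cls [Var i] \<otimes>\<^bsub>A\<^esub> cls (map Var (j # l)) = cls [Var i] \<otimes>\<^bsub>A\<^esub> (cls [Var j] \<otimes>\<^bsub>A\<^esub> cls (map Var l))"
      using cls_Cons[OF gi(2) wl(1)] by simp
    also have "\<dots> = cls [Var i, Var j] \<otimes>\<^bsub>A\<^esub> cls (map Var l)"
      using c1 gi by (simp add: Aalg.m_assoc[symmetric] cls_Cons[of "Var i" "[Var j]"])
    also have "\<dots> = q i j \<odot>\<^bsub>A\<^esub> (cls [Var j, Var i] \<otimes>\<^bsub>A\<^esub> cls (map Var l))"
      unfolding cls_Var_Var[OF assms(1) j ji(2)]
      using L[OF c1(3) qk cls_closed[of "[Var j, Var i]"]] gi by simp
    also have "cls [Var j, Var i] \<otimes>\<^bsub>A\<^esub> cls (map Var l) = cls [Var j] \<otimes>\<^bsub>A\<^esub> (cls [Var i] \<otimes>\<^bsub>A\<^esub> cls (map Var l))"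
      using c1 gi by (simp add: Aalg.m_assoc[symmetric] cls_Cons[of "Var j" "[Var i]"])
    also have "\<dots> = chi {#i#} (mset l) \<odot>\<^bsub>A\<^esub> (cls [Var j] \<otimes>\<^bsub>A\<^esub> cls (map Var (insort i l)))"
      unfolding Cons.IH[OF l] by (rule R[OF c1(1) chi_closed c1(4)])
    also have "cls [Var j] \<otimes>\<^bsub>A\<^esub> cls (map Var (insort i l)) = cls (map Var (insort i (j # l)))"
      using False cls_Cons[OF gi(2) wl(2)] by simp
    finally show ?thesis
      using False ji qk chi_closed c1 cls_closed[of "map Var (insort i (j # l))"] wl gi
      by (simp add: chi_eq Amod.smult_assoc1 del: mset.simps)
  qed
qed

text \<open>The scalar is the one in \<open>e_Var_mult\<close>. This coincidence is what makes the
  comparison map commute with left multiplication by x_i.\<close>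

lemma Var_mon:
  assumes "i \<in> T" "c \<in> carrier C" "exps a"
  shows "cls [Var i] \<otimes>\<^bsub>A\<^esub> mon c a = (gs i c \<otimes> chi {#i#} a) \<odot>\<^bsub>A\<^esub> mon c (add_mset i a)"
proof -
  let ?l = "sorted_list_of_multiset a"
  have w: "map Var ?l \<in> lists gens" "map Var (insort i ?l) \<in> lists gens"
    using assms by (auto intro!: Vars_closed simp: set_insort_key simp del: atLeastAtMost_iff)
  have gi: "Var i \<in> gens" "Elt c \<in> gens" using assms Var_gens Elt_gens by auto
  have c1: "cls [Elt c] \<in> carrier A" "cls [Var i] \<in> carrier A" "cls (map Var ?l) \<in> carrier A"
    "cls (map Var (insort i ?l)) \<in> carrier A" "cls [Elt c, Var i] \<in> carrier A"
    using gi w by (auto intro!: cls_closed)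
  have gk: "gs i c \<in> carrier k" using assms gs_closed by auto
  note L = linear_map_smult[OF bilinear_left[OF bilinear_mult[OF assoc_A]]]
  note R = linear_map_smult[OF bilinear_right[OF bilinear_mult[OF assoc_A]]]
  have "cls [Var i] \<otimes>\<^bsub>A\<^esub> mon c a = cls [Var i, Elt c] \<otimes>\<^bsub>A\<^esub> cls (map Var ?l)"
    using c1 gi w by (simp add: mon_def cls_Cons[of _ "map Var ?l"] cls_Cons[of "Var i" "[Elt c]"] Aalg.m_assoc)
  also have "\<dots> = gs i c \<odot>\<^bsub>A\<^esub> (cls [Elt c, Var i] \<otimes>\<^bsub>A\<^esub> cls (map Var ?l))"
    unfolding cls_Var_Elt[OF assms(1,2)] by (rule L[OF c1(3) gk c1(5)])
  also have "cls [Elt c, Var i] \<otimes>\<^bsub>A\<^esub> cls (map Var ?l) = cls [Elt c] \<otimes>\<^bsub>A\<^esub> (cls [Var i] \<otimes>\<^bsub>A\<^esub> cls (map Var ?l))"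
    using c1 gi by (simp add: Aalg.m_assoc[symmetric] cls_Cons[of "Elt c" "[Var i]"])
  also have "cls [Var i] \<otimes>\<^bsub>A\<^esub> cls (map Var ?l) = chi {#i#} a \<odot>\<^bsub>A\<^esub> cls (map Var (insort i ?l))"
    using Var_Vars[of i ?l] assms by simp
  also have "cls [Elt c] \<otimes>\<^bsub>A\<^esub> (chi {#i#} a \<odot>\<^bsub>A\<^esub> cls (map Var (insort i ?l)))
    = chi {#i#} a \<odot>\<^bsub>A\<^esub> mon c (add_mset i a)"
    unfolding R[OF c1(1) chi_closed c1(4)] using cls_Cons[OF gi(2) w(2)] by (simp add: mon_def)
  finally show ?thesis
    using gk chi_closed mon_closed[of c "add_mset i a"] assms by (simp add: Amod.smult_assoc1)
qed

end

section \<open>The homomorphism from the free algebra onto a graded bialgebra\<close>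

context hopf_graded
begin

definition val :: "'c gen \<Rightarrow> 's" where
  "val x = (case x of Elt c \<Rightarrow> e c {#} | Var i \<Rightarrow> e \<one>\<^bsub>C\<^esub> {#i#})"

abbreviation psi where "psi \<equiv> free_algebra_lift k S val"
abbreviation fval where "fval w \<equiv> foldr (\<lambda>x y. val x \<otimes>\<^bsub>S\<^esub> y) w \<one>\<^bsub>S\<^esub>"

lemma val_closed: "val \<in> gens \<rightarrow> carrier S"
proof
  fix x assume "x \<in> gens"
  then show "val x \<in> carrier S"
    by (cases rule: gens_cases) (auto simp: val_def e_closed)
qed

lemma fval_closed: "w \<in> lists gens \<Longrightarrow> fval w \<in> carrier S"
  by (induction w) (use val_closed in auto)

lemmas psi_linear = linear_free_algebra_lift[OF assoc_S val_closed]
  and psi_single = free_algebra_lift_single[OF assoc_S val_closed]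
  and psi_hom = ring_hom_free_algebra_lift[OF assoc_S val_closed]

text \<open>Since \<open>chi\<close> is 1 on the pair \<open>(i, i)\<close>, powers of one variable
  carry no scalar, so the nilpotency relation reduces to \<open>e_zero\<close>.\<close>

lemma fval_replicate: "i \<in> T \<Longrightarrow> fval (replicate m (Var i)) = e \<one>\<^bsub>C\<^esub> (replicate_mset m i)"
proof (induction m)
  case (Suc m)
  have "chi {#i#} (replicate_mset m' i) = \<one>" for m'
  proof (induction m')
    case (Suc m')
    then show ?case
      using chi_union_right[of "{#i#}" "{#i#}" "replicate_mset m' i"] chi_single[OF Suc.prems Suc.prems] 
        chi_single[OF \<open>i \<in> T\<close> \<open>i \<in> T\<close>] by simp
  qed (simp add: chi_empty)
  moreover have "exps (replicate_mset m i)" "e \<one>\<^bsub>C\<^esub> (add_mset i (replicate_mset m i)) \<in> carrier S"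
    using Suc.prems by (auto intro!: e_closed split: if_splits)
  ultimately show ?case
    using Suc by (simp add: val_def e_Var_mult gs_one)
qed (simp add: one_S)

lemma psi_rels:
  assumes "x \<in> hopf_rels k C t n gs g"
  shows "psi x = \<zero>\<^bsub>S\<^esub>"
proof -
  have self: "u \<ominus>\<^bsub>S\<^esub> u = \<zero>\<^bsub>S\<^esub>" if "u \<in> carrier S" for u using that by (simp add: a_minus_def S.r_neg)
  \<comment> \<open>Every relation except the nilpotency of the variables has this shape, a word
    minus a multiple of a word.\<close>
  have *: "psi (single k v \<ominus>\<^bsub>F\<^esub> r \<odot>\<^bsub>F\<^esub> single k w) = \<zero>\<^bsub>S\<^esub>"
    if "v \<in> lists gens" "w \<in> lists gens" "r \<in> carrier k" "fval v = r \<odot>\<^bsub>S\<^esub> fval w" for v w r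
    using linear_map_diff[OF Fmod.module_axioms module_S psi_linear word_closed[OF that(1)]
        Fmod.smult_closed[OF that(3) word_closed[OF that(2)]]]
      linear_map_smult[OF psi_linear that(3) word_closed[OF that(2)]] that self[OF fval_closed[OF that(1)]]
    by (simp add: psi_single)
  have **: "psi (single k v \<ominus>\<^bsub>F\<^esub> single k w) = \<zero>\<^bsub>S\<^esub>"
    if "v \<in> lists gens" "w \<in> lists gens" "fval v = fval w" for v w
    using *[OF that(1,2) one_closed] that fval_closed[OF that(2)] word_closed[OF that(2)] by simp
  from assms show ?thesis
    unfolding hopf_rels_def Let_def free_algebra_one
  proof (elim UnE CollectE exE conjE singletonE)
    fix c d assume "x = single k [Elt c, Elt d] \<ominus>\<^bsub>F\<^esub> single k [Elt (c \<otimes>\<^bsub>C\<^esub> d)]" "c \<in> carrier C" "d \<in> carrier C"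
    then show ?thesis
      by (simp add: ** Elt_gens val_def one_S e_Elt_mult)
  next
    assume "x = single k [Elt \<one>\<^bsub>C\<^esub>] \<ominus>\<^bsub>F\<^esub> single k []"
    then show ?thesis by (simp add: ** Elt_gens val_def one_S e_Elt_mult)
  next
    fix j c assume x0: "x = single k [Var j, Elt c] \<ominus>\<^bsub>F\<^esub> gs j c \<odot>\<^bsub>F\<^esub> single k [Elt c, Var j]" "j \<in> T" "c \<in> carrier C"
    then have "fval [Var j, Elt c] = gs j c \<odot>\<^bsub>S\<^esub> fval [Elt c, Var j]"
      by (simp add: val_def one_S e_Elt_mult e_Var_mult gs_one chi_empty gs_closed e_closed del: atLeastAtMost_iff)
    then show ?thesis
      using x0 by (simp only: x0(1)) (rule *, auto simp: Elt_gens Var_gens gs_closed simp del: atLeastAtMost_iff)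
  next
    fix j i assume x0: "x = single k [Var j, Var i] \<ominus>\<^bsub>F\<^esub> gs j (g i) \<odot>\<^bsub>F\<^esub> single k [Var i, Var j]"
      "j \<in> T" "i \<in> T" "j \<noteq> i"
    have ij: "exps {#i, j#}" "e \<one>\<^bsub>C\<^esub> {#j, i#} = e \<one>\<^bsub>C\<^esub> {#i, j#}"
      using x0 by (auto simp: add_mset_commute)
    have "fval [Var j, Var i] = chi {#j#} {#i#} \<odot>\<^bsub>S\<^esub> e \<one>\<^bsub>C\<^esub> {#i, j#}"
      "fval [Var i, Var j] = chi {#i#} {#j#} \<odot>\<^bsub>S\<^esub> e \<one>\<^bsub>C\<^esub> {#i, j#}"
      using x0(2-) ij(1) by (simp_all add: ij(2) val_def one_S e_Var_mult gs_one chi_empty chi_closed e_closed del: atLeastAtMost_iff)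
    \<comment> \<open>Only one of the two values of \<open>chi\<close> can differ from 1. For
      \<open>i < j\<close> the equation is immediate, for \<open>j < i\<close> it is
      skewness.\<close>
    moreover have "chi {#j#} {#i#} = q j i \<otimes> chi {#i#} {#j#}"
      using x0(2-) q_skew[of j i] q_closed[of j i] by (auto simp: chi_single simp del: atLeastAtMost_iff)
    ultimately have "fval [Var j, Var i] = gs j (g i) \<odot>\<^bsub>S\<^esub> fval [Var i, Var j]"
      using q_closed[OF x0(2,3)] chi_closed e_closed[OF C.one_closed ij(1)] by (simp add: q_def S.smult_assoc1)
    then show ?thesis
      using x0 q_closed[OF x0(2,3)] by (simp only: x0(1)) (rule *, auto simp: q_def Var_gens simp del: atLeastAtMost_iff)
  next
    fix j assume x: "x = single k (replicate (n j) (Var j))" "j \<in> T"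
    then have "replicate (n j) (Var j) \<in> lists gens"
      by (auto simp: in_lists_conv_set intro!: Var_gens simp del: atLeastAtMost_iff)
    then have "psi x = e \<one>\<^bsub>C\<^esub> (replicate_mset (n j) j)"
      unfolding x(1) by (simp only: psi_single fval_replicate[OF x(2)])
    also have "\<dots> = \<zero>\<^bsub>S\<^esub>"
      using x by (intro e_zero[of _ _ j]) (auto split: if_splits)
    finally show ?thesis .
  qed
qed

text \<open>The kernel of \<open>psi\<close> is an ideal and contains the relations, hence also the
  ideal that they generate.\<close>

lemma psi_I: "x \<in> I \<Longrightarrow> psi x = \<zero>\<^bsub>S\<^esub>"
proof -
  have h: "ring_hom_ring F S psi"
    by (rule ring_hom_ringI2[OF _ _ psi_hom]) (rule assoc_algebra_ring assoc_free_algebra assoc_S)+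
  have "hopf_rels k C t n gs g \<subseteq> a_kernel F S psi"
    using hopf_rels_closed psi_rels by (auto simp: a_kernel_def')
  then have "I \<subseteq> a_kernel F S psi" by (rule I_subset[OF ring_hom_ring.kernel_is_ideal[OF h]])
  then show "x \<in> I \<Longrightarrow> psi x = \<zero>\<^bsub>S\<^esub>" by (auto simp: a_kernel_def')
qed

lemma psi_surj: "carrier S \<subseteq> psi ` carrier F"
proof (rule generated_by_gens)
  show "submodule (psi ` carrier F) k S"
    by (rule submodule_image[OF Fmod.module_axioms module_S psi_linear])
  have one: "psi \<one>\<^bsub>F\<^esub> = \<one>\<^bsub>S\<^esub>" using ring_hom_one[OF psi_hom] .
  then show "e \<one>\<^bsub>C\<^esub> {#} \<in> psi ` carrier F" by (metis Falg.one_closed imageI one_S)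
  have gen: "val x \<otimes>\<^bsub>S\<^esub> u \<in> psi ` carrier F" if x: "x \<in> gens" and u: "u \<in> psi ` carrier F" for x u
  proof -
    obtain f where f: "f \<in> carrier F" "u = psi f" using u by auto
    have x1: "single k [x] \<in> carrier F" using x by (intro word_closed) simp
    have "psi (single k [x]) = val x" using x val_closed by (simp add: psi_single Pi_iff)
    then have "val x \<otimes>\<^bsub>S\<^esub> u = psi (single k [x] \<otimes>\<^bsub>F\<^esub> f)"
      using ring_hom_mult[OF psi_hom x1 f(1)] f by simp
    then show ?thesis using x1 f by (metis Falg.m_closed imageI)
  qed
  show "e c {#} \<otimes>\<^bsub>S\<^esub> u \<in> psi ` carrier F" if "c \<in> carrier C" "u \<in> psi ` carrier F" for c u
    using gen[OF Elt_gens[OF that(1)] that(2)] by (simp add: val_def)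
  show "e \<one>\<^bsub>C\<^esub> {#i#} \<otimes>\<^bsub>S\<^esub> u \<in> psi ` carrier F" if "i \<in> T" "u \<in> psi ` carrier F" for i u
    using gen[OF Var_gens[OF that(1)] that(2)] by (simp add: val_def)
qed

end

context hopf_datum
begin

text \<open>The sorted word contains \<open>n i\<close> adjacent copies of \<open>Var i\<close>, so
  its class has a vanishing factor.\<close>

lemma mon_zero:
  assumes "c \<in> carrier C" "exps a" "i \<in> T" "n i \<le> count a i"
  shows "mon c a = \<zero>\<^bsub>A\<^esub>"
proof -
  let ?l = "sorted_list_of_multiset a"
  let ?u = "filter (\<lambda>j. j < i) ?l" and ?v = "replicate (count a i - n i) i @ filter (\<lambda>j. i < j) ?l"
  have "?l = ?u @ replicate (count a i) i @ filter (\<lambda>j. i < j) ?l"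
    using sorted_list_split[of ?l i] by simp
  also have "replicate (count a i) i = replicate (n i) i @ replicate (count a i - n i) i"
    using assms(4) by (simp add: replicate_add[symmetric])
  finally have "?l = ?u @ replicate (n i) i @ ?v" by simp
  then have "Elt c # map Var ?l = (Elt c # map Var ?u) @ replicate (n i) (Var i) @ map Var ?v"
    by (metis append_Cons map_append map_replicate)
  moreover have "Elt c # map Var ?u \<in> lists gens" "map Var ?v \<in> lists gens" "replicate (n i) (Var i) \<in> lists gens"
    using assms Vars_closed[of ?u] Vars_closed[of ?v] Vars_closed[of "replicate (n i) i"]
    by (auto simp: Elt_gens Var_gens in_lists_conv_set simp del: atLeastAtMost_iff)
  ultimately show ?thesis
    by (simp only: mon_def) (simp add: cls_append cls_power[OF assms(3)] cls_closed del: map_append append_Cons)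
qed

lemma pointed_hopf_simps:
  "carrier (pointed_hopf k C t n gs g) = carrier A" "monoid.mult (pointed_hopf k C t n gs g) = monoid.mult A"
  "one (pointed_hopf k C t n gs g) = one A" "add (pointed_hopf k C t n gs g) = add A"
  "ring.zero (pointed_hopf k C t n gs g) = ring.zero A" "smult (pointed_hopf k C t n gs g) = smult A"
  "comult (pointed_hopf k C t n gs g) U = free_algebra_lift k (tensor_algebra k A A)
    (\<lambda>a. case a of Elt c \<Rightarrow> pure k A A (cls [Elt c]) (cls [Elt c])
      | Var i \<Rightarrow> pure k A A (cls [Var i]) (cls [Elt (g i)]) \<oplus>\<^bsub>tensor k A A\<^esub> pure k A A \<one>\<^bsub>A\<^esub> (cls [Var i]))
    (SOME f. f \<in> U)"
  "counit (pointed_hopf k C t n gs g) U = free_algebra_lift k (self_module k)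
    (\<lambda>a. case a of Elt c \<Rightarrow> \<one> | Var i \<Rightarrow> \<zero>) (SOME f. f \<in> U)"
  by (simp_all add: pointed_hopf_def Let_def bialg.defs module.defs hopf.defs cls_def cong: gen.case_cong)

lemma assoc_self: "assoc_algebra k (self_module k)"
proof -
  have "bilinear k (self_module k) (self_module k) (self_module k) (monoid.mult (self_module k))"
    by (intro bilinearI linear_mapI) (auto simp: self_module_def l_distr r_distr m_ac)
  then show ?thesis
    by (rule assoc_algebraI_span[OF module_self _ spans_carrier]) (auto simp: self_module_def m_assoc)
qed

end

section \<open>The comparison map from a graded bialgebra to \<open>K\<close>\<close>

context hopf_graded
begin

context
  fixes sg
  assumes sg_linear: "linear_map k S A sg"
    and sg_e: "\<And>c a. c \<in> carrier C \<Longrightarrow> exps a \<Longrightarrow> sg (e c a) = mon c a"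
begin

text \<open>The two multiplication tables agree on the family: \<open>e_Elt_mult\<close> corresponds
  to \<open>Elt_mon\<close>, and \<open>e_Var_mult\<close> to \<open>Var_mon\<close>.\<close>

lemma sg_gen_mult:
  assumes x: "x \<in> gens" and s: "s \<in> carrier S"
  shows "sg (val x \<otimes>\<^bsub>S\<^esub> s) = cls [x] \<otimes>\<^bsub>A\<^esub> sg s"
proof (rule spans_ext[OF sp module_S Amod.module_axioms _ _ _ s])
  have v: "val x \<in> carrier S" using x val_closed by auto
  have x1: "cls [x] \<in> carrier A" using x by (intro cls_closed) simp
  show "linear_map k S A (\<lambda>s. sg (val x \<otimes>\<^bsub>S\<^esub> s))"
    by (rule linear_map_comp[OF bilinear_right[OF bil v] sg_linear])
  show "linear_map k S A (\<lambda>s. cls [x] \<otimes>\<^bsub>A\<^esub> sg s)"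
    by (rule linear_map_comp[OF sg_linear bilinear_right[OF bilinear_mult[OF assoc_A] x1]])
  fix s assume "s \<in> basis"
  then obtain d b where y: "s = e d b" "d \<in> carrier C" "exps b" by auto
  from x show "sg (val x \<otimes>\<^bsub>S\<^esub> s) = cls [x] \<otimes>\<^bsub>A\<^esub> sg s"
  proof (cases rule: gens_cases)
    case (Elt c)
    then show ?thesis using y by (simp add: val_def e_Elt_mult sg_e Elt_mon)
  next
    case (Var i)
    have ib: "exps (add_mset i b)" using Var(2) y(3) by auto
    have "gs i d \<otimes> chi {#i#} b \<in> carrier k" using gs_closed[OF Var(2) y(2)] chi_closed by simp
    then show ?thesis
      using Var y linear_map_smult[OF sg_linear _ e_closed[OF y(2) ib]]
      by (simp add: val_def e_Var_mult sg_e[OF y(2) ib] sg_e[OF y(2,3)] Var_mon del: atLeastAtMost_iff)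
  qed
qed

lemma sg_one: "sg \<one>\<^bsub>S\<^esub> = \<one>\<^bsub>A\<^esub>"
  by (simp add: one_S sg_e mon_Elt cls_Elt_one)

lemma sg_fval: "w \<in> lists gens \<Longrightarrow> sg (fval w) = cls w"
proof (induction w)
  case (Cons x w)
  then show ?case using sg_gen_mult[OF _ fval_closed[of w]] cls_Cons[of x w] by simp
qed (simp add: sg_one cls_Nil)

text \<open>Checked on words, where it is \<open>sg_fval\<close>. As \<open>psi\<close> is onto,
  bijectivity and multiplicativity of \<open>sg\<close> are all read off from this equation.\<close>

lemma sg_psi: "f \<in> carrier F \<Longrightarrow> sg (psi f) = I +>\<^bsub>F\<^esub> f"
  by (rule spans_ext[OF spans_free_algebra Fmod.module_axioms Amod.module_axioms
        linear_map_comp[OF psi_linear sg_linear] Q.linear_coset])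
    (elim imageE, simp only: psi_single sg_fval cls_def)

lemma psi_surjE:
  assumes "s \<in> carrier S"
  obtains f where "f \<in> carrier F" "s = psi f"
  using subsetD[OF psi_surj assms] by (rule imageE) simp

text \<open>Equal images mean that preimages under \<open>psi\<close> differ by an element of the
  ideal, which \<open>psi\<close> kills. So no relation holds among the ordered monomials of
  \<open>K\<close> that fails in \<open>S\<close>.\<close>

lemma sg_inj: "inj_on sg (carrier S)"
proof (rule inj_onI)
  fix x y assume xy: "x \<in> carrier S" "y \<in> carrier S" "sg x = sg y"
  obtain f where f: "f \<in> carrier F" "x = psi f" by (rule psi_surjE[OF xy(1)])
  obtain h where h: "h \<in> carrier F" "y = psi h" by (rule psi_surjE[OF xy(2)])
  note fh = f(1) h(1) f(2) h(2)
  have "f \<ominus>\<^bsub>F\<^esub> h \<in> I" using Q.coset_eq_imp[OF fh(1,2)] sg_psi fh xy(3) by simp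
  then have z: "psi f \<ominus>\<^bsub>S\<^esub> psi h = \<zero>\<^bsub>S\<^esub>"
    using psi_I linear_map_diff[OF Fmod.module_axioms module_S psi_linear fh(1,2)] by simp
  have "psi f = (psi f \<ominus>\<^bsub>S\<^esub> psi h) \<oplus>\<^bsub>S\<^esub> psi h"
    using xy fh by (simp add: a_minus_def S.a_assoc S.l_neg)
  then show "x = y" using z fh xy by simp
qed

lemma sg_surj: "sg ` carrier S = carrier A"
proof
  show "sg ` carrier S \<subseteq> carrier A" using linear_map_closed[OF sg_linear] by auto
  show "carrier A \<subseteq> sg ` carrier S"
  proof
    fix U assume "U \<in> carrier A"
    then obtain f where f: "f \<in> carrier F" "U = I +>\<^bsub>F\<^esub> f" by (auto simp: Q.quot_module_simps(1))
    then have "U = sg (psi f)" by (simp add: sg_psi)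
    then show "U \<in> sg ` carrier S" using linear_map_closed[OF psi_linear f(1)] by blast
  qed
qed

lemma sg_mult:
  assumes "x \<in> carrier S" "y \<in> carrier S"
  shows "sg (x \<otimes>\<^bsub>S\<^esub> y) = sg x \<otimes>\<^bsub>A\<^esub> sg y"
proof -
  obtain f where f: "f \<in> carrier F" "x = psi f" by (rule psi_surjE[OF assms(1)])
  obtain h where h: "h \<in> carrier F" "y = psi h" by (rule psi_surjE[OF assms(2)])
  note fh = f(1) h(1) f(2) h(2)
  have "sg (x \<otimes>\<^bsub>S\<^esub> y) = sg (psi (f \<otimes>\<^bsub>F\<^esub> h))" using ring_hom_mult[OF psi_hom fh(1,2)] fh by simp
  also have "\<dots> = sg x \<otimes>\<^bsub>A\<^esub> sg y"
    using fh by (simp add: sg_psi quot_algebra_mult[OF assoc_free_algebra ideal_I])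
  finally show ?thesis .
qed

text \<open>The structure maps of \<open>K\<close> evaluate at a representative chosen by
  \<open>SOME\<close>; whatever it is, \<open>psi\<close> returns it to the original
  element.\<close>

lemma sg_rep:
  assumes "s \<in> carrier S"
  shows "(SOME f. f \<in> sg s) \<in> carrier F" "psi (SOME f. f \<in> sg s) = s"
proof -
  have "sg s \<in> carrier A" using linear_map_closed[OF sg_linear assms] .
  note r = Q.quot_rep[OF this]
  show "(SOME f. f \<in> sg s) \<in> carrier F" by (rule r)
  show "psi (SOME f. f \<in> sg s) = s"
    by (rule inj_onD[OF sg_inj _ linear_map_closed[OF psi_linear r(1)] assms]) (simp only: sg_psi[OF r(1)] r(2))
qed

lemma sg_val: "x \<in> gens \<Longrightarrow> sg (val x) = cls [x]"
  using sg_fval[of "[x]"] val_closed by (auto simp: Pi_iff)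

abbreviation AA where "AA \<equiv> tensor_algebra k A A"
abbreviation sg2 where "sg2 \<equiv> tensor_map k A A sg sg"

lemma sg2_linear: "linear_map k (tensor k S S) (tensor k A A) sg2"
  by (rule linear_tensor_map[OF module_S module_S Amod.module_axioms Amod.module_axioms sg_linear sg_linear])

lemma sg2_pure: "x \<in> carrier S \<Longrightarrow> y \<in> carrier S \<Longrightarrow> sg2 (pure k S S x y) = pure k A A (sg x) (sg y)"
  by (rule tensor_map_pure[OF module_S module_S Amod.module_axioms Amod.module_axioms sg_linear sg_linear])

lemma sg2_mult:
  assumes "u \<in> carrier (tensor k S S)" "v \<in> carrier (tensor k S S)"
  shows "sg2 (u \<otimes>\<^bsub>SS\<^esub> v) = sg2 u \<otimes>\<^bsub>AA\<^esub> sg2 v"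
proof -
  note sps = spans_tensor[OF module_S module_S spans_carrier spans_carrier]
  note mT = module_tensor[OF module_S module_S]
  show ?thesis
    by (rule bilinear_ext[OF sps sps mT mT module_tensor[OF Amod.module_axioms Amod.module_axioms]
          bilinear_comp[OF bilinear_tensor_algebra_mult[OF assoc_S assoc_S] sg2_linear]
          bilinear_comp_args[OF bilinear_tensor_algebra_mult[OF assoc_A assoc_A] sg2_linear sg2_linear] _ assms])
      (auto simp: tensor_algebra_mult_pure[OF assoc_S assoc_S] tensor_algebra_mult_pure[OF assoc_A assoc_A]
        sg2_pure sg_mult linear_map_closed[OF sg_linear])
qed

definition Dval where "Dval = (\<lambda>a. case a of Elt c \<Rightarrow> pure k A A (cls [Elt c]) (cls [Elt c])
      | Var i \<Rightarrow> pure k A A (cls [Var i]) (cls [Elt (g i)]) \<oplus>\<^bsub>tensor k A A\<^esub> pure k A A \<one>\<^bsub>A\<^esub> (cls [Var i]))"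

lemma Dval_eq:
  assumes "x \<in> gens"
  shows "Dval x = sg2 (comult S (val x))"
  using assms
proof (cases rule: gens_cases)
  case (Elt c)
  then show ?thesis
    using sg_val[OF assms] by (simp add: Dval_def val_def comult_e_Elt sg2_pure e_closed)
next
  case (Var i)
  have 1: "pure k S S (e \<one>\<^bsub>C\<^esub> {#i#}) (e (g i) {#}) \<in> carrier (tensor k S S)"
    "pure k S S \<one>\<^bsub>S\<^esub> (e \<one>\<^bsub>C\<^esub> {#i#}) \<in> carrier (tensor k S S)"
    using Var(2) g[OF Var(2)] by (auto intro!: pure_closed module_S e_closed)
  have "sg (e \<one>\<^bsub>C\<^esub> {#i#}) = cls [Var i]" "sg (e (g i) {#}) = cls [Elt (g i)]"
    using sg_val[OF assms] Var g[OF Var(2)] by (auto simp: val_def sg_e mon_Elt)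
  then show ?thesis
    using Var g[OF Var(2)] linear_map_add[OF sg2_linear 1]
    by (simp add: Dval_def val_def comult_e_Var sg2_pure e_closed sg_one del: atLeastAtMost_iff)
qed

text \<open>On the free algebra, lifting \<open>Dval\<close> and transporting the coproduct of
  \<open>S\<close> along \<open>psi\<close> agree on words, since both are multiplicative. The
  second map depends only on \<open>psi f\<close>, so by \<open>sg_rep\<close> the chosen
  representative is immaterial.\<close>

lemma comult_sg:
  assumes s: "s \<in> carrier S"
  shows "comult (pointed_hopf k C t n gs g) (sg s) = sg2 (comult S s)"
proof -
  note mAA = module_tensor[OF Amod.module_axioms Amod.module_axioms]
  have AAc: "carrier AA = carrier (tensor k A A)" "add AA = add (tensor k A A)" "smult AA = smult (tensor k A A)"
    by (simp_all add: tensor_algebra_def)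
  have vc: "val x \<in> carrier S" if "x \<in> gens" for x using val_closed that by auto
  have Dc: "Dval \<in> gens \<rightarrow> carrier AA"
    using Dval_eq linear_map_closed[OF sg2_linear] linear_map_closed[OF co] vc by (auto simp: AAc)
  note assAA = assoc_tensor_algebra[OF assoc_A assoc_A]
  have lin1: "linear_map k F (tensor k A A) (free_algebra_lift k AA Dval)"
    using linear_free_algebra_lift[OF assAA Dc] by (simp add: linear_map_def AAc)
  have lin2: "linear_map k F (tensor k A A) (\<lambda>f. sg2 (comult S (psi f)))"
    by (rule linear_map_comp[OF linear_map_comp[OF psi_linear co] sg2_linear])
  have words: "foldr (\<lambda>x y. Dval x \<otimes>\<^bsub>AA\<^esub> y) w \<one>\<^bsub>AA\<^esub> = sg2 (comult S (fval w))" if "w \<in> lists gens" for w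
    using that
  proof (induction w)
    case Nil
    have "sg2 (comult S \<one>\<^bsub>S\<^esub>) = pure k A A \<one>\<^bsub>A\<^esub> \<one>\<^bsub>A\<^esub>"
      using sg_one by (simp add: one_S comult_e_Elt sg2_pure e_closed)
    then show ?case by (simp add: tensor_algebra_def)
  next
    case (Cons x w)
    then show ?case
      using sg2_mult[OF linear_map_closed[OF co vc] linear_map_closed[OF co fval_closed[of w]]]
        comult_mult[OF vc fval_closed[of w]]
      by (simp add: Dval_eq)
  qed
  have "free_algebra_lift k AA Dval f = sg2 (comult S (psi f))" if "f \<in> carrier F" for f
    by (rule spans_ext[OF spans_free_algebra Fmod.module_axioms mAA lin1 lin2 _ that])
      (elim imageE, simp only: psi_single free_algebra_lift_single[OF assAA Dc] words)
  then show ?thesis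
    unfolding pointed_hopf_simps Dval_def[symmetric] using sg_rep[OF s] by simp
qed

lemma counit_sg:
  assumes s: "s \<in> carrier S"
  shows "counit (pointed_hopf k C t n gs g) (sg s) = counit S s"
proof -
  define E where "E = (\<lambda>a :: 'c gen. case a of Elt c \<Rightarrow> \<one> | Var i \<Rightarrow> \<zero>)"
  have vc: "val x \<in> carrier S" if "x \<in> gens" for x using val_closed that by auto
  have Ec: "E \<in> gens \<rightarrow> carrier (self_module k)" by (auto simp: E_def self_module_def split: gen.split)
  have E: "E x = counit S (val x)" if "x \<in> gens" for x
    using that by (cases rule: gens_cases) (auto simp: E_def val_def e_counit)
  have words: "foldr (\<lambda>x y. E x \<otimes>\<^bsub>self_module k\<^esub> y) w \<one>\<^bsub>self_module k\<^esub> = counit S (fval w)" if "w \<in> lists gens" for w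
    using that
  proof (induction w)
    case (Cons x w)
    then show ?case using counit_mult[OF vc fval_closed[of w]] E by (simp add: self_module_def)
  qed (simp add: self_module_def one_S e_counit)
  have "free_algebra_lift k (self_module k) E f = counit S (psi f)" if "f \<in> carrier F" for f
    by (rule spans_ext[OF spans_free_algebra Fmod.module_axioms module_self
          linear_free_algebra_lift[OF assoc_self Ec] linear_map_comp[OF psi_linear cu] _ that])
      (elim imageE, simp only: psi_single free_algebra_lift_single[OF assoc_self Ec] words)
  then show ?thesis
    unfolding pointed_hopf_simps E_def[symmetric] using sg_rep[OF s] by simp
qed

lemma bialgebra_iso_sg: "bialgebra_iso k S (pointed_hopf k C t n gs g) sg"
proof -
  let ?K = "pointed_hopf k C t n gs g"
  have "linear_map k S ?K sg"
    using sg_linear by (simp add: linear_map_def pointed_hopf_simps)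
  moreover have "sg \<in> ring_hom S ?K"
    by (rule ring_hom_memI)
      (auto simp: pointed_hopf_simps linear_mapD[OF sg_linear] sg_mult sg_one)
  moreover have "bij_betw sg (carrier S) (carrier ?K)"
    using sg_inj sg_surj by (simp add: bij_betw_def pointed_hopf_simps)
  moreover have "tensor_map k ?K ?K sg sg = sg2"
    by (rule tensor_map_record_cong) (simp_all add: pointed_hopf_simps)
  ultimately show ?thesis
    unfolding bialgebra_iso_def using comult_sg counit_sg by simp
qed

end

end

section \<open>The smash biproduct\<close>

lemma bilinear_record_cong:
  assumes "carrier M' = carrier M" "add M' = add M" "smult M' = smult M"
    "carrier N' = carrier N" "add N' = add N" "smult N' = smult N"
    "carrier P' = carrier P" "add P' = add P" "smult P' = smult P"
  shows "bilinear k M' N' P' f \<longleftrightarrow> bilinear k M N P f"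
  using assms by (simp add: bilinear_def linear_map_def)

section \<open>The braided factor \<open>H\<close>\<close>

context hopf_datum
begin

definition reduced :: "nat multiset \<Rightarrow> bool" where
  "reduced a \<longleftrightarrow> exps a \<and> (\<forall>i\<in>T. count a i < n i)"

text \<open>The basis of \<open>H\<close> has to be indexed by natural numbers, hence the coding of exponents.\<close>

definition enc :: "nat multiset \<Rightarrow> nat" where "enc a = to_nat (sorted_list_of_multiset a)"
definition dec :: "nat \<Rightarrow> nat multiset" where "dec u = mset (from_nat u)"

lemma dec_enc: "dec (enc a) = a"
  by (simp add: dec_def enc_def)

abbreviation U where "U \<equiv> enc ` Collect reduced"
abbreviation M where "M \<equiv> free_module k U"

text \<open>With value zero outside the reduced exponents, the formulas for product and coproduct of
  monomials need no case distinction.\<close>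

definition xpow :: "nat multiset \<Rightarrow> nat \<Rightarrow> 'a" where
  "xpow a = (if reduced a then single k (enc a) else \<zero>\<^bsub>M\<^esub>)"

text \<open>The operations are prescribed only on codes of reduced exponents;
  \<open>xpow_mult\<close> and \<open>xpow_comult\<close> extend the formulas to all
  exponents.\<close>

definition H :: "('a, nat \<Rightarrow> 'a) bialg" where
  "H = module.extend
     (M\<lparr>monoid.mult := bil_ext M (\<lambda>u v. chi (dec u) (dec v) \<odot>\<^bsub>M\<^esub> xpow (dec u + dec v)), one := xpow {#}\<rparr>)
     (bialg.fields
       (lin_ext k (tensor k M M) (\<lambda>u. \<Oplus>\<^bsub>tensor k M M\<^esub>p\<in>splits (dec u). gam (fst p) (snd p) \<odot>\<^bsub>tensor k M M\<^esub>
         pure k M M (xpow (fst p)) (xpow (snd p))))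
       (lin_ext k (self_module k) (\<lambda>u. if dec u = {#} then \<one> else \<zero>)))"

lemma H_simps:
  "carrier H = carrier M" "add H = add M" "smult H = smult M" "ring.zero H = ring.zero M"
  "monoid.mult H = bil_ext M (\<lambda>u v. chi (dec u) (dec v) \<odot>\<^bsub>M\<^esub> xpow (dec u + dec v))" "one H = xpow {#}"
  "comult H = lin_ext k (tensor k M M) (\<lambda>u. \<Oplus>\<^bsub>tensor k M M\<^esub>p\<in>splits (dec u). gam (fst p) (snd p) \<odot>\<^bsub>tensor k M M\<^esub>
         pure k M M (xpow (fst p)) (xpow (snd p)))"
  "counit H = lin_ext k (self_module k) (\<lambda>u. if dec u = {#} then \<one> else \<zero>)"
  by (simp_all add: H_def module.defs bialg.defs)

lemma module_H: "module k H"
  by (rule module_record_cong[OF module_free]) (simp_all add: H_simps)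

sublocale Mm: module k M by (rule module_free)
sublocale Hm: module k H by (rule module_H)

lemma tensor_H: "tensor k H H = tensor k M M" "pure k H H = pure k M M"
  using tensor_record_cong[of H M H M] by (simp_all add: H_simps)

lemma xpow_closed: "xpow a \<in> carrier M"
  by (auto simp: xpow_def intro: single_closed)

lemma xpow_zero: "\<not> reduced a \<Longrightarrow> xpow a = \<zero>\<^bsub>M\<^esub>"
  by (simp add: xpow_def)

lemma reduced_union: "exps b \<Longrightarrow> reduced (a + b) \<Longrightarrow> reduced a"
  "exps a \<Longrightarrow> reduced (a + b) \<Longrightarrow> reduced b"
  by (fastforce simp: reduced_def)+

text \<open>The order of a primitive root of unity is positive, so no \<open>n i\<close> is
  zero.\<close>

lemma reduced_empty: "reduced {#}"
  using prim by (auto simp: reduced_def primitive_root_of_unity_def)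

lemma spans_H: "spans k H {xpow a | a. exps a}"
proof -
  have "spans k M {xpow a | a. exps a}"
    unfolding spans_def
  proof (intro conjI allI impI)
    fix N assume "submodule N k M" "{xpow a | a. exps a} \<subseteq> N"
    moreover have "single k ` U \<subseteq> {xpow a | a. exps a}"
      by (force simp: xpow_def reduced_def)
    ultimately show "carrier M \<subseteq> N" using spans_free[of U] unfolding spans_def by blast
  qed (use xpow_closed in auto)
  then show ?thesis by (intro spans_record_cong[of H M]) (simp_all add: H_simps)
qed

lemma bilinear_H: "bilinear k H H H (monoid.mult H)"
  unfolding bilinear_record_cong[of H M H M H M, OF H_simps(1-3) H_simps(1-3) H_simps(1-3)] H_simps(5)
  by (intro bilinear_bil_ext module_free Mm.smult_closed chi_closed xpow_closed)

text \<open>If a factor is not reduced then neither is \<open>a + b\<close>, and both sides are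
  zero.\<close>

lemma xpow_mult:
  assumes a: "exps a" and b: "exps b"
  shows "xpow a \<otimes>\<^bsub>H\<^esub> xpow b = chi a b \<odot>\<^bsub>H\<^esub> xpow (a + b)"
proof (cases "reduced a \<and> reduced b")
  case True
  then show ?thesis
    using chi_closed xpow_closed
    by (simp add: H_simps xpow_def[of a] xpow_def[of b] bil_ext_single[OF module_free] dec_enc)
next
  case False
  then have "\<not> reduced (a + b)" using reduced_union a b by blast
  moreover have "xpow a = \<zero>\<^bsub>H\<^esub> \<or> xpow b = \<zero>\<^bsub>H\<^esub>" using False xpow_zero by (auto simp: H_simps)
  ultimately show ?thesis
    using bilinear_zero[OF bilinear_H module_H module_H module_H] xpow_closed chi_closed
    by (auto simp: xpow_zero[of "a + b"] H_simps(1,3,4))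
qed

lemma linear_comult_H: "linear_map k H (tensor k H H) (comult H)"
proof -
  interpret MM: module k "tensor k M M" by (rule module_tensor[OF module_free module_free])
  have "linear_map k M (tensor k M M) (comult H)"
    unfolding H_simps(7) using xpow_closed
    by (intro linear_lin_ext MM.module_axioms funcsetI MM.finsum_closed MM.smult_closed gam_closed
        pure_closed module_free)
  then show ?thesis unfolding tensor_H(1) by (simp add: linear_map_def H_simps(1-3))
qed

text \<open>For a nonreduced exponent every summand must vanish. Some variable has total
  multiplicity at least \<open>n i\<close>, so either one part already reaches this bound and its
  monomial is zero, or neither does and \<open>gam_eq_zero\<close> applies.\<close>

lemma xpow_comult:
  assumes a: "exps a"
  shows "comult H (xpow a) = (\<Oplus>\<^bsub>tensor k H H\<^esub>p\<in>splits a. gam (fst p) (snd p) \<odot>\<^bsub>tensor k H H\<^esub>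
         pure k H H (xpow (fst p)) (xpow (snd p)))"
proof -
  interpret MM: module k "tensor k M M" by (rule module_tensor[OF module_free module_free])
  have c: "pure k M M (xpow b) (xpow d) \<in> carrier (tensor k M M)" for b d
    by (intro pure_closed module_free xpow_closed)
  show ?thesis
  proof (cases "reduced a")
    case True
    then show ?thesis
      unfolding tensor_H xpow_def[of a]
      by (simp add: H_simps(7), subst lin_ext_single[OF MM.module_axioms])
        (auto simp: dec_enc intro!: MM.finsum_closed MM.smult_closed gam_closed c)
  next
    case False
    then obtain i where i: "i \<in> T" "n i \<le> count a i" using a by (auto simp: reduced_def not_less)
    have "gam (fst p) (snd p) \<odot>\<^bsub>tensor k M M\<^esub> pure k M M (xpow (fst p)) (xpow (snd p)) = \<zero>\<^bsub>tensor k M M\<^esub>"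
      if p: "p \<in> splits a" for p
    proof -
      have s: "n i \<le> count (fst p) i + count (snd p) i" using p i(2) by (auto simp: splits_def)
      note z = bilinear_zero[OF bilinear_pure[OF module_free module_free] module_free module_free MM.module_axioms]
      consider "n i \<le> count (fst p) i" | "n i \<le> count (snd p) i"
        | "count (fst p) i < n i" "count (snd p) i < n i" by linarith
      then show ?thesis
      proof cases
        case 1
        then have "xpow (fst p) = \<zero>\<^bsub>M\<^esub>" using i(1) by (intro xpow_zero) (auto simp: reduced_def not_less)
        then show ?thesis using z(2)[OF xpow_closed] gam_closed by simp
      next
        case 2
        then have "xpow (snd p) = \<zero>\<^bsub>M\<^esub>" using i(1) by (intro xpow_zero) (auto simp: reduced_def not_less)
        then show ?thesis using z(1)[OF xpow_closed] gam_closed by simp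
      next
        case 3
        then show ?thesis using gam_eq_zero[OF i(1) 3 s] c by simp
      qed
    qed
    then have "(\<Oplus>\<^bsub>tensor k M M\<^esub>p\<in>splits a. gam (fst p) (snd p) \<odot>\<^bsub>tensor k M M\<^esub>
        pure k M M (xpow (fst p)) (xpow (snd p))) = \<zero>\<^bsub>tensor k M M\<^esub>"
      by (rule MM.add.finprod_one_eqI)
    moreover have "comult H (xpow a) = \<zero>\<^bsub>tensor k M M\<^esub>"
      using linear_map_zero[OF module_H _ linear_comult_H] False MM.module_axioms
      by (simp add: tensor_H xpow_zero H_simps(4))
    ultimately show ?thesis unfolding tensor_H by simp
  qed
qed

lemma linear_counit_H: "linear_map k H (self_module k) (counit H)"
proof -
  have "linear_map k M (self_module k) (counit H)"
    unfolding H_simps(8) by (intro linear_lin_ext module_self) (auto simp: self_module_def)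
  then show ?thesis by (simp add: linear_map_def H_simps(1-3))
qed

lemma xpow_counit:
  assumes "exps a"
  shows "counit H (xpow a) = (if a = {#} then \<one> else \<zero>)"
proof (cases "reduced a")
  case True
  have "lin_ext k (self_module k) (\<lambda>u. if dec u = {#} then \<one> else \<zero>) (single k (enc a))
    = (if dec (enc a) = {#} then \<one> else \<zero>)"
    by (rule lin_ext_single[OF module_self]) (simp add: self_module_def)
  then show ?thesis using True by (simp add: xpow_def H_simps(8) dec_enc)
next
  case False
  then show ?thesis
    using linear_map_zero[OF module_H module_self linear_counit_H] reduced_empty
    by (auto simp: xpow_zero H_simps(4) self_module_def)
qed

lemma assoc_H: "assoc_algebra k H"
proof (rule assoc_algebraI_span[OF module_H bilinear_H spans_H])
  let ?B = "{xpow a | a. exps a}"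
  have cl: "xpow a \<in> carrier H" for a using xpow_closed by (simp add: H_simps)
  show "\<one>\<^bsub>H\<^esub> \<in> carrier H" by (simp add: H_simps(6) cl)
  show "\<one>\<^bsub>H\<^esub> \<otimes>\<^bsub>H\<^esub> x = x" "x \<otimes>\<^bsub>H\<^esub> \<one>\<^bsub>H\<^esub> = x" if "x \<in> ?B" for x
    using that by (auto simp: H_simps(6) xpow_mult chi_empty cl)
  show "x \<otimes>\<^bsub>H\<^esub> y \<otimes>\<^bsub>H\<^esub> z = x \<otimes>\<^bsub>H\<^esub> (y \<otimes>\<^bsub>H\<^esub> z)" if xyz: "x \<in> ?B" "y \<in> ?B" "z \<in> ?B" for x y z
  proof -
    obtain a where x: "x = xpow a" "exps a" using xyz(1) by auto
    obtain b where y: "y = xpow b" "exps b" using xyz(2) by auto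
    obtain d where z: "z = xpow d" "exps d" using xyz(3) by auto
    have "x \<otimes>\<^bsub>H\<^esub> y \<otimes>\<^bsub>H\<^esub> z = (chi a b \<otimes> chi (a + b) d) \<odot>\<^bsub>H\<^esub> xpow (a + b + d)"
      using x y z linear_map_smult[OF bilinear_left[OF bilinear_H cl[of d]] chi_closed[of a b] cl[of "a + b"]]
      by (simp add: xpow_mult chi_closed cl Hm.smult_assoc1)
    also have "chi a b \<otimes> chi (a + b) d = chi b d \<otimes> chi a (b + d)"
      by (simp add: chi_union_left chi_union_right chi_closed m_ac)
    also have "(chi b d \<otimes> chi a (b + d)) \<odot>\<^bsub>H\<^esub> xpow (a + b + d) = x \<otimes>\<^bsub>H\<^esub> (y \<otimes>\<^bsub>H\<^esub> z)"
      using x y z linear_map_smult[OF bilinear_right[OF bilinear_H cl[of a]] chi_closed[of b d] cl[of "b + d"]]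
      by (simp add: xpow_mult chi_closed cl Hm.smult_assoc1 add.assoc)
    finally show ?thesis .
  qed
qed

lemma coalgebra_H: "coalgebra k H"
proof (rule coalgebra_graded[OF module_H linear_comult_H linear_counit_H, where J = "{()}" and f = "\<lambda>_. xpow" and sh = "\<lambda>_ _. ()"])
  show "spans k H {xpow a | c a. c \<in> {()} \<and> exps a}" using spans_H by simp
qed (simp_all add: xpow_comult xpow_counit del: atLeastAtMost_iff)

section \<open>The group algebra\<close>

abbreviation L where "L \<equiv> group_algebra k C"

lemma L_simps:
  "carrier L = carrier (free_module k (carrier C))" "add L = add (free_module k (carrier C))"
  "smult L = smult (free_module k (carrier C))" "ring.zero L = ring.zero (free_module k (carrier C))"
  "monoid.mult L = monoid.mult (monoid_algebra k C)" "one L = single k \<one>\<^bsub>C\<^esub>"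
  "comult L = lin_ext k (tensor k (free_module k (carrier C)) (free_module k (carrier C)))
     (\<lambda>c. pure k (free_module k (carrier C)) (free_module k (carrier C)) (single k c) (single k c))"
  "counit L = lin_ext k (self_module k) (\<lambda>c. \<one>)"
proof -
  have "tensor k (monoid_algebra k C) (monoid_algebra k C) = tensor k (free_module k (carrier C)) (free_module k (carrier C))"
    "pure k (monoid_algebra k C) (monoid_algebra k C) = pure k (free_module k (carrier C)) (free_module k (carrier C))"
    by (rule tensor_record_cong; simp add: monoid_algebra_simps)+
  then show "comult L = lin_ext k (tensor k (free_module k (carrier C)) (free_module k (carrier C)))
     (\<lambda>c. pure k (free_module k (carrier C)) (free_module k (carrier C)) (single k c) (single k c))"
    by (simp add: group_algebra_def Let_def module.defs bialg.defs)
qed (simp_all add: group_algebra_def Let_def module.defs bialg.defs monoid_algebra_simps)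

lemma module_L: "module k L"
  by (rule module_record_cong[OF module_free]) (simp_all add: L_simps)

sublocale Lm: module k L by (rule module_L)

lemma tensor_L:
  "tensor k L L = tensor k (free_module k (carrier C)) (free_module k (carrier C))"
  "pure k L L = pure k (free_module k (carrier C)) (free_module k (carrier C))"
  by (rule tensor_record_cong; simp add: L_simps)+

lemma single_L: "c \<in> carrier C \<Longrightarrow> single k c \<in> carrier L"
  by (simp add: L_simps single_closed)

lemma spans_L: "spans k L (single k ` carrier C)"
  by (rule spans_record_cong[OF _ _ _ _ spans_free]) (simp_all add: L_simps)

lemma assoc_L: "assoc_algebra k L"
proof -
  have a: "assoc_algebra k (monoid_algebra k C)" by (rule assoc_monoid_algebra[OF C.monoid_axioms])
  have "bilinear k L L L (monoid.mult L)"
    using bilinear_mult[OF a] by (simp add: bilinear_def linear_map_def L_simps(1-3,5) monoid_algebra_simps(1,2,4))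
  then show ?thesis
    by (rule assoc_algebraI_span[OF module_L _ spans_L])
      (auto simp: L_simps(5,6) monoid_algebra_mult_single C.m_assoc single_L)
qed

lemma single_L_mult: "single k c \<otimes>\<^bsub>L\<^esub> single k d = single k (c \<otimes>\<^bsub>C\<^esub> d)"
  by (simp add: L_simps monoid_algebra_mult_single)

lemma linear_comult_L: "linear_map k L (tensor k L L) (comult L)"
proof -
  have "linear_map k (free_module k (carrier C)) (tensor k L L) (comult L)"
    unfolding L_simps(7) tensor_L
    by (intro linear_lin_ext module_tensor module_free funcsetI pure_closed single_closed)
  then show ?thesis by (simp add: linear_map_def L_simps(1-3))
qed

lemma comult_L: "c \<in> carrier C \<Longrightarrow> comult L (single k c) = pure k L L (single k c) (single k c)"
  unfolding L_simps(7) tensor_L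
  by (rule lin_ext_single[OF module_tensor[OF module_free module_free]]) (intro pure_closed module_free single_closed)

lemma linear_counit_L: "linear_map k L (self_module k) (counit L)"
proof -
  have "linear_map k (free_module k (carrier C)) (self_module k) (counit L)"
    unfolding L_simps(8) by (intro linear_lin_ext module_self) (auto simp: self_module_def)
  then show ?thesis by (simp add: linear_map_def L_simps(1-3))
qed

lemma counit_L: "c \<in> carrier C \<Longrightarrow> counit L (single k c) = \<one>"
  unfolding L_simps(8) by (rule lin_ext_single[OF module_self]) (simp add: self_module_def)

text \<open>Group-like elements are treated as a graded family concentrated in degree \<open>{#}\<close>.\<close>

lemma coalgebra_L: "coalgebra k L"
proof -
  interpret LL: module k "tensor k L L" by (rule module_tensor[OF module_L module_L])
  let ?f = "\<lambda>c a. if a = {#} then single k c else \<zero>\<^bsub>L\<^esub>"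
  note z = bilinear_zero[OF bilinear_pure[OF module_L module_L] module_L module_L LL.module_axioms]
  show ?thesis
  proof (rule coalgebra_graded[OF module_L linear_comult_L linear_counit_L, where J = "carrier C" and f = ?f and sh = "\<lambda>c _. c"])
    show "spans k L {?f c a | c a. c \<in> carrier C \<and> exps a}"
      unfolding spans_def
    proof (intro conjI allI impI)
      fix N assume N: "submodule N k L" "{?f c a | c a. c \<in> carrier C \<and> exps a} \<subseteq> N"
      have "single k ` carrier C \<subseteq> N"
      proof
        fix x assume "x \<in> single k ` carrier C"
        then obtain c where "c \<in> carrier C" "x = ?f c {#}" by auto
        then show "x \<in> N" using N(2) by (intro subsetD[OF N(2)] CollectI exI[of _ c] exI[of _ "{#}"]) auto
      qed
      then show "carrier L \<subseteq> N" using spans_L N(1) unfolding spans_def by blast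
    qed (auto simp: single_L)
    fix c a assume c: "c \<in> carrier C" and a: "exps a"
    show "counit L (?f c a) = (if a = {#} then \<one> else \<zero>)"
      using c linear_map_zero[OF module_L module_self linear_counit_L] counit_L
      by (auto simp: self_module_def)
    show "comult L (?f c a) = (\<Oplus>\<^bsub>tensor k L L\<^esub>p\<in>splits a. gam (fst p) (snd p) \<odot>\<^bsub>tensor k L L\<^esub>
          pure k L L (?f c (fst p)) (?f c (snd p)))"
    proof (cases "a = {#}")
      case True
      have "pure k L L (single k c) (single k c) \<in> carrier (tensor k L L)"
        using c by (intro pure_closed module_L single_L)
      then show ?thesis
        using c True by (simp add: splits_empty gam_empty comult_L LL.finsum_insert LL.finsum_empty)
    next
      case False
      have "(\<Oplus>\<^bsub>tensor k L L\<^esub>p\<in>splits a. gam (fst p) (snd p) \<odot>\<^bsub>tensor k L L\<^esub>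
          pure k L L (?f c (fst p)) (?f c (snd p))) = \<zero>\<^bsub>tensor k L L\<^esub>"
      proof (rule LL.add.finprod_one_eqI)
        fix p assume p: "p \<in> splits a"
        then have "fst p \<noteq> {#} \<or> snd p \<noteq> {#}" using False by (auto simp: splits_def)
        then show "gam (fst p) (snd p) \<odot>\<^bsub>tensor k L L\<^esub> pure k L L (?f c (fst p)) (?f c (snd p)) = \<zero>\<^bsub>tensor k L L\<^esub>"
          using z single_L[OF c] gam_closed by auto
      qed
      then show ?thesis
        using False linear_map_zero[OF module_L LL.module_axioms linear_comult_L] by simp
    qed
  qed (simp_all del: atLeastAtMost_iff)
qed

text \<open>\<open>R\<close> and \<open>W\<close> encode a Yetter-Drinfeld structure on
  \<open>H\<close> over the group algebra: \<open>R\<close> the action of \<open>c\<close> on x^a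
  through a character, \<open>W\<close> the coaction by the group element
  \<open>grp a\<close>.\<close>

definition R where "R = tensor_lift k (tensor k L H)
  (bil_ext (tensor k L H) (\<lambda>u c. pure k L H (ev (dec u) c \<odot>\<^bsub>L\<^esub> single k c) (xpow (dec u))))"
definition W where "W = tensor_lift k (tensor k H L)
  (bil_ext (tensor k H L) (\<lambda>c u. pure k H L (xpow (dec u)) (single k (c \<otimes>\<^bsub>C\<^esub> grp (dec u)))))"

abbreviation LH where "LH \<equiv> tensor k L H"
abbreviation HL where "HL \<equiv> tensor k H L"

lemma module_LH: "module k LH" and module_HL: "module k HL"
  by (intro module_tensor module_L module_H)+

lemma xpow_H: "xpow a \<in> carrier H"
  using xpow_closed by (simp add: H_simps)

lemma bilinear_ext_HL:
  assumes P: "module k P" and h: "\<And>u c. u \<in> U \<Longrightarrow> c \<in> carrier C \<Longrightarrow> h u c \<in> carrier P"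
  shows "bilinear k H L P (bil_ext P h)"
proof -
  have "bilinear k (free_module k U) (free_module k (carrier C)) P (bil_ext P h)"
    by (rule bilinear_bil_ext[OF P]) (rule h)
  then show ?thesis
    by (subst bilinear_record_cong[where M = "free_module k U" and N = "free_module k (carrier C)" and P = P])
      (simp_all add: H_simps(1-3) L_simps(1-3))
qed

lemma bilinear_ext_LH:
  assumes P: "module k P" and h: "\<And>c u. c \<in> carrier C \<Longrightarrow> u \<in> U \<Longrightarrow> h c u \<in> carrier P"
  shows "bilinear k L H P (bil_ext P h)"
proof -
  have "bilinear k (free_module k (carrier C)) (free_module k U) P (bil_ext P h)"
    by (rule bilinear_bil_ext[OF P]) (rule h)
  then show ?thesis
    by (subst bilinear_record_cong[where M = "free_module k (carrier C)" and N = "free_module k U" and P = P])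
      (simp_all add: H_simps(1-3) L_simps(1-3))
qed

text \<open>\<open>xpow a\<close> is a basis element only for reduced \<open>a\<close> and zero
  otherwise; the last hypothesis makes the prescribed value vanish in that case too.\<close>

lemma bil_ext_HL:
  assumes P: "module k P" and b: "bilinear k H L P (bil_ext P h)" and c: "c \<in> carrier C"
    and h: "h (enc a) c \<in> carrier P" "\<not> reduced a \<Longrightarrow> h (enc a) c = \<zero>\<^bsub>P\<^esub>"
  shows "bil_ext P h (xpow a) (single k c) = h (enc a) c"
  using bil_ext_single[where h = h, OF P h(1)] bilinear_zero(2)[OF b module_H module_L P single_L[OF c]] h(2)
  by (cases "reduced a") (simp_all add: xpow_def H_simps(4))

lemma bil_ext_LH:
  assumes P: "module k P" and b: "bilinear k L H P (bil_ext P h)" and c: "c \<in> carrier C"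
    and h: "h c (enc a) \<in> carrier P" "\<not> reduced a \<Longrightarrow> h c (enc a) = \<zero>\<^bsub>P\<^esub>"
  shows "bil_ext P h (single k c) (xpow a) = h c (enc a)"
  using bil_ext_single[where h = h, OF P h(1)] bilinear_zero(1)[OF b module_L module_H P single_L[OF c]] h(2)
  by (cases "reduced a") (simp_all add: xpow_def H_simps(4))

lemma bil_R: "bilinear k H L LH (bil_ext LH (\<lambda>u c. pure k L H (ev (dec u) c \<odot>\<^bsub>L\<^esub> single k c) (xpow (dec u))))"
  by (intro bilinear_ext_HL module_LH pure_closed module_L module_H Lm.smult_closed ev_closed single_L xpow_H)

lemma bil_W: "bilinear k L H HL (bil_ext HL (\<lambda>c u. pure k H L (xpow (dec u)) (single k (c \<otimes>\<^bsub>C\<^esub> grp (dec u)))))"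
  by (intro bilinear_ext_LH module_HL pure_closed module_L module_H single_L xpow_H C.m_closed grp_closed)

lemma linear_R: "linear_map k HL LH R"
  unfolding R_def by (rule linear_tensor_lift[OF module_H module_L module_LH bil_R])

lemma linear_W: "linear_map k LH HL W"
  unfolding W_def by (rule linear_tensor_lift[OF module_L module_H module_HL bil_W])

lemma xpow_zero_H: "\<not> reduced a \<Longrightarrow> xpow a = \<zero>\<^bsub>H\<^esub>"
  by (simp add: xpow_zero H_simps)

lemma R_pure:
  assumes c: "c \<in> carrier C"
  shows "R (pure k H L (xpow a) (single k c)) = pure k L H (ev a c \<odot>\<^bsub>L\<^esub> single k c) (xpow a)"
proof -
  note x = Lm.smult_closed[OF ev_closed[OF c] single_L[OF c]]
  show ?thesis
    unfolding R_def tensor_lift_pure[OF module_H module_L module_LH bil_R xpow_H single_L[OF c]]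
    by (subst bil_ext_HL[OF module_LH bil_R c])
      (simp_all add: dec_enc pure_closed[OF module_L module_H x xpow_H] xpow_zero_H
        bilinear_zero(1)[OF bilinear_pure[OF module_L module_H] module_L module_H module_LH x])
qed

lemma W_pure:
  assumes c: "c \<in> carrier C"
  shows "W (pure k L H (single k c) (xpow a)) = pure k H L (xpow a) (single k (c \<otimes>\<^bsub>C\<^esub> grp a))"
proof -
  note x = single_L[OF C.m_closed[OF c grp_closed]]
  show ?thesis
    unfolding W_def tensor_lift_pure[OF module_L module_H module_HL bil_W single_L[OF c] xpow_H]
    by (subst bil_ext_LH[OF module_HL bil_W c])
      (simp_all add: dec_enc pure_closed[OF module_H module_L xpow_H x] xpow_zero_H
        bilinear_zero(2)[OF bilinear_pure[OF module_H module_L] module_H module_L module_HL x])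
qed

section \<open>The smash biproduct as a graded bialgebra\<close>

abbreviation Sm where "Sm \<equiv> smash k L H R W"
definition e where "e c a = pure k L H (single k c) (xpow a)"

lemma Sm_simps:
  "carrier Sm = carrier LH" "add Sm = add LH" "smult Sm = smult LH" "ring.zero Sm = ring.zero LH"
  "monoid.mult Sm = smash_mult k L H R" "one Sm = pure k L H \<one>\<^bsub>L\<^esub> \<one>\<^bsub>H\<^esub>" "comult Sm = smash_comult k L H W"
  "counit Sm = tensor_lift k (self_module k) (\<lambda>x y. counit L x \<otimes> counit H y)"
  by (simp_all add: smash_def module.defs bialg.defs)

lemma module_Sm: "module k Sm"
  by (rule module_record_cong[OF module_LH]) (simp_all add: Sm_simps)

lemma tensor_Sm: "tensor k Sm Sm = tensor k LH LH" "pure k Sm Sm = pure k LH LH"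
  by (rule tensor_record_cong; simp add: Sm_simps)+

lemma e_LH: "c \<in> carrier C \<Longrightarrow> e c a \<in> carrier LH"
  unfolding e_def by (intro pure_closed module_L module_H single_L xpow_H)

lemma spans_LH: "spans k LH {e c a | c a. c \<in> carrier C \<and> exps a}"
proof -
  have "{e c a | c a. c \<in> carrier C \<and> exps a}
    = {pure k L H x y | x y. x \<in> single k ` carrier C \<and> y \<in> {xpow a | a. exps a}}"
    unfolding e_def by auto
  then show ?thesis using spans_tensor[OF module_L module_H spans_L spans_H] by simp
qed

lemma smash_mult_e:
  assumes c: "c \<in> carrier C" and d: "d \<in> carrier C" and a: "exps a" and b: "exps b"
  shows "smash_mult k L H R (e c a) (e d b) = (ev a d \<otimes> chi a b) \<odot>\<^bsub>LH\<^esub> e (c \<otimes>\<^bsub>C\<^esub> d) (a + b)"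
proof -
  interpret LHm: module k LH by (rule module_LH)
  note bp = bilinear_pure[OF module_L module_H]
  have cd: "single k (c \<otimes>\<^bsub>C\<^esub> d) \<in> carrier L" using c d by (intro single_L C.m_closed)
  have k: "ev a d \<in> carrier k" "chi a b \<in> carrier k" using ev_closed[OF d] chi_closed by auto
  have "smash_mult k L H R (e c a) (e d b) = pure k L H (single k c \<otimes>\<^bsub>L\<^esub> (ev a d \<odot>\<^bsub>L\<^esub> single k d)) (xpow a \<otimes>\<^bsub>H\<^esub> xpow b)"
    unfolding e_def
    by (rule smash_mult_pure[OF module_L module_H bilinear_mult[OF assoc_L] bilinear_H linear_R])
      (use c d k in \<open>auto intro!: single_L xpow_H Lm.smult_closed R_pure\<close>)
  also have "single k c \<otimes>\<^bsub>L\<^esub> (ev a d \<odot>\<^bsub>L\<^esub> single k d) = ev a d \<odot>\<^bsub>L\<^esub> single k (c \<otimes>\<^bsub>C\<^esub> d)"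
    using linear_map_smult[OF bilinear_right[OF bilinear_mult[OF assoc_L] single_L[OF c]] k(1) single_L[OF d]]
    by (simp add: single_L_mult)
  also have "xpow a \<otimes>\<^bsub>H\<^esub> xpow b = chi a b \<odot>\<^bsub>H\<^esub> xpow (a + b)" by (rule xpow_mult[OF a b])
  also have "pure k L H (ev a d \<odot>\<^bsub>L\<^esub> single k (c \<otimes>\<^bsub>C\<^esub> d)) (chi a b \<odot>\<^bsub>H\<^esub> xpow (a + b))
    = ev a d \<odot>\<^bsub>LH\<^esub> pure k L H (single k (c \<otimes>\<^bsub>C\<^esub> d)) (chi a b \<odot>\<^bsub>H\<^esub> xpow (a + b))"
    by (rule linear_map_smult[OF bilinear_left[OF bp Hm.smult_closed[OF k(2) xpow_H]] k(1) cd])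
  also have "pure k L H (single k (c \<otimes>\<^bsub>C\<^esub> d)) (chi a b \<odot>\<^bsub>H\<^esub> xpow (a + b)) = chi a b \<odot>\<^bsub>LH\<^esub> e (c \<otimes>\<^bsub>C\<^esub> d) (a + b)"
    unfolding e_def by (rule linear_map_smult[OF bilinear_right[OF bp cd] k(2) xpow_H])
  finally show ?thesis
    using k e_LH[of "c \<otimes>\<^bsub>C\<^esub> d"] c d by (simp add: LHm.smult_assoc1)
qed

text \<open>The group-like \<open>c\<close> is doubled, the braided coproduct splits x^a into x^b
  (x) x^d, and \<open>W\<close> carries the second copy of \<open>c\<close> across x^b, where it
  becomes c g^b.\<close>

lemma smash_comult_e:
  assumes c: "c \<in> carrier C" and a: "exps a"
  shows "smash_comult k L H W (e c a) = (\<Oplus>\<^bsub>tensor k LH LH\<^esub>p\<in>splits a. gam (fst p) (snd p) \<odot>\<^bsub>tensor k LH LH\<^esub>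
      pure k LH LH (e c (fst p)) (e (c \<otimes>\<^bsub>C\<^esub> grp (fst p)) (snd p)))"
proof -
  let ?LL = "tensor k L L" and ?HH = "tensor k H H" and ?T = "tensor k LH LH"
  note mLL = module_tensor[OF module_L module_L] and mHH = module_tensor[OF module_H module_H]
  note mLH2 = module_tensor[OF module_LH module_LH] and mLLHH = module_tensor[OF mLL mHH]
  interpret T2: module k ?T by (rule mLH2)
  interpret HH: module k ?HH by (rule mHH)
  interpret LLHH: module k "tensor k ?LL ?HH" by (rule mLLHH)
  let ?x = "single k c" let ?xx = "pure k L L ?x ?x"
  have x: "?x \<in> carrier L" using single_L[OF c] .
  have xx: "?xx \<in> carrier ?LL" by (rule pure_closed[OF module_L module_L x x])
  have hh: "pure k H H (xpow b) (xpow d) \<in> carrier ?HH" for b d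
    by (rule pure_closed[OF module_H module_H xpow_H xpow_H])
  note am = apply_middle[OF module_L module_L module_H module_H module_H module_L linear_W]
  note lin = linear_map_comp[OF bilinear_right[OF bilinear_pure[OF mLL mHH] xx] am(1)]
  have "smash_comult k L H W (e c a) = apply_middle k L L H H H L W (pure k ?LL ?HH ?xx (comult H (xpow a)))"
    unfolding smash_comult_def e_def
    using tensor_map_pure[OF module_L module_H mLL mHH linear_comult_L linear_comult_H x xpow_H]
    by (simp add: comult_L[OF c])
  also have "\<dots> = (\<Oplus>\<^bsub>?T\<^esub>p\<in>splits a. gam (fst p) (snd p) \<odot>\<^bsub>?T\<^esub>
      apply_middle k L L H H H L W (pure k ?LL ?HH ?xx (pure k H H (xpow (fst p)) (xpow (snd p)))))"
    unfolding xpow_comult[OF a] by (rule linear_map_lincomb[OF mHH mLH2 lin finite_splits gam_closed hh])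
  also have "\<dots> = (\<Oplus>\<^bsub>?T\<^esub>p\<in>splits a. gam (fst p) (snd p) \<odot>\<^bsub>?T\<^esub>
      pure k LH LH (e c (fst p)) (e (c \<otimes>\<^bsub>C\<^esub> grp (fst p)) (snd p)))"
  proof (rule T2.finsum_cong')
    show "(\<lambda>p. gam (fst p) (snd p) \<odot>\<^bsub>?T\<^esub> pure k LH LH (e c (fst p)) (e (c \<otimes>\<^bsub>C\<^esub> grp (fst p)) (snd p)))
        \<in> splits a \<rightarrow> carrier ?T"
      by (intro funcsetI T2.smult_closed gam_closed pure_closed module_LH e_LH C.m_closed grp_closed c)
    fix p
    have "apply_middle k L L H H H L W (pure k ?LL ?HH ?xx (pure k H H (xpow (fst p)) (xpow (snd p))))
      = pure k LH LH (e c (fst p)) (e (c \<otimes>\<^bsub>C\<^esub> grp (fst p)) (snd p))"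
      unfolding e_def
      by (rule am(2)[OF x x xpow_H xpow_H xpow_H _ W_pure[OF c]]) (intro single_L C.m_closed grp_closed c)
    then show "gam (fst p) (snd p) \<odot>\<^bsub>?T\<^esub> apply_middle k L L H H H L W
        (pure k ?LL ?HH ?xx (pure k H H (xpow (fst p)) (xpow (snd p))))
      = gam (fst p) (snd p) \<odot>\<^bsub>?T\<^esub> pure k LH LH (e c (fst p)) (e (c \<otimes>\<^bsub>C\<^esub> grp (fst p)) (snd p))" by simp
  qed simp
  finally show ?thesis .
qed

lemma bilinear_counit: "bilinear k L H (self_module k) (\<lambda>x y. counit L x \<otimes> counit H y)"
  using bilinear_comp_args[OF bilinear_mult[OF assoc_self] linear_counit_L linear_counit_H]
  by (simp add: self_module_def)

sublocale Sg: hopf_graded k C t g gs n Sm e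
proof (intro hopf_graded.intro hopf_graded_axioms.intro hopf_datum_axioms)
  show "module k Sm" by (rule module_Sm)
  show "bilinear k Sm Sm Sm (monoid.mult Sm)"
    using bilinear_smash_mult[OF module_L module_H bilinear_mult[OF assoc_L] bilinear_H linear_R]
    by (simp add: bilinear_def linear_map_def Sm_simps)
  show "\<one>\<^bsub>Sm\<^esub> = e \<one>\<^bsub>C\<^esub> {#}" by (simp add: Sm_simps e_def L_simps H_simps)
  show "linear_map k Sm (tensor k Sm Sm) (comult Sm)"
    using smash_comult[OF module_L module_H linear_comult_L linear_comult_H linear_W]
    by (simp add: linear_map_def Sm_simps tensor_Sm)
  show "linear_map k Sm (self_module k) (counit Sm)"
    using linear_tensor_lift[OF module_L module_H module_self bilinear_counit]
    by (simp add: linear_map_def Sm_simps)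
  show "spans k Sm {e c a | c a. c \<in> carrier C \<and> exps a}"
    by (rule spans_record_cong[OF _ _ _ _ spans_LH]) (simp_all add: Sm_simps)
  show "e c a \<otimes>\<^bsub>Sm\<^esub> e d b = (ev a d \<otimes> chi a b) \<odot>\<^bsub>Sm\<^esub> e (c \<otimes>\<^bsub>C\<^esub> d) (a + b)"
    if "c \<in> carrier C" "d \<in> carrier C" "exps a" "exps b" for c d a b
    using smash_mult_e[OF that] by (simp add: Sm_simps)
  show "comult Sm (e c a) = (\<Oplus>\<^bsub>tensor k Sm Sm\<^esub>p\<in>splits a. gam (fst p) (snd p) \<odot>\<^bsub>tensor k Sm Sm\<^esub>
      pure k Sm Sm (e c (fst p)) (e (c \<otimes>\<^bsub>C\<^esub> grp (fst p)) (snd p)))"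
    if "c \<in> carrier C" "exps a" for c a
    unfolding tensor_Sm using smash_comult_e[OF that] by (simp add: Sm_simps)
  show "counit Sm (e c a) = (if a = {#} then \<one> else \<zero>)" if "c \<in> carrier C" "exps a" for c a
    unfolding Sm_simps e_def
    using tensor_lift_pure[OF module_L module_H module_self bilinear_counit single_L[OF that(1)] xpow_H]
    by (simp add: counit_L[OF that(1)] xpow_counit[OF that(2)])
  show "e c a = \<zero>\<^bsub>Sm\<^esub>" if "c \<in> carrier C" "exps a" "i \<in> T" "n i \<le> count a i" for c a i
  proof -
    have "xpow a = \<zero>\<^bsub>H\<^esub>" using that by (intro xpow_zero_H) (auto simp: reduced_def not_less)
    then show ?thesis
      using bilinear_zero(1)[OF bilinear_pure[OF module_L module_H] module_L module_H module_LH single_L[OF that(1)]]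
      by (simp add: e_def Sm_simps)
  qed
qed

lemma smash_biproduct_LH: "smash_biproduct k L H R W"
  unfolding smash_biproduct_def
  using assoc_L coalgebra_L assoc_H coalgebra_H linear_R linear_W Sg.bialgebra_S by blast

text \<open>Defined as a lift from the tensor product, so that well-definedness and linearity come
  from the universal property and no basis of the tensor product is needed.\<close>

definition sg where "sg = tensor_lift k A (bil_ext A (\<lambda>c u. mon c (dec u)))"

lemma dec_U: "u \<in> U \<Longrightarrow> exps (dec u)"
  by (elim imageE) (simp add: dec_enc reduced_def)

lemma bilinear_sg: "bilinear k L H A (bil_ext A (\<lambda>c u. mon c (dec u)))"
  by (intro bilinear_ext_LH Amod.module_axioms mon_closed dec_U)

text \<open>Beyond the bounds both sides vanish: the left one because \<open>xpow a\<close> does,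
  the right one by \<open>mon_zero\<close>.\<close>

lemma sg_e:
  assumes c: "c \<in> carrier C" and a: "exps a"
  shows "sg (e c a) = mon c a"
  unfolding sg_def e_def tensor_lift_pure[OF module_L module_H Amod.module_axioms bilinear_sg single_L[OF c] xpow_H]
  using mon_zero[OF c a] a
  by (subst bil_ext_LH[OF Amod.module_axioms bilinear_sg c])
    (auto simp: dec_enc mon_closed[OF c a] reduced_def not_less)

lemma bialgebra_iso_sg: "bialgebra_iso k Sm (pointed_hopf k C t n gs g) sg"
proof (rule Sg.bialgebra_iso_sg)
  show "linear_map k Sm A sg"
    using linear_tensor_lift[OF module_L module_H Amod.module_axioms bilinear_sg]
    by (simp add: linear_map_def Sm_simps sg_def)
qed (rule sg_e)

end

theorem theorem5p1:
  fixes k :: "('k, 'm) ring_scheme"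
    and C :: "('c, 'n) monoid_scheme"
    and t :: nat
    and g :: "nat \<Rightarrow> 'c"
    and gs :: "nat \<Rightarrow> 'c \<Rightarrow> 'k"
    and n :: "nat \<Rightarrow> nat"
  assumes alg_closed: "algebraically_closed k"
    and char_0: "\<And>m::nat. m > 0 \<Longrightarrow> [m] \<cdot>\<^bsub>k\<^esub> \<one>\<^bsub>k\<^esub> \<noteq> \<zero>\<^bsub>k\<^esub>"
    and C: "comm_group C" "finite (carrier C)"
    and t: "t > 0"
    and g: "\<And>l. l \<in> {1..t} \<Longrightarrow> g l \<in> carrier C"
    and gs: "\<And>l. l \<in> {1..t} \<Longrightarrow> gs l \<in> hom C (units_of k)"
    and prim: "\<And>l. l \<in> {1..t} \<Longrightarrow> primitive_root_of_unity k (n l) (gs l (g l))"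
    and skew: "\<And>r l. r \<in> {1..t} \<Longrightarrow> l \<in> {1..t} \<Longrightarrow> r \<noteq> l \<Longrightarrow>
                 gs r (g l) = inv\<^bsub>k\<^esub> (gs l (g r))"
  shows "\<exists>(H :: ('k, nat \<Rightarrow> 'k) bialg) R W \<phi>.
           smash_biproduct k (group_algebra k C) H R W \<and>
           bialgebra_iso k (smash k (group_algebra k C) H R W) (pointed_hopf k C t n gs g) \<phi>"
proof -
  interpret K: algebraically_closed k by (rule alg_closed)
  interpret D: hopf_datum k C t g gs n
    by (intro hopf_datum.intro base_field.intro hopf_datum_axioms.intro K.field_axioms C(1) g gs prim skew)
  show ?thesis
    using D.smash_biproduct_LH D.bialgebra_iso_sg by blast
qed

end
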